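(* Let $d\ge 2$ and let $\Omega$ be a bounded domain in $\mathbb R^d$. Let $\{\lambda_j\}_{j\ge1}$ be the Dirichlet eigenvalues of the Laplacian on $\Omega$ and $\{u_j\}_{j\ge 1}$ a corresponding $L^2(\Omega)$-orthonormal set of eigenfunctions. Then for any nonzero $\phi\in H^1_0(\Omega)\cap L^{\infty}(\Omega)$ and any $t>0$, $$\sum_{j=1}^{\infty}e^{-\lambda_{j}t}\|\phi u_j\|_2^2\geq (4\pi t)^{-d/2}\|\phi\|_2^2\,e^{-\frac{\|\nabla\phi\|_2^2}{\|\phi\|_2^2}\,t}.$$ Moreover, $$\sum_{j=1}^{\infty}e^{-\lambda_{j}t}\geq \frac{|\Omega|}{(4\pi t)^{\frac{d}{2}}}-\frac{1}{(4\pi t)^{\frac{d}{2}}}\cdot\frac{\|\nabla\phi\|_2^2\,t+|\Omega|\cdot\|\phi\|_{\infty}^2-\|\phi\|_2^2}{\|\phi\|_{\infty}^2}.$$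
   Context: $-\Delta_\Omega^D$ is the (nonnegative) self-adjoint realization of the Laplacian in $L^2(\Omega)$ with Dirichlet boundary conditions (form domain $H^1_0(\Omega)$); $0<\lambda_1\le\lambda_2\le\dots$ are its eigenvalues repeated according to multiplicity. $\|\cdot\|_2$, $\|\cdot\|_\infty$ are the norms of $L^2(\Omega)$, $L^\infty(\Omega)$; functions $\phi$ are real-valued; $|\Omega|$ is Lebesgue measure. *)

theory Defs
  imports "HOL-Analysis.Analysis" "HOL-Probability.Essential_Supremum"
begin

text \<open>
  Elements of the Lebesgue and Sobolev spaces over \<open>\<Omega>\<close> are represented by functions on the whole
  space of which only the values on \<open>\<Omega>\<close>, up to null sets, matter. The Hilbert space is the complex
  \<open>L\<^sup>2(\<Omega>)\<close>, so eigenfunctions may be complex-valued.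
\<close>

definition L2 :: "(real ^ 'n) set \<Rightarrow> (real ^ 'n \<Rightarrow> 'b::real_normed_vector) set" where
  "L2 \<Omega> = {f \<in> borel_measurable (lebesgue_on \<Omega>). integrable (lebesgue_on \<Omega>) (\<lambda>x. (norm (f x))\<^sup>2)}"

definition L2_norm :: "(real ^ 'n) set \<Rightarrow> (real ^ 'n \<Rightarrow> 'b::real_normed_vector) \<Rightarrow> real" where
  "L2_norm \<Omega> f = sqrt (LINT x|lebesgue_on \<Omega>. (norm (f x))\<^sup>2)"

definition L2_inner :: "(real ^ 'n) set \<Rightarrow> (real ^ 'n \<Rightarrow> complex) \<Rightarrow> (real ^ 'n \<Rightarrow> complex) \<Rightarrow> complex" where
  "L2_inner \<Omega> f g = (LINT x|lebesgue_on \<Omega>. f x * cnj (g x))"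

definition Linf :: "(real ^ 'n) set \<Rightarrow> (real ^ 'n \<Rightarrow> real) set" where
  "Linf \<Omega> = {f \<in> borel_measurable (lebesgue_on \<Omega>). esssup (lebesgue_on \<Omega>) (\<lambda>x. ereal \<bar>f x\<bar>) < \<infinity>}"

definition Linf_norm :: "(real ^ 'n) set \<Rightarrow> (real ^ 'n \<Rightarrow> real) \<Rightarrow> real" where
  "Linf_norm \<Omega> f = real_of_ereal (esssup (lebesgue_on \<Omega>) (\<lambda>x. ereal \<bar>f x\<bar>))"

definition partial :: "'n \<Rightarrow> (real ^ 'n \<Rightarrow> complex) \<Rightarrow> real ^ 'n \<Rightarrow> complex" where
  "partial i f x = frechet_derivative f (at x) (axis i 1)"

definition grad :: "(real ^ 'n \<Rightarrow> complex) \<Rightarrow> real ^ 'n \<Rightarrow> complex ^ 'n" where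
  "grad f x = (\<chi> i. partial i f x)"

fun Ck :: "nat \<Rightarrow> (real ^ 'n \<Rightarrow> complex) \<Rightarrow> bool" where
  "Ck 0 f \<longleftrightarrow> continuous_on UNIV f"
| "Ck (Suc k) f \<longleftrightarrow> (\<forall>x. f differentiable (at x)) \<and> (\<forall>i. Ck k (partial i f))"

definition test_functions :: "(real ^ 'n) set \<Rightarrow> (real ^ 'n \<Rightarrow> complex) set" where
  "test_functions \<Omega> =
    {\<psi>. (\<forall>k. Ck k \<psi>) \<and> compact (closure {x. \<psi> x \<noteq> 0}) \<and> closure {x. \<psi> x \<noteq> 0} \<subseteq> \<Omega>}"

definition has_weak_gradient ::
  "(real ^ 'n) set \<Rightarrow> (real ^ 'n \<Rightarrow> complex) \<Rightarrow> (real ^ 'n \<Rightarrow> complex ^ 'n) \<Rightarrow> bool" where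
  "has_weak_gradient \<Omega> u g \<longleftrightarrow> (\<forall>\<psi>\<in>test_functions \<Omega>. \<forall>i.
    (LINT x|lebesgue_on \<Omega>. u x * partial i \<psi> x) = - (LINT x|lebesgue_on \<Omega>. g x $ i * \<psi> x))"

definition H1 :: "(real ^ 'n) set \<Rightarrow> (real ^ 'n \<Rightarrow> complex) set" where
  "H1 \<Omega> = {u \<in> L2 \<Omega>. \<exists>g\<in>L2 \<Omega>. has_weak_gradient \<Omega> u g}"

text \<open>For \<open>u \<in> H1 \<Omega>\<close> with \<open>\<Omega>\<close> open, the weak gradient is unique up to null sets,
  so the choice below does not affect any integral.\<close>

definition weak_grad :: "(real ^ 'n) set \<Rightarrow> (real ^ 'n \<Rightarrow> complex) \<Rightarrow> real ^ 'n \<Rightarrow> complex ^ 'n" where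
  "weak_grad \<Omega> u = (SOME g. g \<in> L2 \<Omega> \<and> has_weak_gradient \<Omega> u g)"

text \<open>The closure of the test functions in the \<open>H\<^sup>1\<close> norm.\<close>

definition H10 :: "(real ^ 'n) set \<Rightarrow> (real ^ 'n \<Rightarrow> complex) set" where
  "H10 \<Omega> = {u \<in> H1 \<Omega>. \<exists>\<psi>::nat \<Rightarrow> real ^ 'n \<Rightarrow> complex. (\<forall>k. \<psi> k \<in> test_functions \<Omega>)
      \<and> (\<lambda>k. L2_norm \<Omega> (\<lambda>x. \<psi> k x - u x)) \<longlonglongrightarrow> 0
      \<and> (\<lambda>k. L2_norm \<Omega> (\<lambda>x. grad (\<psi> k) x - weak_grad \<Omega> u x)) \<longlonglongrightarrow> 0}"

definition dirichlet_form ::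
  "(real ^ 'n) set \<Rightarrow> (real ^ 'n \<Rightarrow> complex) \<Rightarrow> (real ^ 'n \<Rightarrow> complex) \<Rightarrow> complex" where
  "dirichlet_form \<Omega> u v =
    (\<Sum>i\<in>UNIV. L2_inner \<Omega> (\<lambda>x. weak_grad \<Omega> u x $ i) (\<lambda>x. weak_grad \<Omega> v x $ i))"

text \<open>The graph of the nonnegative self-adjoint operator associated with the Dirichlet form:
  \<open>u\<close> lies in the operator domain and is mapped to \<open>f\<close>.\<close>

definition dirichlet_laplacian ::
  "(real ^ 'n) set \<Rightarrow> (real ^ 'n \<Rightarrow> complex) \<Rightarrow> (real ^ 'n \<Rightarrow> complex) \<Rightarrow> bool" where
  "dirichlet_laplacian \<Omega> u f \<longleftrightarrow>
    u \<in> H10 \<Omega> \<and> f \<in> L2 \<Omega> \<and> (\<forall>v\<in>H10 \<Omega>. dirichlet_form \<Omega> u v = L2_inner \<Omega> f v)"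

definition eigenspace :: "(real ^ 'n) set \<Rightarrow> real \<Rightarrow> (real ^ 'n \<Rightarrow> complex) set" where
  "eigenspace \<Omega> \<mu> = {u. dirichlet_laplacian \<Omega> u (\<lambda>x. complex_of_real \<mu> * u x)}"

text \<open>The eigenspace, modulo equality almost everywhere, has a basis of \<open>m\<close> elements.
  The case \<open>m = 0\<close> says that \<open>\<mu>\<close> is not an eigenvalue.\<close>

definition has_multiplicity :: "(real ^ 'n) set \<Rightarrow> real \<Rightarrow> nat \<Rightarrow> bool" where
  "has_multiplicity \<Omega> \<mu> m \<longleftrightarrow> (\<exists>b::nat \<Rightarrow> real ^ 'n \<Rightarrow> complex.
      (\<forall>i<m. b i \<in> eigenspace \<Omega> \<mu>)
    \<and> (\<forall>c::nat \<Rightarrow> complex. (AE x in lebesgue_on \<Omega>. (\<Sum>i<m. c i * b i x) = 0) \<longrightarrow> (\<forall>i<m. c i = 0))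
    \<and> (\<forall>w\<in>eigenspace \<Omega> \<mu>. \<exists>c::nat \<Rightarrow> complex. AE x in lebesgue_on \<Omega>. w x = (\<Sum>i<m. c i * b i x)))"

text \<open>\<open>lam\<close> lists all eigenvalues in nondecreasing order, each repeated according to its
  multiplicity; the enumeration starts at index \<open>0\<close>.\<close>

definition dirichlet_eigenvalues :: "(real ^ 'n) set \<Rightarrow> (nat \<Rightarrow> real) \<Rightarrow> bool" where
  "dirichlet_eigenvalues \<Omega> lam \<longleftrightarrow>
    incseq lam \<and> (\<forall>\<mu>. finite {j. lam j = \<mu>} \<and> has_multiplicity \<Omega> \<mu> (card {j. lam j = \<mu>}))"

end

theory Submission
  imports Defs "HOL-Complex_Analysis.Great_Picard" "HOL-Probability.Characteristic_Functions"
begin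

text \<open>
  For \<open>\<xi> \<in> \<real>\<^sup>d\<close> the function \<open>exp (i \<xi> \<bullet> x) \<phi>(x)\<close> lies in \<open>H\<^sup>1\<^sub>0(\<Omega>)\<close> and has energy
  \<open>\<parallel>\<nabla>\<phi>\<parallel>\<^sup>2 + |\<xi>|\<^sup>2 \<parallel>\<phi>\<parallel>\<^sup>2\<close>. Its coefficients in the eigenbasis have square sum \<open>\<parallel>\<phi>\<parallel>\<^sup>2\<close>, so Jensen's
  inequality bounds the sum of \<open>exp (- \<lambda>\<^sub>j t)\<close> against the squared coefficients from below.
  The \<open>j\<close>-th coefficient is, up to conjugation, the Fourier transform of \<open>\<phi> u\<^sub>j\<close> at \<open>\<xi>\<close>; integrating over
  \<open>\<xi>\<close> gives the first estimate, and \<open>\<parallel>\<phi> u\<^sub>j\<parallel> \<le> \<parallel>\<phi>\<parallel>\<^sub>\<infinity>\<close> and \<open>exp (- s) \<ge> 1 - s\<close> the second.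

  That the eigenfunctions are complete follows by minimising the energy on their orthogonal
  complement. The compactness needed here, as well as the growth of \<open>\<lambda>\<^sub>j\<close> that makes the heat trace
  finite, come from the inequality
  \<open>(2 \<pi>)\<^sup>d \<parallel>u\<parallel>\<^sup>2 \<le> C a \<parallel>\<nabla>u\<parallel>\<^sup>2 + \<integral> exp (- a |\<xi>|\<^sup>2) |F u(\<xi>)|\<^sup>2 d\<xi>\<close> on \<open>H\<^sup>1\<^sub>0(\<Omega>)\<close>,
  where \<open>F\<close> denotes the Fourier transform.
\<close>

text \<open>The hypotheses say only that \<open>lam\<close> lists the eigenvalues with multiplicity
  and that \<open>u\<close> is orthonormal; Jensen's inequality needs the full square sum, so the
  completeness of \<open>u\<close> has to be derived. The integration over \<xi> is the other
  delicate point: the exact step would be Plancherel's identity for \<phi> \<open>u j\<close>.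
  Instead an extra weight exp(- a |\<xi>|^2) is carried along. It makes the double integrals
  absolutely convergent, so that the \<xi>-integral can be performed first and leaves a Gaussian
  kernel whose total mass is (2 pi)^d, whatever a is. Bounding the resulting double integral from
  above gives one half of Plancherel with the sharp constant, which is all that the estimate uses; a
  tends to 0 at the end. Bounding it from below, by translation estimates for test functions, gives
  the inequality with the gradient term. The final constant is (pi / t)^(d/2) / (2 pi)^d = (4 pi
  t)^(-d/2). Modulation by plane waves is what forces complex scalars although \<phi> is
  real.\<close>

lemma L2_borel_measurable: "f \<in> L2 \<Omega> \<Longrightarrow> f \<in> borel_measurable (lebesgue_on \<Omega>)"
  and L2_integrable: "f \<in> L2 \<Omega> \<Longrightarrow> integrable (lebesgue_on \<Omega>) (\<lambda>x. (norm (f x))\<^sup>2)"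
  by (auto simp: L2_def)

subsection \<open>The space \<open>L\<^sup>2(\<Omega>)\<close>\<close>

lemma borel_measurable_cnj [measurable (raw)]:
  "f \<in> borel_measurable M \<Longrightarrow> (\<lambda>x. cnj (f x)) \<in> borel_measurable M"
  by (rule borel_measurable_continuous_on[OF continuous_on_cnj[OF continuous_on_id]])

lemma L2_norm_nonneg [simp]: "0 \<le> L2_norm \<Omega> f"
  by (simp add: L2_norm_def)

lemma L2_norm_power2: "(L2_norm \<Omega> f)\<^sup>2 = (LINT x|lebesgue_on \<Omega>. (norm (f x))\<^sup>2)"
  by (simp add: L2_norm_def)

lemma L2_dominated:
  fixes f :: "real ^ 'n \<Rightarrow> 'b::euclidean_space" and g :: "real ^ 'n \<Rightarrow> 'c::real_normed_vector"
  assumes f: "f \<in> borel_measurable (lebesgue_on \<Omega>)" and g: "g \<in> L2 \<Omega>"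
    and le: "AE x in lebesgue_on \<Omega>. norm (f x) \<le> C * norm (g x)"
  shows "f \<in> L2 \<Omega>"
proof -
  have "integrable (lebesgue_on \<Omega>) (\<lambda>x. (norm (f x))\<^sup>2)"
  proof (rule Bochner_Integration.integrable_bound)
    show "integrable (lebesgue_on \<Omega>) (\<lambda>x. C\<^sup>2 * (norm (g x))\<^sup>2)"
      using L2_integrable[OF g] by simp
    show "AE x in lebesgue_on \<Omega>. norm ((norm (f x))\<^sup>2) \<le> norm (C\<^sup>2 * (norm (g x))\<^sup>2)"
      using le
    proof eventually_elim
      case (elim x)
      then have "(norm (f x))\<^sup>2 \<le> (C * norm (g x))\<^sup>2"
        by (intro power_mono) auto
      then show ?case by (simp add: power_mult_distrib)
    qed
    show "(\<lambda>x. (norm (f x))\<^sup>2) \<in> borel_measurable (lebesgue_on \<Omega>)"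
      using f by measurable
  qed
  with f show ?thesis by (simp add: L2_def)
qed

lemma L2_bounded_mult:
  fixes f g :: "real ^ 'n \<Rightarrow> complex"
  assumes "f \<in> borel_measurable (lebesgue_on \<Omega>)" "AE x in lebesgue_on \<Omega>. norm (f x) \<le> C" "g \<in> L2 \<Omega>"
  shows "(\<lambda>x. f x * g x) \<in> L2 \<Omega>"
proof (rule L2_dominated[OF _ assms(3)])
  show "(\<lambda>x. f x * g x) \<in> borel_measurable (lebesgue_on \<Omega>)"
    using assms(1) L2_borel_measurable[OF assms(3)] by measurable
  show "AE x in lebesgue_on \<Omega>. norm (f x * g x) \<le> C * norm (g x)"
    using assms(2) by eventually_elim (simp add: norm_mult mult_right_mono)
qed

lemma L2_norm_mult_integrable:
  fixes f :: "real ^ 'n \<Rightarrow> 'b::euclidean_space" and g :: "real ^ 'n \<Rightarrow> 'c::euclidean_space"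
  assumes f: "f \<in> L2 \<Omega>" and g: "g \<in> L2 \<Omega>"
  shows "integrable (lebesgue_on \<Omega>) (\<lambda>x. norm (f x) * norm (g x))"
proof (rule Bochner_Integration.integrable_bound)
  show "integrable (lebesgue_on \<Omega>) (\<lambda>x. (norm (f x))\<^sup>2 + (norm (g x))\<^sup>2)"
    using L2_integrable[OF f] L2_integrable[OF g] by simp
  show "AE x in lebesgue_on \<Omega>. norm (norm (f x) * norm (g x)) \<le> norm ((norm (f x))\<^sup>2 + (norm (g x))\<^sup>2)"
  proof (intro AE_I2)
    fix x
    have "2 * (norm (f x) * norm (g x)) \<le> (norm (f x))\<^sup>2 + (norm (g x))\<^sup>2"
      using sum_squares_bound[of "norm (f x)" "norm (g x)"] by simp
    moreover have "0 \<le> norm (f x) * norm (g x)" by simp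
    ultimately have "norm (f x) * norm (g x) \<le> (norm (f x))\<^sup>2 + (norm (g x))\<^sup>2" by linarith
    then show "norm (norm (f x) * norm (g x)) \<le> norm ((norm (f x))\<^sup>2 + (norm (g x))\<^sup>2)"
      by simp
  qed
  show "(\<lambda>x. norm (f x) * norm (g x)) \<in> borel_measurable (lebesgue_on \<Omega>)"
    using L2_borel_measurable[OF f] L2_borel_measurable[OF g] by measurable
qed

lemma L2_mult_integrable:
  fixes f g :: "real ^ 'n \<Rightarrow> complex"
  assumes f: "f \<in> L2 \<Omega>" and g: "g \<in> L2 \<Omega>"
  shows "integrable (lebesgue_on \<Omega>) (\<lambda>x. f x * g x)"
proof (rule Bochner_Integration.integrable_bound[OF L2_norm_mult_integrable[OF f g]])
  show "(\<lambda>x. f x * g x) \<in> borel_measurable (lebesgue_on \<Omega>)"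
    using L2_borel_measurable[OF f] L2_borel_measurable[OF g] by measurable
qed (simp add: norm_mult)

lemma L2_cnj: "f \<in> L2 \<Omega> \<Longrightarrow> (\<lambda>x. cnj (f x)) \<in> L2 \<Omega>"
  by (auto simp: L2_def intro: borel_measurable_cnj)

lemma L2_Cauchy_Schwarz:
  fixes f :: "real ^ 'n \<Rightarrow> 'b::euclidean_space" and g :: "real ^ 'n \<Rightarrow> 'c::euclidean_space"
  assumes f: "f \<in> L2 \<Omega>" and g: "g \<in> L2 \<Omega>"
  shows "(LINT x|lebesgue_on \<Omega>. norm (f x) * norm (g x)) \<le> L2_norm \<Omega> f * L2_norm \<Omega> g"
proof -
  let ?M = "lebesgue_on \<Omega>"
  have 1: "(\<integral>\<^sup>+x. ennreal (norm (f x)) * ennreal (norm (g x)) \<partial>?M)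
      = ennreal (LINT x|?M. norm (f x) * norm (g x))"
    using L2_norm_mult_integrable[OF f g]
    by (subst nn_integral_eq_integral[symmetric]) (auto simp: ennreal_mult)
  have 2: "(\<integral>\<^sup>+x. ennreal (norm (f x)) ^ 2 \<partial>?M) = ennreal ((L2_norm \<Omega> f)\<^sup>2)"
    using L2_integrable[OF f] unfolding L2_norm_power2
    by (subst nn_integral_eq_integral[symmetric]) (auto simp: ennreal_power)
  have 3: "(\<integral>\<^sup>+x. ennreal (norm (g x)) ^ 2 \<partial>?M) = ennreal ((L2_norm \<Omega> g)\<^sup>2)"
    using L2_integrable[OF g] unfolding L2_norm_power2
    by (subst nn_integral_eq_integral[symmetric]) (auto simp: ennreal_power)
  have "(\<integral>\<^sup>+x. ennreal (norm (f x)) * ennreal (norm (g x)) \<partial>?M)\<^sup>2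
      \<le> (\<integral>\<^sup>+x. ennreal (norm (f x)) ^ 2 \<partial>?M) * (\<integral>\<^sup>+x. ennreal (norm (g x)) ^ 2 \<partial>?M)"
    using L2_borel_measurable[OF f] L2_borel_measurable[OF g]
    by (intro Cauchy_Schwarz_nn_integral) auto
  then have "ennreal ((LINT x|?M. norm (f x) * norm (g x))\<^sup>2) \<le> ennreal ((L2_norm \<Omega> f)\<^sup>2 * (L2_norm \<Omega> g)\<^sup>2)"
    unfolding 1 2 3 by (simp add: ennreal_power ennreal_mult)
  then have "(LINT x|?M. norm (f x) * norm (g x))\<^sup>2 \<le> (L2_norm \<Omega> f * L2_norm \<Omega> g)\<^sup>2"
    by (simp add: power_mult_distrib ennreal_le_iff)
  then show ?thesis
    by (rule power2_le_imp_le) simp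
qed

lemma L2_inner_Cauchy_Schwarz:
  assumes f: "f \<in> L2 \<Omega>" and g: "g \<in> L2 \<Omega>"
  shows "norm (L2_inner \<Omega> f g) \<le> L2_norm \<Omega> f * L2_norm \<Omega> g"
proof -
  have "norm (L2_inner \<Omega> f g) \<le> (LINT x|lebesgue_on \<Omega>. norm (f x * cnj (g x)))"
    unfolding L2_inner_def by (rule integral_norm_bound)
  also have "\<dots> \<le> L2_norm \<Omega> f * L2_norm \<Omega> g"
    using L2_Cauchy_Schwarz[OF f g] by (simp add: norm_mult)
  finally show ?thesis .
qed

lemma L2_add:
  fixes f g :: "real ^ 'n \<Rightarrow> 'b::euclidean_space"
  assumes f: "f \<in> L2 \<Omega>" and g: "g \<in> L2 \<Omega>"
  shows "(\<lambda>x. f x + g x) \<in> L2 \<Omega>"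
proof -
  note [measurable] = L2_borel_measurable[OF f] L2_borel_measurable[OF g]
  have "integrable (lebesgue_on \<Omega>) (\<lambda>x. (norm (f x + g x))\<^sup>2)"
  proof (rule Bochner_Integration.integrable_bound)
    show "integrable (lebesgue_on \<Omega>) (\<lambda>x. (norm (f x))\<^sup>2 + 2 * (norm (f x) * norm (g x)) + (norm (g x))\<^sup>2)"
      using L2_integrable[OF f] L2_integrable[OF g] L2_norm_mult_integrable[OF f g] by simp
    have "(norm (f x + g x))\<^sup>2 \<le> (norm (f x) + norm (g x))\<^sup>2" for x
      by (intro power_mono norm_triangle_ineq) simp
    then show "AE x in lebesgue_on \<Omega>. norm ((norm (f x + g x))\<^sup>2)
        \<le> norm ((norm (f x))\<^sup>2 + 2 * (norm (f x) * norm (g x)) + (norm (g x))\<^sup>2)"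
      by (intro AE_I2) (simp add: power2_sum algebra_simps)
  qed measurable
  then show ?thesis by (simp add: L2_def)
qed

lemma L2_minus:
  fixes f :: "real ^ 'n \<Rightarrow> 'b::euclidean_space"
  shows "f \<in> L2 \<Omega> \<Longrightarrow> (\<lambda>x. - f x) \<in> L2 \<Omega>"
  by (auto simp: L2_def)

lemma L2_diff:
  fixes f g :: "real ^ 'n \<Rightarrow> 'b::euclidean_space"
  assumes f: "f \<in> L2 \<Omega>" and g: "g \<in> L2 \<Omega>"
  shows "(\<lambda>x. f x - g x) \<in> L2 \<Omega>"
  using L2_add[OF f L2_minus[OF g]] by simp

lemma L2_scale: "f \<in> L2 \<Omega> \<Longrightarrow> (\<lambda>x. c * f x) \<in> L2 \<Omega>" for c :: complex
  by (rule L2_bounded_mult[where C = "norm c"]) auto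

lemma L2_norm_minus: "L2_norm \<Omega> (\<lambda>x. - f x) = L2_norm \<Omega> f"
  by (simp add: L2_norm_def)

lemma L2_norm_minus_commute: "L2_norm \<Omega> (\<lambda>x. f x - g x) = L2_norm \<Omega> (\<lambda>x. g x - f x)"
  by (simp add: L2_norm_def norm_minus_commute)

lemma L2_norm_scale: "L2_norm \<Omega> (\<lambda>x. c * f x) = norm c * L2_norm \<Omega> f" for c :: complex
  by (simp add: L2_norm_def norm_mult power_mult_distrib real_sqrt_mult)

lemma L2_norm_cong_AE:
  assumes "f \<in> borel_measurable (lebesgue_on \<Omega>)" "g \<in> borel_measurable (lebesgue_on \<Omega>)"
    and "AE x in lebesgue_on \<Omega>. norm (f x) = norm (g x)"
  shows "L2_norm \<Omega> f = L2_norm \<Omega> g"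
  unfolding L2_norm_def using assms
  by (intro arg_cong[where f = sqrt] integral_cong_AE) (auto elim: eventually_mono)

lemma L2_norm_triangle:
  fixes f g :: "real ^ 'n \<Rightarrow> 'b::euclidean_space"
  assumes f: "f \<in> L2 \<Omega>" and g: "g \<in> L2 \<Omega>"
  shows "L2_norm \<Omega> (\<lambda>x. f x + g x) \<le> L2_norm \<Omega> f + L2_norm \<Omega> g"
proof (rule power2_le_imp_le)
  have "(L2_norm \<Omega> (\<lambda>x. f x + g x))\<^sup>2
      \<le> (LINT x|lebesgue_on \<Omega>. (norm (f x))\<^sup>2 + 2 * (norm (f x) * norm (g x)) + (norm (g x))\<^sup>2)"
    unfolding L2_norm_power2
  proof (rule integral_mono)
    show "integrable (lebesgue_on \<Omega>) (\<lambda>x. (norm (f x + g x))\<^sup>2)"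
      by (rule L2_integrable[OF L2_add[OF f g]])
    show "integrable (lebesgue_on \<Omega>) (\<lambda>x. (norm (f x))\<^sup>2 + 2 * (norm (f x) * norm (g x)) + (norm (g x))\<^sup>2)"
      using L2_integrable[OF f] L2_integrable[OF g] L2_norm_mult_integrable[OF f g] by simp
    fix x
    have "(norm (f x + g x))\<^sup>2 \<le> (norm (f x) + norm (g x))\<^sup>2"
      by (intro power_mono norm_triangle_ineq) simp
    then show "(norm (f x + g x))\<^sup>2 \<le> (norm (f x))\<^sup>2 + 2 * (norm (f x) * norm (g x)) + (norm (g x))\<^sup>2"
      by (simp add: power2_sum algebra_simps)
  qed
  also have "\<dots> = (L2_norm \<Omega> f)\<^sup>2 + 2 * (LINT x|lebesgue_on \<Omega>. norm (f x) * norm (g x)) + (L2_norm \<Omega> g)\<^sup>2"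
    using L2_integrable[OF f] L2_integrable[OF g] L2_norm_mult_integrable[OF f g]
    by (simp add: L2_norm_power2)
  also have "\<dots> \<le> (L2_norm \<Omega> f + L2_norm \<Omega> g)\<^sup>2"
    using L2_Cauchy_Schwarz[OF f g] by (simp add: power2_sum)
  finally show "(L2_norm \<Omega> (\<lambda>x. f x + g x))\<^sup>2 \<le> (L2_norm \<Omega> f + L2_norm \<Omega> g)\<^sup>2" .
qed simp

lemma L2_norm_diff_le:
  fixes f g :: "real ^ 'n \<Rightarrow> 'b::euclidean_space"
  assumes f: "f \<in> L2 \<Omega>" and g: "g \<in> L2 \<Omega>"
  shows "\<bar>L2_norm \<Omega> f - L2_norm \<Omega> g\<bar> \<le> L2_norm \<Omega> (\<lambda>x. f x - g x)"
  using L2_norm_triangle[OF L2_diff[OF f g] g] L2_norm_triangle[OF L2_diff[OF g f] f]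
    L2_norm_minus_commute[of \<Omega> f g] by simp

lemma L2_norm_tendsto:
  fixes f :: "real ^ 'n \<Rightarrow> 'b::euclidean_space"
  assumes "\<And>k. F k \<in> L2 \<Omega>" "f \<in> L2 \<Omega>" "(\<lambda>k. L2_norm \<Omega> (\<lambda>x. F k x - f x)) \<longlonglongrightarrow> 0"
  shows "(\<lambda>k. L2_norm \<Omega> (F k)) \<longlonglongrightarrow> L2_norm \<Omega> f"
proof -
  have "(\<lambda>k. L2_norm \<Omega> (F k) - L2_norm \<Omega> f) \<longlonglongrightarrow> 0"
    by (rule Lim_null_comparison[OF _ assms(3)])
      (use L2_norm_diff_le[OF assms(1,2)] in simp)
  then show ?thesis by (simp add: LIM_zero_iff)
qed

lemma L2_norm_eq_0_AE:
  fixes f :: "real ^ 'n \<Rightarrow> 'b::euclidean_space"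
  assumes f: "f \<in> L2 \<Omega>" and "L2_norm \<Omega> f = 0"
  shows "AE x in lebesgue_on \<Omega>. f x = 0"
proof -
  have "(LINT x|lebesgue_on \<Omega>. (norm (f x))\<^sup>2) = 0"
    using assms by (simp flip: L2_norm_power2)
  then have "AE x in lebesgue_on \<Omega>. (norm (f x))\<^sup>2 = 0"
    using integral_nonneg_eq_0_iff_AE[OF L2_integrable[OF f]] by simp
  then show ?thesis by simp
qed

lemma L2_inner_tendsto:
  assumes F: "\<And>k. F k \<in> L2 \<Omega>" and f: "f \<in> L2 \<Omega>" and G: "\<And>k. G k \<in> L2 \<Omega>" and g: "g \<in> L2 \<Omega>"
    and lF: "(\<lambda>k. L2_norm \<Omega> (\<lambda>x. F k x - f x)) \<longlonglongrightarrow> 0"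
    and lG: "(\<lambda>k. L2_norm \<Omega> (\<lambda>x. G k x - g x)) \<longlonglongrightarrow> 0"
  shows "(\<lambda>k. L2_inner \<Omega> (F k) (G k)) \<longlonglongrightarrow> L2_inner \<Omega> f g"
proof -
  have eq: "L2_inner \<Omega> (F k) (G k) - L2_inner \<Omega> f g
      = L2_inner \<Omega> (\<lambda>x. F k x - f x) (G k) + L2_inner \<Omega> f (\<lambda>x. G k x - g x)" for k
    using L2_mult_integrable[OF F L2_cnj[OF G]] L2_mult_integrable[OF f L2_cnj[OF G]]
      L2_mult_integrable[OF f L2_cnj[OF g]]
    by (simp add: L2_inner_def left_diff_distrib right_diff_distrib)
  have "(\<lambda>k. L2_inner \<Omega> (F k) (G k) - L2_inner \<Omega> f g) \<longlonglongrightarrow> 0"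
  proof (rule Lim_null_comparison)
    have "norm (L2_inner \<Omega> (F k) (G k) - L2_inner \<Omega> f g)
        \<le> L2_norm \<Omega> (\<lambda>x. F k x - f x) * L2_norm \<Omega> (G k) + L2_norm \<Omega> f * L2_norm \<Omega> (\<lambda>x. G k x - g x)" for k
      unfolding eq
      by (intro norm_triangle_le add_mono L2_inner_Cauchy_Schwarz L2_diff F G f g)
    then show "\<forall>\<^sub>F k in sequentially. norm (L2_inner \<Omega> (F k) (G k) - L2_inner \<Omega> f g)
        \<le> L2_norm \<Omega> (\<lambda>x. F k x - f x) * L2_norm \<Omega> (G k) + L2_norm \<Omega> f * L2_norm \<Omega> (\<lambda>x. G k x - g x)"
      by simp
    show "(\<lambda>k. L2_norm \<Omega> (\<lambda>x. F k x - f x) * L2_norm \<Omega> (G k) + L2_norm \<Omega> f * L2_norm \<Omega> (\<lambda>x. G k x - g x)) \<longlonglongrightarrow> 0"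
      using L2_norm_tendsto[OF G g lG] lF lG by (auto intro!: tendsto_eq_intros)
  qed
  then show ?thesis by (simp add: LIM_zero_iff)
qed

text \<open>Boundedness makes the measure on \<Omega> finite, so that L^2 functions are integrable
  and bounded measurable functions, plane waves among them, lie in L^2. Openness gives measurability
  and the supply of test functions that makes weak gradients unique.\<close>

locale bounded_open =
  fixes \<Omega> :: "(real ^ 'n) set"
  assumes open_dom: "open \<Omega>" and bounded_dom: "bounded \<Omega>"
begin

lemma finite_measure_dom: "finite_measure (lebesgue_on \<Omega>)"
  by (rule finite_measure_lebesgue_on) (use bounded_dom open_dom lmeasurable_open in blast)

lemma dom_sets [measurable, simp]: "\<Omega> \<in> sets lebesgue"
  using open_dom by (simp add: borel_open sets_completionI_sets)

sublocale dom: finite_measure "lebesgue_on \<Omega>"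
  by (rule finite_measure_dom)

lemma continuous_borel_measurable_dom:
  fixes f :: "real ^ 'n \<Rightarrow> 'b::real_normed_vector"
  shows "continuous_on UNIV f \<Longrightarrow> f \<in> borel_measurable (lebesgue_on \<Omega>)"
  by (rule measurable_restrict_space1, rule measurable_completion) (simp add: borel_measurable_continuous_onI)

lemma measure_dom: "measure (lebesgue_on \<Omega>) (space (lebesgue_on \<Omega>)) = measure lebesgue \<Omega>"
  by (simp add: measure_restrict_space space_restrict_space)

lemma bounded_L2:
  fixes f :: "real ^ 'n \<Rightarrow> 'b::euclidean_space"
  assumes "f \<in> borel_measurable (lebesgue_on \<Omega>)" "AE x in lebesgue_on \<Omega>. norm (f x) \<le> C"
  shows "f \<in> L2 \<Omega>"
proof (rule L2_dominated[OF assms(1), of "\<lambda>x. 1::real" C])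
  show "(\<lambda>x. 1::real) \<in> L2 \<Omega>" by (simp add: L2_def)
qed (use assms in simp)

lemma L2_integrable1:
  fixes f :: "real ^ 'n \<Rightarrow> 'b::euclidean_space"
  assumes f: "f \<in> L2 \<Omega>"
  shows "integrable (lebesgue_on \<Omega>) f"
proof -
  have "integrable (lebesgue_on \<Omega>) (\<lambda>x. norm (f x) * norm (1::real))"
    by (rule L2_norm_mult_integrable[OF f]) (simp add: L2_def)
  then show ?thesis
    using L2_borel_measurable[OF f] by (simp add: integrable_norm_iff)
qed

lemma L1_norm_le:
  fixes f :: "real ^ 'n \<Rightarrow> 'b::euclidean_space"
  assumes f: "f \<in> L2 \<Omega>"
  shows "(LINT x|lebesgue_on \<Omega>. norm (f x)) \<le> L2_norm \<Omega> f * sqrt (measure lebesgue \<Omega>)"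
proof -
  have "(LINT x|lebesgue_on \<Omega>. norm (f x) * norm (1::real)) \<le> L2_norm \<Omega> f * L2_norm \<Omega> (\<lambda>x. 1::real)"
    by (rule L2_Cauchy_Schwarz[OF f]) (simp add: L2_def)
  then show ?thesis using measure_dom by (simp add: L2_norm_def)
qed

text \<open>Riesz-Fischer: a subsequence with increments below (1/2)^k in L^2 has summable
  increments in L^1, because the measure is finite, hence converges almost everywhere. Fatou's lemma
  then turns the Cauchy condition into convergence to the pointwise limit.\<close>

lemma L2_complete:
  fixes f :: "nat \<Rightarrow> real ^ 'n \<Rightarrow> 'b::euclidean_space"
  assumes f: "\<And>n. f n \<in> L2 \<Omega>"
    and Cauchy: "\<And>e. e > 0 \<Longrightarrow> \<exists>N. \<forall>m\<ge>N. \<forall>n\<ge>N. L2_norm \<Omega> (\<lambda>x. f m x - f n x) < e"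
  shows "\<exists>g\<in>L2 \<Omega>. (\<lambda>n. L2_norm \<Omega> (\<lambda>x. f n x - g x)) \<longlonglongrightarrow> 0"
proof -
  let ?M = "lebesgue_on \<Omega>"
  note [measurable] = L2_borel_measurable[OF f]
  have "\<forall>k. \<exists>N. \<forall>m\<ge>N. \<forall>n\<ge>N. L2_norm \<Omega> (\<lambda>x. f m x - f n x) < (1/2) ^ k"
    using Cauchy by simp
  then obtain N where N: "\<And>k m n. m \<ge> N k \<Longrightarrow> n \<ge> N k \<Longrightarrow> L2_norm \<Omega> (\<lambda>x. f m x - f n x) < (1/2) ^ k"
    by metis
  \<comment> \<open>The sum keeps \<open>r\<close> monotone and above every \<open>N k\<close>; the
    summand \<open>k\<close> forces it to infinity.\<close>
  define r where "r k = (\<Sum>i\<le>k. N i) + k" for k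
  have r_ge: "N k \<le> r k" for k
    unfolding r_def using member_le_sum[of k "{..k}" N] by simp
  have r_Suc: "r k \<le> r (Suc k)" for k by (simp add: r_def)
  have r_lim: "filterlim r at_top sequentially"
    by (rule filterlim_at_top_mono[OF filterlim_ident]) (simp add: r_def)
  define d where "d k x = f (r (Suc k)) x - f (r k) x" for k x
  have d_L2: "d k \<in> L2 \<Omega>" for k
    unfolding d_def by (intro L2_diff f)
  note [measurable] = L2_borel_measurable[OF d_L2]
  have dk: "(LINT x|?M. norm (d k x)) \<le> (1/2) ^ k * sqrt (measure lebesgue \<Omega>)" for k
  proof -
    have "L2_norm \<Omega> (d k) \<le> (1/2) ^ k"
      unfolding d_def using N[of k "r (Suc k)" "r k"] r_ge[of k] r_Suc[of k] by simp
    then show ?thesis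
      by (intro order.trans[OF L1_norm_le[OF d_L2]] mult_right_mono) auto
  qed
  have "(\<integral>\<^sup>+x. (\<Sum>k. ennreal (norm (d k x))) \<partial>?M) = (\<Sum>k. \<integral>\<^sup>+x. ennreal (norm (d k x)) \<partial>?M)"
    by (rule nn_integral_suminf) measurable
  also have "\<dots> = (\<Sum>k. ennreal (LINT x|?M. norm (d k x)))"
    using L2_integrable1[OF d_L2] by (simp add: nn_integral_eq_integral)
  also have "\<dots> \<le> (\<Sum>k. ennreal ((1/2) ^ k * sqrt (measure lebesgue \<Omega>)))"
    by (intro suminf_le ennreal_leI dk) auto
  also have "\<dots> = ennreal (\<Sum>k. (1/2) ^ k * sqrt (measure lebesgue \<Omega>))"
    by (rule suminf_ennreal2) (auto intro!: summable_mult2 summable_geometric)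
  also have "\<dots> < \<infinity>" by simp
  finally have "AE x in ?M. (\<Sum>k. ennreal (norm (d k x))) \<noteq> \<infinity>"
    by (intro nn_integral_PInf_AE) auto
  then have AE_conv: "AE x in ?M. convergent (\<lambda>k. f (r k) x)"
  proof eventually_elim
    case (elim x)
    then have "summable (\<lambda>k. norm (d k x))"
      by (intro summable_suminf_not_top) auto
    then have "summable (\<lambda>k. d k x)" by (rule summable_norm_cancel)
    then have "convergent (\<lambda>n. \<Sum>k<n. d k x)" by (simp add: summable_iff_convergent)
    then have "convergent (\<lambda>n. f (r n) x - f (r 0) x)"
      unfolding d_def by (subst (asm) sum_lessThan_telescope)
    then show ?case
      using convergent_diff_const_right_iff by blast
  qed
  define g where "g x = lim (\<lambda>k. f (r k) x)" for x
  have g_meas [measurable]: "g \<in> borel_measurable ?M"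
    unfolding g_def by measurable
  \<comment> \<open>Fatou along the subsequence. The bound is on the nonnegative integral, since the
    difference is not yet known to be in L^2.\<close>
  have bound: "(\<integral>\<^sup>+x. ennreal ((norm (f n x - g x))\<^sup>2) \<partial>?M) \<le> ennreal (e\<^sup>2)"
    if "e > 0" and n: "\<And>m. m \<ge> N0 \<Longrightarrow> L2_norm \<Omega> (\<lambda>x. f n x - f m x) < e" for n e N0
  proof -
    have "(\<integral>\<^sup>+x. ennreal ((norm (f n x - g x))\<^sup>2) \<partial>?M)
        = (\<integral>\<^sup>+x. liminf (\<lambda>k. ennreal ((norm (f n x - f (r k) x))\<^sup>2)) \<partial>?M)"
    proof (rule nn_integral_cong_AE)
      show "AE x in ?M. ennreal ((norm (f n x - g x))\<^sup>2) = liminf (\<lambda>k. ennreal ((norm (f n x - f (r k) x))\<^sup>2))"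
        using AE_conv
      proof eventually_elim
        case (elim x)
        then have "(\<lambda>k. f (r k) x) \<longlonglongrightarrow> g x" by (simp add: g_def convergent_LIMSEQ_iff)
        then have "(\<lambda>k. ennreal ((norm (f n x - f (r k) x))\<^sup>2)) \<longlonglongrightarrow> ennreal ((norm (f n x - g x))\<^sup>2)"
          by (intro tendsto_intros)
        from lim_imp_Liminf[OF sequentially_bot this] show ?case by simp
      qed
    qed
    also have "\<dots> \<le> liminf (\<lambda>k. \<integral>\<^sup>+x. ennreal ((norm (f n x - f (r k) x))\<^sup>2) \<partial>?M)"
      by (rule nn_integral_liminf) measurable
    also have "\<dots> \<le> ennreal (e\<^sup>2)"
    proof (rule Liminf_le)
      have "\<forall>\<^sub>F k in sequentially. r k \<ge> N0"
        using r_lim by (simp add: filterlim_at_top)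
      then show "\<forall>\<^sub>F k in sequentially. (\<integral>\<^sup>+x. ennreal ((norm (f n x - f (r k) x))\<^sup>2) \<partial>?M) \<le> ennreal (e\<^sup>2)"
      proof eventually_elim
        case (elim k)
        have "(\<integral>\<^sup>+x. ennreal ((norm (f n x - f (r k) x))\<^sup>2) \<partial>?M) = ennreal ((L2_norm \<Omega> (\<lambda>x. f n x - f (r k) x))\<^sup>2)"
          unfolding L2_norm_power2
          by (rule nn_integral_eq_integral[OF L2_integrable[OF L2_diff[OF f f]]]) simp
        also have "\<dots> \<le> ennreal (e\<^sup>2)"
          using n[OF elim] by (intro ennreal_leI power_mono) auto
        finally show ?case .
      qed
    qed simp
    finally show ?thesis .
  qed
  have diff_L2: "(\<lambda>x. f n x - g x) \<in> L2 \<Omega> \<and> L2_norm \<Omega> (\<lambda>x. f n x - g x) \<le> e"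
    if "e > 0" and n: "\<And>m. m \<ge> N0 \<Longrightarrow> L2_norm \<Omega> (\<lambda>x. f n x - f m x) < e" for n e N0
  proof -
    have le: "(\<integral>\<^sup>+x. ennreal ((norm (f n x - g x))\<^sup>2) \<partial>?M) \<le> ennreal (e\<^sup>2)"
      by (rule bound[of e N0]) (fact that)+
    have "(\<integral>\<^sup>+x. ennreal ((norm (f n x - g x))\<^sup>2) \<partial>?M) < \<infinity>"
      using order.strict_trans1[OF le ennreal_less_top] by simp
    then have int: "integrable ?M (\<lambda>x. (norm (f n x - g x))\<^sup>2)"
      by (intro integrableI_bounded) auto
    have "ennreal ((L2_norm \<Omega> (\<lambda>x. f n x - g x))\<^sup>2) \<le> ennreal (e\<^sup>2)"
      using le unfolding L2_norm_power2 by (subst (asm) nn_integral_eq_integral[OF int]) simp_all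
    then have "(L2_norm \<Omega> (\<lambda>x. f n x - g x))\<^sup>2 \<le> e\<^sup>2"
      by (simp only: ennreal_le_iff zero_le_power2)
    then have "L2_norm \<Omega> (\<lambda>x. f n x - g x) \<le> e"
      using \<open>e > 0\<close> by - (rule power2_le_imp_le, simp_all)
    with int show ?thesis by (simp add: L2_def)
  qed
  have "g \<in> L2 \<Omega>"
  proof -
    obtain N0 where "\<And>m n. m \<ge> N0 \<Longrightarrow> n \<ge> N0 \<Longrightarrow> L2_norm \<Omega> (\<lambda>x. f m x - f n x) < 1"
      using Cauchy[of 1] by auto
    then have "(\<lambda>x. f N0 x - g x) \<in> L2 \<Omega>" using diff_L2[of 1 N0 N0] by simp
    from L2_diff[OF f this, of N0] show ?thesis by simp
  qed
  moreover have "(\<lambda>n. L2_norm \<Omega> (\<lambda>x. f n x - g x)) \<longlonglongrightarrow> 0"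
  proof (rule LIMSEQ_I)
    fix e :: real assume "e > 0"
    then obtain N0 where "\<And>m n. m \<ge> N0 \<Longrightarrow> n \<ge> N0 \<Longrightarrow> L2_norm \<Omega> (\<lambda>x. f m x - f n x) < e/2"
      using Cauchy[of "e/2"] by auto
    then have *: "L2_norm \<Omega> (\<lambda>x. f n x - g x) \<le> e/2" if "n \<ge> N0" for n
      using diff_L2[of "e/2" N0 n] that \<open>e > 0\<close> by simp
    show "\<exists>no. \<forall>n\<ge>no. norm (L2_norm \<Omega> (\<lambda>x. f n x - g x) - 0) < e"
    proof (intro exI allI impI)
      fix n assume "n \<ge> N0"
      then have "L2_norm \<Omega> (\<lambda>x. f n x - g x) \<le> e/2" by (rule *)
      then show "norm (L2_norm \<Omega> (\<lambda>x. f n x - g x) - 0) < e"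
        using \<open>e > 0\<close> by simp
    qed
  qed
  ultimately show ?thesis by blast
qed

end

subsection \<open>Smooth functions and test functions\<close>

lemma partial_eqI: "(f has_derivative D) (at x) \<Longrightarrow> partial i f x = D (axis i 1)"
  unfolding partial_def using frechet_derivative_at by metis

lemma has_derivative_partial:
  assumes "f differentiable (at x)"
  shows "(f has_derivative (\<lambda>z. \<Sum>i\<in>UNIV. of_real (z $ i) * partial i f x)) (at x)"
proof -
  let ?D = "frechet_derivative f (at x)"
  have D: "(f has_derivative ?D) (at x)"
    using assms frechet_derivative_works by blast
  then interpret linear ?D by (rule has_derivative_linear)
  have "?D z = (\<Sum>i\<in>UNIV. of_real (z $ i) * partial i f x)" for z
  proof -
    have "?D z = ?D (\<Sum>i\<in>UNIV. z $ i *\<^sub>R axis i 1)"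
      by (subst basis_expansion[symmetric, of z]) (simp add: scalar_mult_eq_scaleR)
    then show ?thesis
      unfolding partial_def scaleR_conv_of_real[symmetric] by (simp only: sum scale)
  qed
  then have "?D = (\<lambda>z. \<Sum>i\<in>UNIV. of_real (z $ i) * partial i f x)" by (rule ext)
  with D show ?thesis by simp
qed

lemma Ck_Suc_imp_Ck: "Ck (Suc k) f \<Longrightarrow> Ck k f"
proof (induction k arbitrary: f)
  case 0
  then show ?case
    by (simp add: continuous_on_eq_continuous_at differentiable_imp_continuous_within)
next
  case (Suc k)
  then show ?case by (metis Ck.simps(2))
qed

text \<open>No k-th derivative has to be computed: smoothness follows once a family containing the
  function and closed under \<open>partial\<close> is exhibited, such as the multiples of one plane
  wave.\<close>

lemma Ck_family:
  assumes "\<And>f x. f \<in> S \<Longrightarrow> f differentiable (at x)" "\<And>f i. f \<in> S \<Longrightarrow> partial i f \<in> S" "f \<in> S"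
  shows "Ck k f"
  using assms(3)
proof (induction k arbitrary: f)
  case 0
  then show ?case
    by (simp add: continuous_on_eq_continuous_at assms(1) differentiable_imp_continuous_within)
next
  case (Suc k)
  then show ?case using assms by simp
qed

section \<open>Closure properties of smoothness\<close>

lemma partial_const: "partial i (\<lambda>x. c) = (\<lambda>x. 0)"
  by (rule ext, subst partial_eqI[OF has_derivative_const]) simp

lemma Ck_const: "Ck k (\<lambda>x. c)"
  by (rule Ck_family[of "range (\<lambda>c x. c)"]) (auto simp: partial_const)

lemma partial_add:
  assumes "f differentiable (at x)" "g differentiable (at x)"
  shows "partial i (\<lambda>x. f x + g x) x = partial i f x + partial i g x"
  using assms unfolding frechet_derivative_works
  by (subst partial_eqI[OF has_derivative_add]) (auto simp: partial_def)

lemma partial_mult: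
  assumes "f differentiable (at x)" "g differentiable (at x)"
  shows "partial i (\<lambda>x. f x * g x) x = f x * partial i g x + partial i f x * g x"
  using assms unfolding frechet_derivative_works
  by (subst partial_eqI[OF has_derivative_mult]) (auto simp: partial_def)

lemma Ck_add: "Ck k f \<Longrightarrow> Ck k g \<Longrightarrow> Ck k (\<lambda>x. f x + g x)"
proof (induction k arbitrary: f g)
  case (Suc k)
  then have "partial i (\<lambda>x. f x + g x) = (\<lambda>x. partial i f x + partial i g x)" for i
    using partial_add by fastforce
  with Suc show ?case by simp
qed (simp add: continuous_on_add)

lemma Ck_mult: "Ck k f \<Longrightarrow> Ck k g \<Longrightarrow> Ck k (\<lambda>x. f x * g x)"
proof (induction k arbitrary: f g)
  case (Suc k)
  have "partial i (\<lambda>x. f x * g x) = (\<lambda>x. f x * partial i g x + partial i f x * g x)" for i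
    using Suc.prems partial_mult by fastforce
  moreover have "Ck k (\<lambda>x. f x * partial i g x + partial i f x * g x)" for i
    using Suc.prems Ck_Suc_imp_Ck[OF Suc.prems(1)] Ck_Suc_imp_Ck[OF Suc.prems(2)]
    by (intro Ck_add Suc.IH) auto
  ultimately show ?case using Suc.prems by simp
qed (simp add: continuous_on_mult)

lemma Ck_prod: "finite I \<Longrightarrow> (\<And>i. i \<in> I \<Longrightarrow> Ck k (f i)) \<Longrightarrow> Ck k (\<lambda>x. \<Prod>i\<in>I. f i x)"
  by (induction I rule: finite_induct) (simp_all add: Ck_const Ck_mult)

definition plane_wave :: "real ^ 'n \<Rightarrow> real ^ 'n \<Rightarrow> complex" where
  "plane_wave \<xi> x = exp (\<i> * of_real (\<xi> \<bullet> x))"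

lemma norm_plane_wave [simp]: "norm (plane_wave \<xi> x) = 1"
  by (simp add: plane_wave_def)

lemma plane_wave_has_derivative:
  "((\<lambda>x. c * plane_wave \<xi> x) has_derivative (\<lambda>h. c * (plane_wave \<xi> x * (\<i> * of_real (\<xi> \<bullet> h))))) (at x)"
proof -
  have "((\<lambda>x. \<i> * complex_of_real (\<xi> \<bullet> x)) has_derivative (\<lambda>h. \<i> * of_real (\<xi> \<bullet> h))) (at x)"
    by (auto intro!: derivative_eq_intros)
  from has_derivative_compose[OF this DERIV_exp[unfolded has_field_derivative_def]]
  show ?thesis
    unfolding plane_wave_def by (rule bounded_linear.has_derivative[OF bounded_linear_mult_right])
qed

lemma partial_plane_wave:
  "partial i (\<lambda>x. c * plane_wave \<xi> x) = (\<lambda>x. (c * (\<i> * of_real (\<xi> $ i))) * plane_wave \<xi> x)"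
  by (rule ext, subst partial_eqI[OF plane_wave_has_derivative]) (simp add: inner_axis mult_ac)

lemma Ck_plane_wave: "Ck k (plane_wave \<xi>)"
proof -
  have "Ck k (\<lambda>x. 1 * plane_wave \<xi> x)"
  proof (rule Ck_family[of "range (\<lambda>c x. c * plane_wave \<xi> x)"])
    fix f x assume "f \<in> range (\<lambda>c x. c * plane_wave \<xi> x)"
    then show "f differentiable (at x)"
      using plane_wave_has_derivative unfolding differentiable_def by blast
  next
    fix f i assume "f \<in> range (\<lambda>c x. c * plane_wave \<xi> x)"
    then show "partial i f \<in> range (\<lambda>c x. c * plane_wave \<xi> x)"
      by (auto simp: partial_plane_wave)
  next
    show "(\<lambda>x. 1 * plane_wave \<xi> x) \<in> range (\<lambda>c x. c * plane_wave \<xi> x)"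
      by (rule rangeI)
  qed
  then show ?thesis by simp
qed

text \<open>The classical smooth function \<open>exp (- 1 / s)\<close>, with polynomial factors in \<open>1 / s\<close>
  so that the family is closed under differentiation.\<close>

definition bump :: "real poly \<Rightarrow> real \<Rightarrow> real" where
  "bump p s = (if s > 0 then poly p (1 / s) * exp (- (1 / s)) else 0)"

lemma poly_exp_tendsto_0: "((\<lambda>y::real. poly p y * exp (- y)) \<longlongrightarrow> 0) at_top"
proof -
  have "((\<lambda>y::real. \<Sum>i\<le>degree p. coeff p i * (y ^ i / exp y)) \<longlongrightarrow> (\<Sum>i\<le>degree p. coeff p i * 0)) at_top"
    by (intro tendsto_intros tendsto_power_div_exp_0)
  then show ?thesis
    by (simp add: poly_altdef sum_distrib_right exp_minus divide_inverse mult.assoc)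
qed

text \<open>With y = 1 / s one has d/ds = - y^2 d/dy, so differentiating p(y) exp(- y) yields y^2 (p
  - p')(y) exp(- y); \<open>[:0, 0, 1:]\<close> is the polynomial y^2. Only s = 0 needs an argument,
  by one-sided difference quotients.\<close>

lemma bump_has_derivative:
  "(bump p has_real_derivative bump ([:0, 0, 1:] * (p - pderiv p)) s) (at s)"
proof -
  consider "s > 0" | "s < 0" | "s = 0" by linarith
  then show ?thesis
  proof cases
    case 1
    have "((\<lambda>s. poly p (1 / s) * exp (- (1 / s))) has_real_derivative
        bump ([:0, 0, 1:] * (p - pderiv p)) s) (at s)"
      unfolding bump_def using 1
      by (auto intro!: derivative_eq_intros DERIV_chain2[OF poly_DERIV] simp: field_simps power2_eq_square)
    then show ?thesis
    proof (rule has_field_derivative_transform_within_open[of _ _ _ "{0<..}"])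
      show "poly p (1 / x) * exp (- (1 / x)) = bump p x" if "x \<in> {0<..}" for x
        using that by (simp add: bump_def)
    qed (use 1 in auto)
  next
    case 2
    have "((\<lambda>s. 0) has_real_derivative bump ([:0, 0, 1:] * (p - pderiv p)) s) (at s)"
      using 2 by (simp add: bump_def)
    then show ?thesis
    proof (rule has_field_derivative_transform_within_open[of _ _ _ "{..<0}"])
      show "0 = bump p x" if "x \<in> {..<0}" for x
        using that by (simp add: bump_def)
    qed (use 2 in auto)
  next
    case 3
    have "((\<lambda>h. bump p h / h) \<longlongrightarrow> 0) (at_left 0)"
      by (rule tendsto_eventually) (simp add: bump_def eventually_at_filter)
    moreover have "((\<lambda>h. bump p h / h) \<longlongrightarrow> 0) (at_right 0)"
    proof -
      \<comment> \<open>Dividing by h amounts to multiplying by y = 1 / h, which is absorbed into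
        the polynomial as \<open>[:0, 1:]\<close>; the exponential still wins.\<close>
      have "((\<lambda>h::real. poly ([:0, 1:] * p) (inverse h) * exp (- inverse h)) \<longlongrightarrow> 0) (at_right 0)"
        by (rule filterlim_compose[OF poly_exp_tendsto_0 filterlim_inverse_at_top_right])
      then show ?thesis
        by (rule Lim_transform_eventually)
          (auto simp: bump_def eventually_at_filter divide_simps)
    qed
    ultimately have "((\<lambda>h. bump p h / h) \<longlongrightarrow> 0) (at 0)"
      by (simp add: filterlim_at_split)
    then show ?thesis
      using 3 by (simp add: DERIV_def bump_def)
  qed
qed

lemma bump_coord_has_derivative:
  "((\<lambda>x. complex_of_real (c * bump p (a * x $ i + b))) has_derivative
    (\<lambda>h. of_real (c * (h $ i * a * bump ([:0, 0, 1:] * (p - pderiv p)) (a * x $ i + b))))) (at x)"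
proof -
  have "((\<lambda>x. a * x $ i + b) has_derivative (\<lambda>h. a * h $ i)) (at x)"
    by (auto intro!: derivative_eq_intros bounded_linear_imp_has_derivative[OF bounded_linear_vec_nth])
  from has_derivative_compose[OF this bump_has_derivative[unfolded has_field_derivative_def]]
  have "((\<lambda>x. bump p (a * x $ i + b)) has_derivative
      (\<lambda>h. bump ([:0, 0, 1:] * (p - pderiv p)) (a * x $ i + b) * (a * h $ i))) (at x)"
    by simp
  then show ?thesis
    by (intro has_derivative_of_real) (auto intro!: derivative_eq_intros simp: mult_ac)
qed

lemma Ck_bump_coord: "Ck k (\<lambda>x. complex_of_real (bump p (a * x $ i + b)))"
proof -
  \<comment> \<open>The scalar \<open>c\<close> absorbs the chain rule factor \<open>a\<close> of
    each differentiation, and becomes 0 for derivatives in the other coordinates.\<close>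
  define S where "S = {f. \<exists>c p. f = (\<lambda>x::real^'a. complex_of_real (c * bump p (a * x $ i + b)))}"
  have "Ck k (\<lambda>x. complex_of_real (1 * bump p (a * x $ i + b)))"
  proof (rule Ck_family[of S])
    fix f x assume "f \<in> S"
    then show "f differentiable (at x)"
      unfolding S_def differentiable_def using bump_coord_has_derivative by blast
  next
    fix f j assume "f \<in> S"
    then obtain c p where f: "f = (\<lambda>x. complex_of_real (c * bump p (a * x $ i + b)))"
      by (auto simp: S_def)
    have "partial j f = (\<lambda>x. complex_of_real
        ((if i = j then c * a else 0) * bump ([:0, 0, 1:] * (p - pderiv p)) (a * x $ i + b)))"
      unfolding f
      by (rule ext, subst partial_eqI[OF bump_coord_has_derivative]) (simp add: axis_def)
    then show "partial j f \<in> S" unfolding S_def by blast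
  qed (unfold S_def, blast)
  then show ?thesis by simp
qed

section \<open>Test functions\<close>

lemma test_functions_Ck: "\<psi> \<in> test_functions \<Omega> \<Longrightarrow> Ck k \<psi>"
  by (simp add: test_functions_def)

lemma test_functions_differentiable: "\<psi> \<in> test_functions \<Omega> \<Longrightarrow> \<psi> differentiable (at x)"
  using test_functions_Ck[of \<psi> \<Omega> "Suc 0"] by simp

lemma test_functions_continuous: "\<psi> \<in> test_functions \<Omega> \<Longrightarrow> continuous_on UNIV \<psi>"
  using test_functions_Ck[of \<psi> \<Omega> 0] by simp

lemma test_functions_borel: "\<psi> \<in> test_functions \<Omega> \<Longrightarrow> \<psi> \<in> borel_measurable borel"
  by (intro borel_measurable_continuous_onI test_functions_continuous)

lemma test_functions_support: "\<psi> \<in> test_functions \<Omega> \<Longrightarrow> x \<notin> \<Omega> \<Longrightarrow> \<psi> x = 0"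
  unfolding test_functions_def using closure_subset[of "{x. \<psi> x \<noteq> 0}"] by auto

lemma test_functionsI:
  assumes "\<And>k. Ck k f" "closure {x. f x \<noteq> 0} \<subseteq> K" "compact K" "K \<subseteq> \<Omega>"
  shows "f \<in> test_functions \<Omega>"
proof -
  have "compact (K \<inter> closure {x. f x \<noteq> 0})"
    using assms(3) by (rule compact_Int_closed) simp
  moreover have "K \<inter> closure {x. f x \<noteq> 0} = closure {x. f x \<noteq> 0}"
    using assms(2) by blast
  ultimately show ?thesis
    using assms unfolding test_functions_def by auto
qed

lemma test_functions_mult:
  assumes "\<psi> \<in> test_functions \<Omega>" "\<And>k. Ck k f"
  shows "(\<lambda>x. f x * \<psi> x) \<in> test_functions \<Omega>"
proof (rule test_functionsI)
  show "closure {x. f x * \<psi> x \<noteq> 0} \<subseteq> closure {x. \<psi> x \<noteq> 0}"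
    by (rule closure_mono) auto
qed (use assms in \<open>auto simp: test_functions_def intro: Ck_mult\<close>)

lemma test_functions_add:
  assumes "\<psi> \<in> test_functions \<Omega>" "\<eta> \<in> test_functions \<Omega>"
  shows "(\<lambda>x. \<psi> x + \<eta> x) \<in> test_functions \<Omega>"
proof (rule test_functionsI)
  show "closure {x. \<psi> x + \<eta> x \<noteq> 0} \<subseteq> closure {x. \<psi> x \<noteq> 0} \<union> closure {x. \<eta> x \<noteq> 0}"
    unfolding closure_Un[symmetric] by (rule closure_mono) auto
qed (use assms in \<open>auto simp: test_functions_def intro: Ck_add compact_Un\<close>)

lemma partial_eq_0_outside_support:
  assumes "x \<notin> closure {x. f x \<noteq> 0}"
  shows "partial i f x = 0"
proof -
  have "(f has_derivative (\<lambda>h. 0)) (at x)"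
  proof (rule has_derivative_transform_within_open[of "\<lambda>x. 0" _ _ _ "- closure {x. f x \<noteq> 0}"])
    show "0 = f y" if "y \<in> - closure {x. f x \<noteq> 0}" for y
      using that closure_subset[of "{x. f x \<noteq> 0}"] by auto
  qed (use assms in auto)
  from partial_eqI[OF this] show ?thesis by simp
qed

lemma test_functions_partial:
  assumes "\<psi> \<in> test_functions \<Omega>"
  shows "partial i \<psi> \<in> test_functions \<Omega>"
proof (rule test_functionsI)
  show "closure {x. partial i \<psi> x \<noteq> 0} \<subseteq> closure {x. \<psi> x \<noteq> 0}"
    using partial_eq_0_outside_support[of _ \<psi> i] by (intro closure_minimal) auto
  show "Ck k (partial i \<psi>)" for k
    using test_functions_Ck[OF assms, of "Suc k"] by simp
qed (use assms in \<open>auto simp: test_functions_def\<close>)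

lemma test_functions_bounded:
  assumes "\<psi> \<in> test_functions \<Omega>"
  shows "\<exists>B. \<forall>x. norm (\<psi> x) \<le> B"
proof -
  let ?K = "closure {x. \<psi> x \<noteq> 0}"
  have "compact (\<psi> ` ?K)"
    using assms test_functions_continuous[OF assms]
    by (intro compact_continuous_image) (auto simp: test_functions_def intro: continuous_on_subset)
  then obtain B where B: "\<And>y. y \<in> \<psi> ` ?K \<Longrightarrow> norm y \<le> B"
    using compact_imp_bounded bounded_iff by metis
  have "norm (\<psi> x) \<le> max 0 B" for x
  proof (cases "\<psi> x = 0")
    case False
    then have "x \<in> ?K" using closure_subset[of "{x. \<psi> x \<noteq> 0}"] by auto
    then show ?thesis using B by fastforce
  qed simp
  then show ?thesis by blast
qed

text \<open>Each factor is exp(- 1 / ((k + 1) s)), where s is the signed distance to a face of the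
  box, and 0 for s \<le> 0. It is at most 1 and tends to 1 for s > 0 as k grows, so the products are
  smooth approximations of the indicator of the open box.\<close>

definition box_bump :: "nat \<Rightarrow> real ^ 'n \<Rightarrow> real ^ 'n \<Rightarrow> real ^ 'n \<Rightarrow> complex" where
  "box_bump k a b x = (\<Prod>i\<in>UNIV. of_real (bump 1 (real (Suc k) * (x $ i - a $ i)))
      * of_real (bump 1 (real (Suc k) * (b $ i - x $ i))))"

lemma box_bump_outside: "x \<notin> box a b \<Longrightarrow> box_bump k a b x = 0"
proof -
  assume "x \<notin> box a b"
  then obtain i where "x $ i \<le> a $ i \<or> b $ i \<le> x $ i"
    by (auto simp: mem_box_cart not_less)
  then have "complex_of_real (bump 1 (real (Suc k) * (x $ i - a $ i)))
      * of_real (bump 1 (real (Suc k) * (b $ i - x $ i))) = 0"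
    by (auto simp: bump_def zero_less_mult_iff)
  then show ?thesis
    unfolding box_bump_def by (intro prod_zero) auto
qed

lemma box_bump_test:
  assumes "cbox a b \<subseteq> \<Omega>"
  shows "box_bump k a b \<in> test_functions \<Omega>"
proof (rule test_functionsI[OF _ _ compact_cbox assms])
  have "{x. box_bump k a b x \<noteq> 0} \<subseteq> cbox a b"
    using box_bump_outside box_subset_cbox by fast
  then show "closure {x. box_bump k a b x \<noteq> 0} \<subseteq> cbox a b"
    by (rule closure_minimal) (rule closed_cbox)
  have eq: "real (Suc k) * (x $ i - a $ i) = real (Suc k) * x $ i + - real (Suc k) * a $ i"
      "real (Suc k) * (b $ i - x $ i) = - real (Suc k) * x $ i + real (Suc k) * b $ i" for x i
    by (simp_all add: algebra_simps)
  show "Ck m (box_bump k a b)" for m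
    unfolding box_bump_def eq by (intro Ck_prod Ck_mult Ck_bump_coord) auto
qed

lemma norm_box_bump_le: "norm (box_bump k a b x) \<le> 1"
proof -
  have "\<bar>bump 1 s\<bar> \<le> 1" for s by (simp add: bump_def)
  then show ?thesis
    unfolding box_bump_def prod_norm[symmetric] norm_mult norm_of_real
    by (intro prod_le_1) (auto intro: mult_le_one)
qed

lemma bump_scaled_tendsto:
  assumes "s > 0" shows "(\<lambda>k. bump 1 (real (Suc k) * s)) \<longlonglongrightarrow> 1"
proof -
  have "bump 1 (real (Suc k) * s) = exp (- (inverse (real (Suc k)) * (1 / s)))" for k
    using assms by (simp add: bump_def zero_less_mult_iff divide_inverse del: of_nat_Suc)
  moreover have "(\<lambda>k. exp (- (inverse (real (Suc k)) * (1 / s)))) \<longlonglongrightarrow> exp (- (0 * (1 / s)))"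
    by (intro tendsto_intros LIMSEQ_inverse_real_of_nat)
  ultimately show ?thesis by simp
qed

lemma box_bump_tendsto: "(\<lambda>k. box_bump k a b x) \<longlonglongrightarrow> indicator (box a b) x"
proof (cases "x \<in> box a b")
  case True
  then have pos: "x $ i - a $ i > 0" "b $ i - x $ i > 0" for i
    by (auto simp: mem_box_cart)
  have "(\<lambda>k. \<Prod>i\<in>UNIV. complex_of_real (bump 1 (real (Suc k) * (x $ i - a $ i)))
      * of_real (bump 1 (real (Suc k) * (b $ i - x $ i)))) \<longlonglongrightarrow> (\<Prod>i\<in>(UNIV::'a set). of_real 1 * of_real 1)"
    by (intro tendsto_intros bump_scaled_tendsto pos)
  then show ?thesis
    using True unfolding box_bump_def by simp
qed (simp add: box_bump_outside)

subsection \<open>Integration by parts and uniqueness of weak gradients\<close>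

text \<open>Henstock's lemma bounds the sum of |content(k) g(x) - integral of g over k| over a fine
  tagged division. Since these integrals vanish, the sum is a Riemann sum of |g|, so |g| has gauge
  integral 0. This takes the place of the Lebesgue differentiation theorem.\<close>

lemma AE_zero_if_integral_zero_on_boxes:
  fixes g :: "'a::euclidean_space \<Rightarrow> 'b::euclidean_space"
  assumes g: "g absolutely_integrable_on cbox c d"
    and zero: "\<And>a b. cbox a b \<subseteq> cbox c d \<Longrightarrow> integral (cbox a b) g = 0"
  shows "AE x in lebesgue. x \<in> cbox c d \<longrightarrow> g x = 0"
proof -
  have gint: "g integrable_on cbox c d"
    using g by (rule set_lebesgue_integral_eq_integral(1))
  have "((\<lambda>x. norm (g x)) has_integral 0) (cbox c d)"
    unfolding has_integral
  proof (intro allI impI)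
    fix e :: real assume "e > 0"
    \<comment> \<open>Henstock's lemma loses the factor 2 \<open>DIM('b)\<close> for vector values;
      the additional 1 makes the final inequality strict.\<close>
    define e' where "e' = e / (2 * real DIM('b) + 1)"
    have "e' > 0" using \<open>e > 0\<close> by (simp add: e'_def)
    have "(g has_integral integral (cbox c d) g) (cbox c d)"
      using gint by (rule integrable_integral)
    then obtain \<gamma> where \<gamma>: "gauge \<gamma>"
      "\<And>D. D tagged_division_of (cbox c d) \<Longrightarrow> \<gamma> fine D \<Longrightarrow>
        norm ((\<Sum>(x,k)\<in>D. measure lborel k *\<^sub>R g x) - integral (cbox c d) g) < e'"
      using \<open>e' > 0\<close> unfolding has_integral by metis
    show "\<exists>\<gamma>. gauge \<gamma> \<and> (\<forall>D. D tagged_division_of cbox c d \<and> \<gamma> fine D \<longrightarrow>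
        norm ((\<Sum>(x,k)\<in>D. measure lborel k *\<^sub>R norm (g x)) - 0) < e)"
    proof (intro exI conjI allI impI)
      fix D assume D: "D tagged_division_of cbox c d \<and> \<gamma> fine D"
      then have part: "D tagged_partial_division_of cbox c d"
        by (simp add: tagged_division_of_def)
      have "(\<Sum>(x,k)\<in>D. measure lborel k *\<^sub>R norm (g x)) = (\<Sum>(x,k)\<in>D. norm (measure lborel k *\<^sub>R g x - integral k g))"
      proof (rule sum.cong[OF refl], clarify)
        fix x k assume xk: "(x, k) \<in> D"
        obtain a b where "k = cbox a b" "k \<subseteq> cbox c d"
          using D xk by (meson tagged_division_ofD(3,4))
        then have "integral k g = 0" using zero by simp
        then show "measure lborel k *\<^sub>R norm (g x) = norm (measure lborel k *\<^sub>R g x - integral k g)" by simp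
      qed
      also have "\<dots> \<le> 2 * real DIM('b) * e'"
        by (rule Henstock_lemma_part2[OF gint \<open>e' > 0\<close> \<gamma> part]) (use D in auto)
      also have "\<dots> < e"
        using \<open>e > 0\<close> by (simp add: e'_def field_simps)
      finally have "(\<Sum>(x,k)\<in>D. measure lborel k *\<^sub>R norm (g x)) < e" .
      moreover have "0 \<le> (\<Sum>(x,k)\<in>D. measure lborel k *\<^sub>R norm (g x))"
        by (intro sum_nonneg) auto
      ultimately show "norm ((\<Sum>(x,k)\<in>D. measure lborel k *\<^sub>R norm (g x)) - 0) < e"
        by simp
    qed (fact \<gamma>(1))
  qed
  then have "integral (cbox c d) (\<lambda>x. norm (g x)) = 0" by (rule integral_unique)
  moreover have ni: "(\<lambda>x. norm (g x)) absolutely_integrable_on cbox c d"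
    using absolutely_integrable_norm[OF g] by (simp add: o_def)
  ultimately have "(LINT x|lebesgue. indicator (cbox c d) x *\<^sub>R norm (g x)) = 0"
    using set_lebesgue_integral_eq_integral(2)[OF ni] by (simp add: set_lebesgue_integral_def)
  then have "AE x in lebesgue. indicator (cbox c d) x *\<^sub>R norm (g x) = 0"
    using ni unfolding set_integrable_def
    by (subst (asm) integral_nonneg_eq_0_iff_AE) auto
  then show ?thesis
    by eventually_elim (auto simp: indicator_def)
qed

lemma test_function_line_derivative:
  assumes "\<psi> \<in> test_functions \<Omega>"
  shows "((\<lambda>s. \<psi> (x + s *\<^sub>R z)) has_vector_derivative (\<Sum>i\<in>UNIV. of_real (z $ i) * partial i \<psi> (x + s *\<^sub>R z))) (at s)"
proof -
  have "((\<lambda>s. x + s *\<^sub>R z) has_derivative (\<lambda>h. h *\<^sub>R z)) (at s)"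
    by (auto intro!: derivative_eq_intros)
  from has_derivative_compose[OF this has_derivative_partial[OF test_functions_differentiable[OF assms]]]
  show ?thesis
    unfolding has_vector_derivative_def
    by (rule has_derivative_eq_rhs)
      (simp add: fun_eq_iff scaleR_sum_right sum_distrib_left scaleR_conv_of_real[where 'a=complex] mult.assoc)
qed

lemma test_function_line_integral:
  assumes "\<psi> \<in> test_functions \<Omega>"
  shows "((\<lambda>s. \<Sum>i\<in>UNIV. of_real (z $ i) * partial i \<psi> (x + s *\<^sub>R z)) has_integral \<psi> (x + z) - \<psi> x) {0..1}"
  using fundamental_theorem_of_calculus[of 0 1 "\<lambda>s. \<psi> (x + s *\<^sub>R z)"]
    has_vector_derivative_at_within[OF test_function_line_derivative[OF assms]]
  by simp

lemma integral_lborel_translate: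
  fixes f :: "'a::euclidean_space \<Rightarrow> 'b::{banach,second_countable_topology}"
  assumes "f \<in> borel_measurable borel"
  shows "(LINT x|lborel. f (x + c)) = (LINT x|lborel. f x)"
proof -
  have "(LINT x|lborel. f x) = (LINT x|distr lborel borel ((+) c). f x)"
    by (simp add: lborel_distr_plus)
  also have "\<dots> = (LINT x|lborel. f (c + x))"
    using assms by (subst integral_distr) auto
  finally show ?thesis by (simp add: add.commute)
qed

context bounded_open
begin

text \<open>For functions supported in \<Omega>, test functions above all, this moves integrals to
  the whole space, where translation invariance is available.\<close>

lemma integral_eq_lborel:
  fixes f :: "real ^ 'n \<Rightarrow> 'b::{banach,second_countable_topology}"
  assumes "f \<in> borel_measurable borel" "\<And>x. x \<notin> \<Omega> \<Longrightarrow> f x = 0"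
  shows "(LINT x|lebesgue_on \<Omega>. f x) = (LINT x|lborel. f x)"
proof -
  have "(LINT x|lebesgue_on \<Omega>. f x) = (LINT x|lebesgue. indicator \<Omega> x *\<^sub>R f x)"
    by (rule integral_restrict_space) simp
  also have "\<dots> = (LINT x|lebesgue. f x)"
    using assms(2) by (intro Bochner_Integration.integral_cong) (auto simp: indicator_def)
  also have "\<dots> = (LINT x|lborel. f x)"
    using assms(1) by (intro integral_completion) simp
  finally show ?thesis .
qed

lemma integrable_lborel_iff:
  fixes f :: "real ^ 'n \<Rightarrow> 'b::{banach,second_countable_topology}"
  assumes "f \<in> borel_measurable borel" "\<And>x. x \<notin> \<Omega> \<Longrightarrow> f x = 0"
  shows "integrable lborel f \<longleftrightarrow> integrable (lebesgue_on \<Omega>) f"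
proof -
  have "integrable (lebesgue_on \<Omega>) f \<longleftrightarrow> integrable lebesgue (\<lambda>x. indicator \<Omega> x *\<^sub>R f x)"
    by (rule integrable_restrict_space) simp
  also have "(\<lambda>x. indicator \<Omega> x *\<^sub>R f x) = f"
    using assms(2) by (auto simp: indicator_def)
  also have "integrable lebesgue f \<longleftrightarrow> integrable lborel f"
    using assms(1) by (intro integrable_completion) simp
  finally show ?thesis by simp
qed

lemma test_functions_L2: "\<psi> \<in> test_functions \<Omega> \<Longrightarrow> \<psi> \<in> L2 \<Omega>"
  using test_functions_bounded[of \<psi> \<Omega>]
  by (auto intro!: bounded_L2 continuous_borel_measurable_dom test_functions_continuous)

lemma test_functions_integrable:
  assumes "\<psi> \<in> test_functions \<Omega>" shows "integrable lborel \<psi>"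
proof -
  have "integrable lborel \<psi> \<longleftrightarrow> integrable (lebesgue_on \<Omega>) \<psi>"
    using test_functions_borel[OF assms] test_functions_support[OF assms] by (rule integrable_lborel_iff)
  then show ?thesis using L2_integrable1[OF test_functions_L2[OF assms]] by simp
qed

text \<open>By translation invariance every difference quotient of \<psi> has integral 0, and the
  quotients converge to the partial derivative under a common integrable bound.\<close>

lemma integral_partial_test_function:
  assumes \<psi>: "\<psi> \<in> test_functions \<Omega>"
  shows "(LINT x|lborel. partial i \<psi> x) = 0"
proof -
  define h where "h k = inverse (real (Suc k))" for k
  define q where "q k x = (\<psi> (x + h k *\<^sub>R axis i 1) - \<psi> x) / of_real (h k)" for k x
  have h: "0 < h k" "h k \<le> 1" for k
    by (simp_all add: h_def field_simps)
  have cont: "continuous_on UNIV \<psi>" "continuous_on UNIV (partial i \<psi>)"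
    using test_functions_continuous \<psi> test_functions_partial by blast+
  obtain R where R: "\<And>x. x \<in> \<Omega> \<Longrightarrow> norm x \<le> R"
    using bounded_dom bounded_iff by metis
  obtain B where B: "\<And>x. norm (partial i \<psi> x) \<le> B"
    using test_functions_bounded[OF test_functions_partial[OF \<psi>]] by blast
  have "0 \<le> B" using norm_ge_zero B order_trans by blast
  \<comment> \<open>The quotients are bounded by the supremum \<open>B\<close> of the derivative, by
    integration along the segment, and the steps \<open>h k\<close> are at most 1, so all quotients
    vanish outside the ball of radius \<open>R + 1\<close>.\<close>
  have "(\<lambda>k. LINT x|lborel. q k x) \<longlonglongrightarrow> (LINT x|lborel. partial i \<psi> x)"
  proof (rule integral_dominated_convergence[where w = "\<lambda>x. B * indicator (cball 0 (R + 1)) x"])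
    show "partial i \<psi> \<in> borel_measurable lborel"
      using cont by (simp add: borel_measurable_continuous_onI)
    have "continuous_on UNIV (q k)" for k
      unfolding q_def
      by (intro continuous_intros continuous_on_compose2[OF cont(1)]) (use h[of k] in auto)
    then show "q k \<in> borel_measurable lborel" for k
      by (simp add: borel_measurable_continuous_onI)
    show "integrable lborel (\<lambda>x. B * indicator (cball 0 (R + 1)) x)"
      by (intro integrable_mult_right integrable_real_indicator)
        (use emeasure_bounded_finite[OF bounded_cball] in \<open>simp_all add: less_top\<close>)
    show "AE x in lborel. (\<lambda>k. q k x) \<longlonglongrightarrow> partial i \<psi> x"
    proof (intro AE_I2)
      fix x
      have "((\<lambda>s. \<psi> (x + s *\<^sub>R axis i 1)) has_vector_derivative
          (\<Sum>j\<in>UNIV. of_real (axis i 1 $ j) * partial j \<psi> (x + 0 *\<^sub>R axis i 1))) (at 0)"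
        by (rule test_function_line_derivative[OF \<psi>])
      moreover have "(\<Sum>j\<in>UNIV. of_real (axis i 1 $ j) * partial j \<psi> x) = partial i \<psi> x"
        by (subst sum.remove[of _ i]) (auto simp: axis_def intro!: sum.neutral)
      ultimately have D: "((\<lambda>s. \<psi> (x + s *\<^sub>R axis i 1)) has_derivative (\<lambda>s. s *\<^sub>R partial i \<psi> x)) (at 0)"
        by (simp add: has_vector_derivative_def)
      have "filterlim h (at 0) sequentially"
        unfolding filterlim_at h_def using LIMSEQ_inverse_real_of_nat by (auto simp del: of_nat_Suc)
      with D have "(\<lambda>k. norm (\<psi> (x + (0 + h k) *\<^sub>R axis i 1) - \<psi> (x + 0 *\<^sub>R axis i 1) - h k *\<^sub>R partial i \<psi> x) / norm (h k)) \<longlonglongrightarrow> 0"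
        unfolding has_derivative_at by (auto elim: filterlim_compose)
      moreover have "norm (\<psi> (x + (0 + h k) *\<^sub>R axis i 1) - \<psi> (x + 0 *\<^sub>R axis i 1) - h k *\<^sub>R partial i \<psi> x) / norm (h k)
          = norm (q k x - partial i \<psi> x)" for k
      proof -
        have "q k x - partial i \<psi> x = (\<psi> (x + h k *\<^sub>R axis i 1) - \<psi> x - h k *\<^sub>R partial i \<psi> x) / of_real (h k)"
          using h(1)[of k] by (simp add: q_def diff_divide_distrib scaleR_conv_of_real)
        then show ?thesis by (simp add: norm_divide)
      qed
      ultimately have "(\<lambda>k. norm (q k x - partial i \<psi> x)) \<longlonglongrightarrow> 0" by simp
      then show "(\<lambda>k. q k x) \<longlonglongrightarrow> partial i \<psi> x"
        using tendsto_norm_zero_iff LIM_zero_iff by blast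
    qed
    show "AE x in lborel. norm (q k x) \<le> B * indicator (cball 0 (R + 1)) x" for k
    proof (intro AE_I2)
      fix x
      show "norm (q k x) \<le> B * indicator (cball 0 (R + 1)) x"
      proof (cases "x \<in> cball 0 (R + 1)")
        case True
        have "norm (\<psi> (x + h k *\<^sub>R axis i 1) - \<psi> x) \<le> (B * h k) * measure lborel (cbox (0::real) 1)"
        proof (rule has_integral_bound)
          show "0 \<le> B * h k" using \<open>0 \<le> B\<close> h(1)[of k] by simp
          show "((\<lambda>s. \<Sum>j\<in>UNIV. of_real ((h k *\<^sub>R axis i 1) $ j) * partial j \<psi> (x + s *\<^sub>R (h k *\<^sub>R axis i 1)))
              has_integral \<psi> (x + h k *\<^sub>R axis i 1) - \<psi> x) (cbox 0 1)"
            using test_function_line_integral[OF \<psi>, of "h k *\<^sub>R axis i 1" x] by simp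
          fix s :: real
          have "(\<Sum>j\<in>UNIV. of_real ((h k *\<^sub>R axis i 1) $ j) * partial j \<psi> (x + s *\<^sub>R (h k *\<^sub>R axis i 1)))
              = of_real (h k) * partial i \<psi> (x + s *\<^sub>R (h k *\<^sub>R axis i 1))"
            by (subst sum.remove[of _ i]) (auto simp: axis_def intro!: sum.neutral)
          then show "norm (\<Sum>j\<in>UNIV. of_real ((h k *\<^sub>R axis i 1) $ j) * partial j \<psi> (x + s *\<^sub>R (h k *\<^sub>R axis i 1))) \<le> B * h k"
            using h(1)[of k] B by (simp add: norm_mult mult.commute mult_right_mono)
        qed
        then show ?thesis
          using True h(1)[of k] by (simp add: q_def norm_divide field_simps)
      next
        case False
        have "x \<notin> \<Omega>" using False R by force
        moreover have "x + h k *\<^sub>R axis i 1 \<notin> \<Omega>"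
        proof
          assume "x + h k *\<^sub>R axis i 1 \<in> \<Omega>"
          then have "norm (x + h k *\<^sub>R axis i 1) \<le> R" by (rule R)
          moreover have "norm x \<le> norm (x + h k *\<^sub>R axis i 1) + norm (h k *\<^sub>R axis i (1::real) :: real^'n)"
            using norm_triangle_ineq4[of "x + h k *\<^sub>R axis i 1" "h k *\<^sub>R axis i 1"] by simp
          moreover have "norm (h k *\<^sub>R axis i (1::real) :: real^'n) \<le> 1"
            using h[of k] by (simp add: norm_axis_1)
          ultimately show False using False by simp
        qed
        ultimately show ?thesis
          using test_functions_support[OF \<psi>] \<open>0 \<le> B\<close> by (simp add: q_def)
      qed
    qed
  qed
  moreover have "(LINT x|lborel. q k x) = 0" for k
  proof -
    have meas: "\<psi> \<in> borel_measurable borel"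
      using cont(1) by (rule borel_measurable_continuous_onI)
    have int: "integrable lborel \<psi>" by (rule test_functions_integrable[OF \<psi>])
    then have "integrable (distr lborel borel ((+) (h k *\<^sub>R axis i 1))) \<psi>"
      by (simp add: lborel_distr_plus)
    then have "integrable lborel (\<lambda>x. \<psi> (x + h k *\<^sub>R axis i 1))"
      using meas by (subst (asm) integrable_distr_eq) (auto simp: add.commute)
    with int show ?thesis
      unfolding q_def by (simp add: integral_lborel_translate[OF meas])
  qed
  ultimately have "(\<lambda>k::nat. 0) \<longlonglongrightarrow> (LINT x|lborel. partial i \<psi> x)"
    by simp
  then show ?thesis by (simp add: LIMSEQ_const_iff)
qed

lemma integral_by_parts_test_functions:
  assumes \<psi>: "\<psi> \<in> test_functions \<Omega>" and \<eta>: "\<eta> \<in> test_functions \<Omega>"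
  shows "(LINT x|lebesgue_on \<Omega>. \<psi> x * partial i \<eta> x) = - (LINT x|lebesgue_on \<Omega>. partial i \<psi> x * \<eta> x)"
proof -
  have prod: "(\<lambda>x. \<psi> x * \<eta> x) \<in> test_functions \<Omega>"
    by (intro test_functions_mult test_functions_Ck[OF \<psi>] \<eta>)
  have eq: "partial i (\<lambda>x. \<psi> x * \<eta> x) = (\<lambda>x. \<psi> x * partial i \<eta> x + partial i \<psi> x * \<eta> x)"
    by (intro ext partial_mult test_functions_differentiable[OF \<psi>] test_functions_differentiable[OF \<eta>])
  have "0 = (LINT x|lebesgue_on \<Omega>. partial i (\<lambda>x. \<psi> x * \<eta> x) x)"
    using integral_partial_test_function[OF prod]
    by (subst integral_eq_lborel)
      (simp_all add: test_functions_borel[OF test_functions_partial[OF prod]]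
        test_functions_support[OF test_functions_partial[OF prod]])
  also have "\<dots> = (LINT x|lebesgue_on \<Omega>. \<psi> x * partial i \<eta> x) + (LINT x|lebesgue_on \<Omega>. partial i \<psi> x * \<eta> x)"
    unfolding eq
    by (intro Bochner_Integration.integral_add L2_mult_integrable test_functions_L2 test_functions_partial \<psi> \<eta>)
  finally show ?thesis by (simp add: eq_neg_iff_add_eq_0)
qed

text \<open>Testing with \<open>box_bump\<close> and passing to the limit shows that g has integral
  0 over every closed box inside \<Omega>; hence g vanishes almost everywhere on each such box, and
  countably many of them cover the open set \<Omega>.\<close>

lemma fundamental_lemma_variations:
  fixes g :: "real ^ 'n \<Rightarrow> complex"
  assumes g: "g \<in> L2 \<Omega>"
    and zero: "\<And>\<psi>. \<psi> \<in> test_functions \<Omega> \<Longrightarrow> (LINT x|lebesgue_on \<Omega>. g x * \<psi> x) = 0"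
  shows "AE x in lebesgue_on \<Omega>. g x = 0"
proof -
  have int: "integrable (lebesgue_on \<Omega>) g" by (rule L2_integrable1[OF g])
  then have si: "set_integrable lebesgue \<Omega> g"
    unfolding set_integrable_def by (subst (asm) integrable_restrict_space) auto
  have box0: "integral (cbox a b) g = 0" if ab: "cbox a b \<subseteq> \<Omega>" for a b
  proof -
    have "(\<lambda>k. LINT x|lebesgue_on \<Omega>. g x * box_bump k a b x) \<longlonglongrightarrow> (LINT x|lebesgue_on \<Omega>. g x * indicator (box a b) x)"
    proof (rule integral_dominated_convergence[where w = "\<lambda>x. norm (g x)"])
      show "(\<lambda>x. g x * box_bump k a b x) \<in> borel_measurable (lebesgue_on \<Omega>)" for k
        using L2_mult_integrable[OF g test_functions_L2[OF box_bump_test[OF ab]]] by simp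
      show "(\<lambda>x. g x * indicator (box a b) x) \<in> borel_measurable (lebesgue_on \<Omega>)"
        by (intro borel_measurable_times L2_borel_measurable[OF g]
            measurable_restrict_space1[OF borel_measurable_indicator]) auto
      show "AE x in lebesgue_on \<Omega>. (\<lambda>k. g x * box_bump k a b x) \<longlonglongrightarrow> g x * indicator (box a b) x"
        by (intro AE_I2 tendsto_intros box_bump_tendsto)
      show "AE x in lebesgue_on \<Omega>. norm (g x * box_bump k a b x) \<le> norm (g x)" for k
        by (intro AE_I2) (simp add: norm_mult mult_left_le[OF norm_box_bump_le norm_ge_zero])
    qed (use int in simp)
    then have "(LINT x|lebesgue_on \<Omega>. g x * indicator (box a b) x) = 0"
      by (simp add: zero[OF box_bump_test[OF ab]] LIMSEQ_const_iff)
    moreover have "(LINT x|lebesgue_on \<Omega>. g x * indicator (box a b) x) = (LINT x|lebesgue. indicator (box a b) x *\<^sub>R g x)"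
    proof -
      have "(LINT x|lebesgue_on \<Omega>. g x * indicator (box a b) x) = (LINT x|lebesgue. indicator \<Omega> x *\<^sub>R (g x * indicator (box a b) x))"
        by (rule integral_restrict_space) simp
      also have "\<dots> = (LINT x|lebesgue. indicator (box a b) x *\<^sub>R g x)"
        using ab box_subset_cbox by (intro Bochner_Integration.integral_cong) (fastforce simp: indicator_def)+
      finally show ?thesis .
    qed
    moreover have "set_integrable lebesgue (box a b) g"
      using si by (rule set_integrable_subset) (use ab box_subset_cbox in auto)
    ultimately have "integral (box a b) g = 0"
      using set_lebesgue_integral_eq_integral(2)[of "box a b" g] by (simp add: set_lebesgue_integral_def)
    then show ?thesis by (simp add: integral_open_interval)
  qed
  obtain D where D: "countable D" "\<And>X. X \<in> D \<Longrightarrow> X \<subseteq> \<Omega>" "\<And>X. X \<in> D \<Longrightarrow> \<exists>a b. X = cbox a b" "\<Union>D = \<Omega>"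
    using open_countable_Union_open_cbox[OF open_dom] by (metis Pow_iff subset_eq)
  have "AE x in lebesgue. \<forall>X\<in>D. x \<in> X \<longrightarrow> g x = 0"
  proof (subst AE_ball_countable[OF D(1)], rule ballI)
    fix X assume X: "X \<in> D"
    then obtain a b where ab: "X = cbox a b" "cbox a b \<subseteq> \<Omega>" using D by metis
    have "set_integrable lebesgue (cbox a b) g"
      using si by (rule set_integrable_subset) (use ab in auto)
    then show "AE x in lebesgue. x \<in> X \<longrightarrow> g x = 0"
      unfolding ab(1) by (rule AE_zero_if_integral_zero_on_boxes) (use box0 ab in blast)
  qed
  then have "AE x in lebesgue. x \<in> \<Omega> \<longrightarrow> g x = 0"
    by eventually_elim (use D(4) in blast)
  then show ?thesis by (simp add: AE_restrict_space_iff)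
qed

end

subsection \<open>The space \<open>H\<^sup>1\<^sub>0(\<Omega>)\<close>\<close>

lemma norm_vec_power2: "(norm (v :: complex ^ 'n))\<^sup>2 = (\<Sum>i\<in>UNIV. (norm (v $ i))\<^sup>2)"
  by (simp add: norm_vec_def L2_set_def sum_nonneg)

lemma L2_vec_nth:
  fixes g :: "real ^ 'n \<Rightarrow> complex ^ 'm"
  assumes "g \<in> L2 \<Omega>" shows "(\<lambda>x. g x $ i) \<in> L2 \<Omega>"
proof (rule L2_dominated[OF _ assms, of _ 1])
  show "(\<lambda>x. g x $ i) \<in> borel_measurable (lebesgue_on \<Omega>)"
    using L2_borel_measurable[OF assms]
    by (rule borel_measurable_continuous_on[rotated]) (intro continuous_intros)
qed (simp add: Finite_Cartesian_Product.norm_nth_le)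

lemma L2_vecI:
  fixes g :: "real ^ 'n \<Rightarrow> complex ^ 'm"
  assumes "\<And>i. (\<lambda>x. g x $ i) \<in> L2 \<Omega>" shows "g \<in> L2 \<Omega>"
proof -
  \<comment> \<open>Measurability of \<open>g\<close> is obtained by writing it as the finite sum of
    its coordinates, each embedded continuously into the vector space.\<close>
  have cont: "continuous_on UNIV (\<lambda>z::complex. \<chi> j. if j = i then z else 0)" for i :: 'm
  proof (rule continuous_on_vec_lambda)
    show "continuous_on UNIV (\<lambda>z::complex. if j = i then z else 0)" for j
      by (cases "j = i") simp_all
  qed
  have "(\<lambda>x. \<Sum>i\<in>UNIV. (\<chi> j. if j = i then g x $ i else 0)) \<in> borel_measurable (lebesgue_on \<Omega>)"
    by (intro borel_measurable_sum borel_measurable_continuous_on[OF cont] L2_borel_measurable assms)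
  also have "(\<lambda>x. \<Sum>i\<in>UNIV. (\<chi> j. if j = i then g x $ i else 0)) = g"
    by (simp add: fun_eq_iff vec_eq_iff)
  finally show ?thesis
    using L2_integrable[OF assms] by (simp add: L2_def norm_vec_power2)
qed

lemma L2_norm_vec:
  fixes g :: "real ^ 'n \<Rightarrow> complex ^ 'm"
  assumes "g \<in> L2 \<Omega>"
  shows "L2_norm \<Omega> g = sqrt (\<Sum>i\<in>UNIV. (L2_norm \<Omega> (\<lambda>x. g x $ i))\<^sup>2)"
proof -
  have "(LINT x|lebesgue_on \<Omega>. (norm (g x))\<^sup>2) = (\<Sum>i\<in>UNIV. (LINT x|lebesgue_on \<Omega>. (norm (g x $ i))\<^sup>2))"
    unfolding norm_vec_power2
    by (rule Bochner_Integration.integral_sum) (rule L2_integrable[OF L2_vec_nth[OF assms]])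
  then show ?thesis by (simp add: L2_norm_def)
qed

lemma L2_norm_vec_tendsto_0:
  fixes g :: "nat \<Rightarrow> real ^ 'n \<Rightarrow> complex ^ 'm"
  assumes "\<And>k. g k \<in> L2 \<Omega>" "\<And>i. (\<lambda>k. L2_norm \<Omega> (\<lambda>x. g k x $ i)) \<longlonglongrightarrow> 0"
  shows "(\<lambda>k. L2_norm \<Omega> (g k)) \<longlonglongrightarrow> 0"
proof -
  have "(\<lambda>k. sqrt (\<Sum>i\<in>UNIV. (L2_norm \<Omega> (\<lambda>x. g k x $ i))\<^sup>2)) \<longlonglongrightarrow> sqrt (\<Sum>i\<in>(UNIV::'m set). 0\<^sup>2)"
    by (intro tendsto_intros assms)
  then show ?thesis by (simp add: L2_norm_vec[OF assms(1)])
qed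

lemma L2_norm_vec_nth_le:
  fixes g :: "real ^ 'n \<Rightarrow> complex ^ 'm"
  assumes "g \<in> L2 \<Omega>"
  shows "L2_norm \<Omega> (\<lambda>x. g x $ i) \<le> L2_norm \<Omega> g"
proof -
  have "(L2_norm \<Omega> (\<lambda>x. g x $ i))\<^sup>2 \<le> (\<Sum>i\<in>UNIV. (L2_norm \<Omega> (\<lambda>x. g x $ i))\<^sup>2)"
    by (rule member_le_sum) auto
  then show ?thesis
    unfolding L2_norm_vec[OF assms] by (rule real_le_rsqrt)
qed

lemma L2_norm_vec_nth_tendsto_0:
  fixes g :: "nat \<Rightarrow> real ^ 'n \<Rightarrow> complex ^ 'm"
  assumes "\<And>k. g k \<in> L2 \<Omega>" "(\<lambda>k. L2_norm \<Omega> (g k)) \<longlonglongrightarrow> 0"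
  shows "(\<lambda>k. L2_norm \<Omega> (\<lambda>x. g k x $ i)) \<longlonglongrightarrow> 0"
  by (rule Lim_null_comparison[OF _ assms(2)]) (simp add: L2_norm_vec_nth_le[OF assms(1)])

lemma L2_norm_add_tendsto_0:
  fixes f g :: "nat \<Rightarrow> real ^ 'n \<Rightarrow> 'b::euclidean_space"
  assumes "\<And>k. f k \<in> L2 \<Omega>" "\<And>k. g k \<in> L2 \<Omega>"
    and "(\<lambda>k. L2_norm \<Omega> (f k)) \<longlonglongrightarrow> 0" "(\<lambda>k. L2_norm \<Omega> (g k)) \<longlonglongrightarrow> 0"
  shows "(\<lambda>k. L2_norm \<Omega> (\<lambda>x. f k x + g k x)) \<longlonglongrightarrow> 0"
proof (rule Lim_null_comparison)
  show "\<forall>\<^sub>F k in sequentially. norm (L2_norm \<Omega> (\<lambda>x. f k x + g k x)) \<le> L2_norm \<Omega> (f k) + L2_norm \<Omega> (g k)"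
    by (simp add: L2_norm_triangle assms)
  show "(\<lambda>k. L2_norm \<Omega> (f k) + L2_norm \<Omega> (g k)) \<longlonglongrightarrow> 0"
    using tendsto_add[OF assms(3,4)] by simp
qed

lemma L2_norm_scale_tendsto_0:
  "(\<lambda>k. L2_norm \<Omega> (f k)) \<longlonglongrightarrow> 0 \<Longrightarrow> (\<lambda>k. L2_norm \<Omega> (\<lambda>x. c * f k x)) \<longlonglongrightarrow> 0" for c :: complex
  unfolding L2_norm_scale by (rule tendsto_mult_right_zero)

lemma L2_norm_mult_plane_wave: "L2_norm \<Omega> (\<lambda>x. plane_wave \<xi> x * f x) = L2_norm \<Omega> f"
  by (simp add: L2_norm_def norm_mult)

text \<open>Unlike \<^const>\<open>weak_grad\<close>, this relation involves no choice, so it passes directly to limits and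
  linear combinations.\<close>

definition h10_grad :: "(real ^ 'n) set \<Rightarrow> (real ^ 'n \<Rightarrow> complex) \<Rightarrow> (real ^ 'n \<Rightarrow> complex ^ 'n) \<Rightarrow> bool" where
  "h10_grad \<Omega> u g \<longleftrightarrow> u \<in> L2 \<Omega> \<and> g \<in> L2 \<Omega> \<and> (\<exists>\<psi>. (\<forall>k. \<psi> k \<in> test_functions \<Omega>)
      \<and> (\<lambda>k. L2_norm \<Omega> (\<lambda>x. \<psi> k x - u x)) \<longlonglongrightarrow> 0
      \<and> (\<lambda>k. L2_norm \<Omega> (\<lambda>x. grad (\<psi> k) x - g x)) \<longlonglongrightarrow> 0)"

text \<open>The Dirichlet form as a function of the gradients themselves, so that any representative
  can be inserted in place of the choice made by \<open>weak_grad\<close>.\<close>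

definition grad_inner ::
  "(real ^ 'n) set \<Rightarrow> (real ^ 'n \<Rightarrow> complex ^ 'n) \<Rightarrow> (real ^ 'n \<Rightarrow> complex ^ 'n) \<Rightarrow> complex" where
  "grad_inner \<Omega> g h = (\<Sum>i\<in>UNIV. L2_inner \<Omega> (\<lambda>x. g x $ i) (\<lambda>x. h x $ i))"

lemma dirichlet_form_eq_grad_inner:
  "dirichlet_form \<Omega> u v = grad_inner \<Omega> (weak_grad \<Omega> u) (weak_grad \<Omega> v)"
  by (simp add: dirichlet_form_def grad_inner_def)

lemma L2_inner_self: "L2_inner \<Omega> f f = of_real ((L2_norm \<Omega> f)\<^sup>2)"
  unfolding L2_inner_def L2_norm_power2 complex_norm_square[symmetric]
  by (rule integral_complex_of_real)

lemma grad_inner_self: "g \<in> L2 \<Omega> \<Longrightarrow> grad_inner \<Omega> g g = of_real ((L2_norm \<Omega> g)\<^sup>2)"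
  by (simp add: grad_inner_def L2_inner_self L2_norm_vec sum_nonneg)

lemma L2_inner_cong_AE:
  assumes "f \<in> L2 \<Omega>" "f' \<in> L2 \<Omega>" "g \<in> L2 \<Omega>" "g' \<in> L2 \<Omega>"
    and "AE x in lebesgue_on \<Omega>. f x = f' x" "AE x in lebesgue_on \<Omega>. g x = g' x"
  shows "L2_inner \<Omega> f g = L2_inner \<Omega> f' g'"
  unfolding L2_inner_def
proof (rule integral_cong_AE)
  show "AE x in lebesgue_on \<Omega>. f x * cnj (g x) = f' x * cnj (g' x)"
    using assms(5,6) by eventually_elim simp
qed (intro borel_measurable_times borel_measurable_cnj L2_borel_measurable assms)+

lemma grad_inner_cong_AE:
  assumes "g \<in> L2 \<Omega>" "g' \<in> L2 \<Omega>" "h \<in> L2 \<Omega>" "h' \<in> L2 \<Omega>"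
    and "AE x in lebesgue_on \<Omega>. g x = g' x" "AE x in lebesgue_on \<Omega>. h x = h' x"
  shows "grad_inner \<Omega> g h = grad_inner \<Omega> g' h'"
  unfolding grad_inner_def
proof (intro sum.cong refl L2_inner_cong_AE L2_vec_nth assms)
  fix i
  show "AE x in lebesgue_on \<Omega>. g x $ i = g' x $ i" "AE x in lebesgue_on \<Omega>. h x $ i = h' x $ i"
    using assms(5,6) by (auto elim: eventually_mono)
qed

lemma grad_nth [simp]: "grad f x $ i = partial i f x"
  by (simp add: grad_def)

section \<open>Calculus with approximable gradients\<close>

context bounded_open
begin

lemma grad_test_function_L2: "\<psi> \<in> test_functions \<Omega> \<Longrightarrow> grad \<psi> \<in> L2 \<Omega>"
  by (rule L2_vecI) (simp add: test_functions_L2 test_functions_partial)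

lemma h10_grad_test_function: "\<psi> \<in> test_functions \<Omega> \<Longrightarrow> h10_grad \<Omega> \<psi> (grad \<psi>)"
  unfolding h10_grad_def
  by (intro conjI exI[of _ "\<lambda>k. \<psi>"]) (simp_all add: test_functions_L2 grad_test_function_L2 L2_norm_def)

lemma h10_gradE:
  assumes "h10_grad \<Omega> u g"
  obtains \<psi> where "\<And>k. \<psi> k \<in> test_functions \<Omega>"
    "(\<lambda>k. L2_norm \<Omega> (\<lambda>x. \<psi> k x - u x)) \<longlonglongrightarrow> 0"
    "(\<lambda>k. L2_norm \<Omega> (\<lambda>x. grad (\<psi> k) x - g x)) \<longlonglongrightarrow> 0"
    "\<And>i. (\<lambda>k. L2_norm \<Omega> (\<lambda>x. partial i (\<psi> k) x - g x $ i)) \<longlonglongrightarrow> 0"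
    "u \<in> L2 \<Omega>" "g \<in> L2 \<Omega>"
proof -
  obtain \<psi> where \<psi>: "\<And>k. \<psi> k \<in> test_functions \<Omega>"
    "(\<lambda>k. L2_norm \<Omega> (\<lambda>x. \<psi> k x - u x)) \<longlonglongrightarrow> 0"
    "(\<lambda>k. L2_norm \<Omega> (\<lambda>x. grad (\<psi> k) x - g x)) \<longlonglongrightarrow> 0"
    and L2: "u \<in> L2 \<Omega>" "g \<in> L2 \<Omega>"
    using assms unfolding h10_grad_def by blast
  have "(\<lambda>k. L2_norm \<Omega> (\<lambda>x. (grad (\<psi> k) x - g x) $ i)) \<longlonglongrightarrow> 0" for i
    by (rule L2_norm_vec_nth_tendsto_0[OF L2_diff[OF grad_test_function_L2[OF \<psi>(1)] L2(2)] \<psi>(3)])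
  then show ?thesis using that[OF \<psi> _ L2] by simp
qed

lemma h10_gradI:
  assumes L2: "u \<in> L2 \<Omega>" "g \<in> L2 \<Omega>" and \<psi>: "\<And>k. \<psi> k \<in> test_functions \<Omega>"
    and "(\<lambda>k. L2_norm \<Omega> (\<lambda>x. \<psi> k x - u x)) \<longlonglongrightarrow> 0"
    and lim: "\<And>i. (\<lambda>k. L2_norm \<Omega> (\<lambda>x. partial i (\<psi> k) x - g x $ i)) \<longlonglongrightarrow> 0"
  shows "h10_grad \<Omega> u g"
proof -
  have "(\<lambda>k. L2_norm \<Omega> (\<lambda>x. grad (\<psi> k) x - g x)) \<longlonglongrightarrow> 0"
    by (rule L2_norm_vec_tendsto_0[OF L2_diff[OF grad_test_function_L2[OF \<psi>] L2(2)]]) (simp add: lim)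
  with assms show ?thesis unfolding h10_grad_def by blast
qed

text \<open>Both sides are continuous in L^2 along approximating test functions, for which the
  identity has been proved. Approximation of both factors by test functions is what rules out a
  boundary term.\<close>

lemma h10_grad_by_parts:
  assumes "h10_grad \<Omega> u g" "h10_grad \<Omega> v h"
  shows "(LINT x|lebesgue_on \<Omega>. u x * h x $ i) = - (LINT x|lebesgue_on \<Omega>. g x $ i * v x)"
proof -
  obtain \<psi> where \<psi>: "\<And>k. \<psi> k \<in> test_functions \<Omega>"
    "(\<lambda>k. L2_norm \<Omega> (\<lambda>x. \<psi> k x - u x)) \<longlonglongrightarrow> 0"
    "(\<lambda>k. L2_norm \<Omega> (\<lambda>x. grad (\<psi> k) x - g x)) \<longlonglongrightarrow> 0"
    "\<And>i. (\<lambda>k. L2_norm \<Omega> (\<lambda>x. partial i (\<psi> k) x - g x $ i)) \<longlonglongrightarrow> 0"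
    "u \<in> L2 \<Omega>" "g \<in> L2 \<Omega>"
    by (rule h10_gradE[OF assms(1)]) (rule that; assumption)
  obtain \<eta> where \<eta>: "\<And>k. \<eta> k \<in> test_functions \<Omega>"
    "(\<lambda>k. L2_norm \<Omega> (\<lambda>x. \<eta> k x - v x)) \<longlonglongrightarrow> 0"
    "(\<lambda>k. L2_norm \<Omega> (\<lambda>x. grad (\<eta> k) x - h x)) \<longlonglongrightarrow> 0"
    "\<And>i. (\<lambda>k. L2_norm \<Omega> (\<lambda>x. partial i (\<eta> k) x - h x $ i)) \<longlonglongrightarrow> 0"
    "v \<in> L2 \<Omega>" "h \<in> L2 \<Omega>"
    by (rule h10_gradE[OF assms(2)]) (rule that; assumption)
  \<comment> \<open>The integrals carry no conjugate, whereas \<open>L2_inner\<close> conjugates its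
    second argument; inserting \<open>cnj\<close> there makes \<open>L2_inner_tendsto\<close>
    applicable.\<close>
  have lim: "(\<lambda>k. L2_inner \<Omega> (F k) (\<lambda>x. cnj (G k x))) \<longlonglongrightarrow> L2_inner \<Omega> f (\<lambda>x. cnj (g x))"
    if "\<And>k. F k \<in> test_functions \<Omega>" "\<And>k. G k \<in> test_functions \<Omega>" "f \<in> L2 \<Omega>" "g \<in> L2 \<Omega>"
      "(\<lambda>k. L2_norm \<Omega> (\<lambda>x. F k x - f x)) \<longlonglongrightarrow> 0" "(\<lambda>k. L2_norm \<Omega> (\<lambda>x. G k x - g x)) \<longlonglongrightarrow> 0" for F G f g
  proof (rule L2_inner_tendsto)
    have "L2_norm \<Omega> (\<lambda>x. cnj (G k x) - cnj (g x)) = L2_norm \<Omega> (\<lambda>x. G k x - g x)" for k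
      by (simp add: L2_norm_def flip: complex_cnj_diff)
    then show "(\<lambda>k. L2_norm \<Omega> (\<lambda>x. cnj (G k x) - cnj (g x))) \<longlonglongrightarrow> 0"
      using that(6) by simp
  qed (use that in \<open>auto intro: test_functions_L2 L2_cnj\<close>)
  have "(\<lambda>k. L2_inner \<Omega> (\<psi> k) (\<lambda>x. cnj (partial i (\<eta> k) x))) \<longlonglongrightarrow> L2_inner \<Omega> u (\<lambda>x. cnj (h x $ i))"
    by (intro lim \<psi> \<eta> test_functions_partial L2_vec_nth)
  moreover have "(\<lambda>k. - L2_inner \<Omega> (partial i (\<psi> k)) (\<lambda>x. cnj (\<eta> k x))) \<longlonglongrightarrow> - L2_inner \<Omega> (\<lambda>x. g x $ i) (\<lambda>x. cnj (v x))"
    by (intro tendsto_minus lim \<psi> \<eta> test_functions_partial L2_vec_nth)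
  moreover have "L2_inner \<Omega> (\<psi> k) (\<lambda>x. cnj (partial i (\<eta> k) x)) = - L2_inner \<Omega> (partial i (\<psi> k)) (\<lambda>x. cnj (\<eta> k x))" for k
    using integral_by_parts_test_functions[OF \<psi>(1) \<eta>(1)] by (simp add: L2_inner_def)
  ultimately have "L2_inner \<Omega> u (\<lambda>x. cnj (h x $ i)) = - L2_inner \<Omega> (\<lambda>x. g x $ i) (\<lambda>x. cnj (v x))"
    using LIMSEQ_unique by simp
  then show ?thesis by (simp add: L2_inner_def)
qed

lemma h10_grad_has_weak_gradient:
  assumes "h10_grad \<Omega> u g" shows "has_weak_gradient \<Omega> u g"
  using h10_grad_by_parts[OF assms h10_grad_test_function] by (simp add: has_weak_gradient_def)

lemma weak_gradient_unique:
  assumes "g \<in> L2 \<Omega>" "h \<in> L2 \<Omega>" "has_weak_gradient \<Omega> u g" "has_weak_gradient \<Omega> u h"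
  shows "AE x in lebesgue_on \<Omega>. g x = h x"
proof -
  have "AE x in lebesgue_on \<Omega>. \<forall>i. g x $ i - h x $ i = 0"
  proof (subst AE_all_countable, rule allI)
    fix i
    show "AE x in lebesgue_on \<Omega>. g x $ i - h x $ i = 0"
    proof (rule fundamental_lemma_variations)
      fix \<psi> assume \<psi>: "\<psi> \<in> test_functions \<Omega>"
      have "(LINT x|lebesgue_on \<Omega>. g x $ i * \<psi> x) = (LINT x|lebesgue_on \<Omega>. h x $ i * \<psi> x)"
        using assms(3)[unfolded has_weak_gradient_def, rule_format, OF \<psi>, of i]
          assms(4)[unfolded has_weak_gradient_def, rule_format, OF \<psi>, of i] by simp
      then show "(LINT x|lebesgue_on \<Omega>. (g x $ i - h x $ i) * \<psi> x) = 0"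
        using assms(1,2) \<psi>
        by (simp add: left_diff_distrib L2_mult_integrable L2_vec_nth test_functions_L2)
    qed (intro L2_diff L2_vec_nth assms)
  qed
  then show ?thesis by eventually_elim (simp add: vec_eq_iff)
qed

lemma H10_imp_h10_grad:
  assumes "u \<in> H10 \<Omega>" shows "h10_grad \<Omega> u (weak_grad \<Omega> u)"
proof -
  have "\<exists>g. g \<in> L2 \<Omega> \<and> has_weak_gradient \<Omega> u g"
    using assms by (auto simp: H10_def H1_def)
  then have "weak_grad \<Omega> u \<in> L2 \<Omega>"
    unfolding weak_grad_def by (rule someI2_ex) blast
  then show ?thesis
    using assms by (auto simp: H10_def H1_def h10_grad_def)
qed

lemma H10_L2: "u \<in> H10 \<Omega> \<Longrightarrow> u \<in> L2 \<Omega>" and weak_grad_L2: "u \<in> H10 \<Omega> \<Longrightarrow> weak_grad \<Omega> u \<in> L2 \<Omega>"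
  using H10_imp_h10_grad by (auto simp: h10_grad_def)

text \<open>The bridge back to the given definitions: weak gradients are unique almost everywhere,
  so \<open>weak_grad\<close> agrees with \<open>g\<close>, and the test functions that approximate
  \<open>u\<close> and \<open>g\<close> witness membership in \<open>H10\<close>.\<close>

lemma h10_grad_weak_grad:
  assumes "h10_grad \<Omega> u g"
  shows "AE x in lebesgue_on \<Omega>. weak_grad \<Omega> u x = g x" and "u \<in> H10 \<Omega>"
proof -
  have g: "g \<in> L2 \<Omega>" "u \<in> L2 \<Omega>" "has_weak_gradient \<Omega> u g"
    using assms h10_grad_has_weak_gradient by (auto simp: h10_grad_def)
  then have "\<exists>g. g \<in> L2 \<Omega> \<and> has_weak_gradient \<Omega> u g" by blast
  from someI_ex[OF this] have wg: "weak_grad \<Omega> u \<in> L2 \<Omega>" "has_weak_gradient \<Omega> u (weak_grad \<Omega> u)"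
    unfolding weak_grad_def by blast+
  show ae: "AE x in lebesgue_on \<Omega>. weak_grad \<Omega> u x = g x"
    by (rule weak_gradient_unique[OF wg(1) g(1) wg(2) g(3)])
  obtain \<psi> where \<psi>: "\<And>k. \<psi> k \<in> test_functions \<Omega>"
    "(\<lambda>k. L2_norm \<Omega> (\<lambda>x. \<psi> k x - u x)) \<longlonglongrightarrow> 0"
    "(\<lambda>k. L2_norm \<Omega> (\<lambda>x. grad (\<psi> k) x - g x)) \<longlonglongrightarrow> 0"
    "\<And>i. (\<lambda>k. L2_norm \<Omega> (\<lambda>x. partial i (\<psi> k) x - g x $ i)) \<longlonglongrightarrow> 0"
    "u \<in> L2 \<Omega>" "g \<in> L2 \<Omega>"
    by (rule h10_gradE[OF assms]) (rule that; assumption)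
  have "L2_norm \<Omega> (\<lambda>x. grad (\<psi> k) x - weak_grad \<Omega> u x) = L2_norm \<Omega> (\<lambda>x. grad (\<psi> k) x - g x)" for k
    by (intro L2_norm_cong_AE L2_borel_measurable L2_diff grad_test_function_L2 \<psi> g wg)
      (use ae in \<open>auto elim: eventually_mono\<close>)
  then have "(\<lambda>k. L2_norm \<Omega> (\<lambda>x. grad (\<psi> k) x - weak_grad \<Omega> u x)) \<longlonglongrightarrow> 0"
    using \<psi>(3) by simp
  moreover have "u \<in> H1 \<Omega>"
    unfolding H1_def using g by blast
  ultimately show "u \<in> H10 \<Omega>"
    unfolding H10_def using \<psi>(1,2) by blast
qed

lemma h10_grad_lincomb:
  assumes "h10_grad \<Omega> u g" "h10_grad \<Omega> v h"
  shows "h10_grad \<Omega> (\<lambda>x. u x + c * v x) (\<lambda>x. \<chi> i. g x $ i + c * h x $ i)"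
proof -
  obtain \<psi> where \<psi>: "\<And>k. \<psi> k \<in> test_functions \<Omega>"
    "(\<lambda>k. L2_norm \<Omega> (\<lambda>x. \<psi> k x - u x)) \<longlonglongrightarrow> 0"
    "(\<lambda>k. L2_norm \<Omega> (\<lambda>x. grad (\<psi> k) x - g x)) \<longlonglongrightarrow> 0"
    "\<And>i. (\<lambda>k. L2_norm \<Omega> (\<lambda>x. partial i (\<psi> k) x - g x $ i)) \<longlonglongrightarrow> 0"
    "u \<in> L2 \<Omega>" "g \<in> L2 \<Omega>"
    by (rule h10_gradE[OF assms(1)]) (rule that; assumption)
  obtain \<eta> where \<eta>: "\<And>k. \<eta> k \<in> test_functions \<Omega>"
    "(\<lambda>k. L2_norm \<Omega> (\<lambda>x. \<eta> k x - v x)) \<longlonglongrightarrow> 0"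
    "(\<lambda>k. L2_norm \<Omega> (\<lambda>x. grad (\<eta> k) x - h x)) \<longlonglongrightarrow> 0"
    "\<And>i. (\<lambda>k. L2_norm \<Omega> (\<lambda>x. partial i (\<eta> k) x - h x $ i)) \<longlonglongrightarrow> 0"
    "v \<in> L2 \<Omega>" "h \<in> L2 \<Omega>"
    by (rule h10_gradE[OF assms(2)]) (rule that; assumption)
  have c\<eta>: "(\<lambda>x. c * \<eta> k x) \<in> test_functions \<Omega>" for k
    by (rule test_functions_mult[OF \<eta>(1) Ck_const])
  have pc: "partial i (\<lambda>x. c * \<eta> k x) x = c * partial i (\<eta> k) x" for i k x
    using partial_mult[of "\<lambda>x. c" x "\<eta> k" i] test_functions_differentiable[OF \<eta>(1)]
    by (simp add: partial_const)
  have p: "partial i (\<lambda>x. \<psi> k x + c * \<eta> k x) x = partial i (\<psi> k) x + c * partial i (\<eta> k) x" for i k x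
    using partial_add[of "\<psi> k" x "\<lambda>x. c * \<eta> k x" i] test_functions_differentiable[OF \<psi>(1)]
      test_functions_differentiable[OF c\<eta>] by (simp add: pc)
  show ?thesis
  proof (rule h10_gradI)
    show "(\<lambda>x. u x + c * v x) \<in> L2 \<Omega>"
      by (intro L2_add L2_scale \<psi> \<eta>)
    show "(\<lambda>x. \<chi> i. g x $ i + c * h x $ i) \<in> L2 \<Omega>"
      by (rule L2_vecI) (simp, intro L2_add L2_scale L2_vec_nth \<psi> \<eta>)
    show "(\<lambda>x. \<psi> k x + c * \<eta> k x) \<in> test_functions \<Omega>" for k
      by (rule test_functions_add[OF \<psi>(1) c\<eta>])
    have "(\<lambda>k. L2_norm \<Omega> (\<lambda>x. (\<psi> k x - u x) + c * (\<eta> k x - v x))) \<longlonglongrightarrow> 0"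
      by (intro L2_norm_add_tendsto_0 L2_norm_scale_tendsto_0 L2_scale L2_diff test_functions_L2 \<psi> \<eta>)
    then show "(\<lambda>k. L2_norm \<Omega> (\<lambda>x. \<psi> k x + c * \<eta> k x - (u x + c * v x))) \<longlonglongrightarrow> 0"
      by (simp add: algebra_simps)
    fix i
    have "(\<lambda>k. L2_norm \<Omega> (\<lambda>x. (partial i (\<psi> k) x - g x $ i) + c * (partial i (\<eta> k) x - h x $ i))) \<longlonglongrightarrow> 0"
      by (intro L2_norm_add_tendsto_0 L2_norm_scale_tendsto_0 L2_scale L2_diff test_functions_L2
          test_functions_partial L2_vec_nth \<psi> \<eta>)
    then show "(\<lambda>k. L2_norm \<Omega> (\<lambda>x. partial i (\<lambda>x. \<psi> k x + c * \<eta> k x) x - (\<chi> i. g x $ i + c * h x $ i) $ i)) \<longlonglongrightarrow> 0"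
      by (simp add: p algebra_simps)
  qed
qed

text \<open>Multiplication by a plane wave preserves test functions and the L^2 norm, and the
  product rule turns the gradient g into exp(i \<xi> x) (g + i \<xi> u); so an approximating
  sequence for \<open>u\<close> stays one after modulation.\<close>

lemma h10_grad_plane_wave:
  assumes "h10_grad \<Omega> u g"
  shows "h10_grad \<Omega> (\<lambda>x. plane_wave \<xi> x * u x)
    (\<lambda>x. \<chi> i. plane_wave \<xi> x * (g x $ i + \<i> * of_real (\<xi> $ i) * u x))"
proof -
  obtain \<psi> where \<psi>: "\<And>k. \<psi> k \<in> test_functions \<Omega>"
    "(\<lambda>k. L2_norm \<Omega> (\<lambda>x. \<psi> k x - u x)) \<longlonglongrightarrow> 0"
    "(\<lambda>k. L2_norm \<Omega> (\<lambda>x. grad (\<psi> k) x - g x)) \<longlonglongrightarrow> 0"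
    "\<And>i. (\<lambda>k. L2_norm \<Omega> (\<lambda>x. partial i (\<psi> k) x - g x $ i)) \<longlonglongrightarrow> 0"
    "u \<in> L2 \<Omega>" "g \<in> L2 \<Omega>"
    by (rule h10_gradE[OF assms]) (rule that; assumption)
  have "Ck (Suc 0) (plane_wave \<xi>)" by (rule Ck_plane_wave)
  then have diff: "plane_wave \<xi> differentiable (at x)" for x by simp
  have p: "partial i (\<lambda>x. plane_wave \<xi> x * \<psi> k x) x
      = plane_wave \<xi> x * (partial i (\<psi> k) x + \<i> * of_real (\<xi> $ i) * \<psi> k x)" for i k x
    using partial_mult[OF diff test_functions_differentiable[OF \<psi>(1)]] partial_plane_wave[of i 1 \<xi>]
    by (simp add: algebra_simps)
  have pw: "(\<lambda>x. plane_wave \<xi> x * f x) \<in> L2 \<Omega>" if "f \<in> L2 \<Omega>" for f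
    by (rule L2_bounded_mult[where C = 1])
      (use that Ck_plane_wave[of 0 \<xi>] in \<open>auto intro: continuous_borel_measurable_dom\<close>)
  show ?thesis
  proof (rule h10_gradI)
    show "(\<lambda>x. plane_wave \<xi> x * u x) \<in> L2 \<Omega>"
      by (intro pw \<psi>)
    show "(\<lambda>x. \<chi> i. plane_wave \<xi> x * (g x $ i + \<i> * of_real (\<xi> $ i) * u x)) \<in> L2 \<Omega>"
      by (rule L2_vecI) (simp, intro pw L2_add L2_scale L2_vec_nth \<psi>)
    show "(\<lambda>x. plane_wave \<xi> x * \<psi> k x) \<in> test_functions \<Omega>" for k
      by (intro test_functions_mult \<psi> Ck_plane_wave)
    show "(\<lambda>k. L2_norm \<Omega> (\<lambda>x. plane_wave \<xi> x * \<psi> k x - plane_wave \<xi> x * u x)) \<longlonglongrightarrow> 0"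
      using \<psi>(2) by (simp add: L2_norm_mult_plane_wave flip: right_diff_distrib)
    fix i
    have "(\<lambda>k. L2_norm \<Omega> (\<lambda>x. (partial i (\<psi> k) x - g x $ i) + (\<i> * of_real (\<xi> $ i)) * (\<psi> k x - u x))) \<longlonglongrightarrow> 0"
      by (intro L2_norm_add_tendsto_0 L2_norm_scale_tendsto_0 L2_scale L2_diff test_functions_L2
          test_functions_partial L2_vec_nth \<psi>)
    then have "(\<lambda>k. L2_norm \<Omega> (\<lambda>x. plane_wave \<xi> x *
        ((partial i (\<psi> k) x - g x $ i) + (\<i> * of_real (\<xi> $ i)) * (\<psi> k x - u x)))) \<longlonglongrightarrow> 0"
      by (simp only: L2_norm_mult_plane_wave)
    then show "(\<lambda>k. L2_norm \<Omega> (\<lambda>x. partial i (\<lambda>x. plane_wave \<xi> x * \<psi> k x) x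
        - (\<chi> i. plane_wave \<xi> x * (g x $ i + \<i> * of_real (\<xi> $ i) * u x)) $ i)) \<longlonglongrightarrow> 0"
      by (simp add: p algebra_simps)
  qed
qed

text \<open>A diagonal choice: for each n take a test function within 1 / (n + 1) of
  \<open>u n\<close> and of \<open>g n\<close> in L^2, and apply the triangle inequality.\<close>

lemma h10_grad_closed:
  assumes ug: "\<And>n. h10_grad \<Omega> (u n) (g n)" and L2: "v \<in> L2 \<Omega>" "h \<in> L2 \<Omega>"
    and "(\<lambda>n. L2_norm \<Omega> (\<lambda>x. u n x - v x)) \<longlonglongrightarrow> 0" "(\<lambda>n. L2_norm \<Omega> (\<lambda>x. g n x - h x)) \<longlonglongrightarrow> 0"
  shows "h10_grad \<Omega> v h"
proof -
  have L2': "u n \<in> L2 \<Omega>" "g n \<in> L2 \<Omega>" for n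
    using ug by (auto simp: h10_grad_def)
  have "\<exists>\<psi>\<in>test_functions \<Omega>. L2_norm \<Omega> (\<lambda>x. \<psi> x - u n x) < inverse (real (Suc n))
      \<and> L2_norm \<Omega> (\<lambda>x. grad \<psi> x - g n x) < inverse (real (Suc n))" for n
  proof -
    obtain \<psi> where \<psi>: "\<And>k. \<psi> k \<in> test_functions \<Omega>"
    "(\<lambda>k. L2_norm \<Omega> (\<lambda>x. \<psi> k x - u n x)) \<longlonglongrightarrow> 0"
    "(\<lambda>k. L2_norm \<Omega> (\<lambda>x. grad (\<psi> k) x - g n x)) \<longlonglongrightarrow> 0"
    "\<And>i. (\<lambda>k. L2_norm \<Omega> (\<lambda>x. partial i (\<psi> k) x - g n x $ i)) \<longlonglongrightarrow> 0"
    "u n \<in> L2 \<Omega>" "g n \<in> L2 \<Omega>"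
    by (rule h10_gradE[OF ug[of n]]) (rule that; assumption)
    have pos: "0 < inverse (real (Suc n))" by simp
    have "\<forall>\<^sub>F k in sequentially. L2_norm \<Omega> (\<lambda>x. \<psi> k x - u n x) < inverse (real (Suc n))
        \<and> L2_norm \<Omega> (\<lambda>x. grad (\<psi> k) x - g n x) < inverse (real (Suc n))"
      using order_tendstoD(2)[OF \<psi>(2) pos] order_tendstoD(2)[OF \<psi>(3) pos] by eventually_elim simp
    then obtain k where "L2_norm \<Omega> (\<lambda>x. \<psi> k x - u n x) < inverse (real (Suc n))
        \<and> L2_norm \<Omega> (\<lambda>x. grad (\<psi> k) x - g n x) < inverse (real (Suc n))"
      using eventually_happens'[OF sequentially_bot] by blast
    with \<psi>(1) show ?thesis by blast
  qed
  then obtain \<psi> where \<psi>: "\<And>n. \<psi> n \<in> test_functions \<Omega>"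
    "\<And>n. L2_norm \<Omega> (\<lambda>x. \<psi> n x - u n x) < inverse (real (Suc n))"
    "\<And>n. L2_norm \<Omega> (\<lambda>x. grad (\<psi> n) x - g n x) < inverse (real (Suc n))"
    by metis
  have "(\<lambda>n. L2_norm \<Omega> (\<lambda>x. \<psi> n x - u n x)) \<longlonglongrightarrow> 0"
    by (rule Lim_null_comparison[OF _ LIMSEQ_inverse_real_of_nat]) (simp add: less_imp_le \<psi> del: of_nat_Suc)
  then have "(\<lambda>n. L2_norm \<Omega> (\<lambda>x. (\<psi> n x - u n x) + (u n x - v x))) \<longlonglongrightarrow> 0"
    by (intro L2_norm_add_tendsto_0 L2_diff test_functions_L2 \<psi> L2 L2' assms(4))
  moreover have "(\<lambda>n. L2_norm \<Omega> (\<lambda>x. grad (\<psi> n) x - g n x)) \<longlonglongrightarrow> 0"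
    by (rule Lim_null_comparison[OF _ LIMSEQ_inverse_real_of_nat]) (simp add: less_imp_le \<psi> del: of_nat_Suc)
  then have "(\<lambda>n. L2_norm \<Omega> (\<lambda>x. (grad (\<psi> n) x - g n x) + (g n x - h x))) \<longlonglongrightarrow> 0"
    by (intro L2_norm_add_tendsto_0 L2_diff grad_test_function_L2 \<psi> L2 L2' assms(5))
  ultimately show ?thesis
    unfolding h10_grad_def using L2 \<psi>(1) by auto
qed

text \<open>The cross term \<open>2 \<xi> \<bullet> Im \<integral> \<phi> \<nabla>\<phi>\<close> vanishes because \<open>\<integral> \<phi> \<nabla>\<phi> = - \<integral> \<phi> \<nabla>\<phi>\<close>.\<close>

lemma energy_plane_wave:
  assumes "h10_grad \<Omega> (\<lambda>x. of_real (\<phi> x)) g"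
  shows "(L2_norm \<Omega> (\<lambda>x. \<chi> i. plane_wave \<xi> x * (g x $ i + \<i> * of_real (\<xi> $ i) * of_real (\<phi> x))))\<^sup>2
    = (L2_norm \<Omega> g)\<^sup>2 + (norm \<xi>)\<^sup>2 * (L2_norm \<Omega> \<phi>)\<^sup>2"
proof -
  let ?M = "lebesgue_on \<Omega>"
  let ?w = "\<lambda>x. \<chi> i. plane_wave \<xi> x * (g x $ i + \<i> * of_real (\<xi> $ i) * of_real (\<phi> x))"
  have L2: "(\<lambda>x. complex_of_real (\<phi> x)) \<in> L2 \<Omega>" "g \<in> L2 \<Omega>"
    using assms by (auto simp: h10_grad_def)
  have w: "?w \<in> L2 \<Omega>"
    using h10_grad_plane_wave[OF assms, of \<xi>] by (simp add: h10_grad_def)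
  \<comment> \<open>The gradient \<open>g\<close> is not shown to be real. Integration by parts of
    \<phi> against itself gives I = - I, and a vanishing integral is enough for the cross
    term.\<close>
  have zero: "(LINT x|?M. of_real (\<phi> x) * g x $ i) = 0" for i
    using h10_grad_by_parts[OF assms assms, of i] by (simp add: mult.commute)
  have comp: "(L2_norm \<Omega> (\<lambda>x. ?w x $ i))\<^sup>2 = (L2_norm \<Omega> (\<lambda>x. g x $ i))\<^sup>2 + (\<xi> $ i)\<^sup>2 * (L2_norm \<Omega> \<phi>)\<^sup>2" for i
  proof -
    have gi: "(\<lambda>x. g x $ i) \<in> L2 \<Omega>" by (rule L2_vec_nth[OF L2(2)])
    have int: "integrable ?M (\<lambda>x. of_real (\<phi> x) * g x $ i)"
      by (rule L2_mult_integrable[OF L2(1) gi])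
    have "(norm (?w x $ i))\<^sup>2 = (norm (g x $ i))\<^sup>2 + (\<xi> $ i)\<^sup>2 * (norm (\<phi> x))\<^sup>2
        + 2 * \<xi> $ i * Im (of_real (\<phi> x) * g x $ i)" for x
    proof -
      have "norm (?w x $ i) = norm (g x $ i + \<i> * of_real (\<xi> $ i) * of_real (\<phi> x))"
        unfolding vec_lambda_beta norm_mult by simp
      then show ?thesis
        by (simp add: cmod_power2) (simp add: power2_eq_square algebra_simps)
    qed
    then have "(L2_norm \<Omega> (\<lambda>x. ?w x $ i))\<^sup>2 = (LINT x|?M. (norm (g x $ i))\<^sup>2 + (\<xi> $ i)\<^sup>2 * (norm (\<phi> x))\<^sup>2
        + 2 * \<xi> $ i * Im (of_real (\<phi> x) * g x $ i))"
      by (simp add: L2_norm_power2)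
    also have "\<dots> = (LINT x|?M. (norm (g x $ i))\<^sup>2) + (\<xi> $ i)\<^sup>2 * (LINT x|?M. (norm (\<phi> x))\<^sup>2)
        + 2 * \<xi> $ i * (LINT x|?M. Im (of_real (\<phi> x) * g x $ i))"
      using L2_integrable[OF gi] L2_integrable[OF L2(1)] integrable_Im[OF int]
      by simp
    also have "(LINT x|?M. Im (of_real (\<phi> x) * g x $ i)) = 0"
      using integral_Im[OF int] zero by simp
    finally show ?thesis by (simp add: L2_norm_power2)
  qed
  have "(L2_norm \<Omega> ?w)\<^sup>2 = (\<Sum>i\<in>UNIV. (L2_norm \<Omega> (\<lambda>x. ?w x $ i))\<^sup>2)"
    unfolding L2_norm_vec[OF w] by (simp add: sum_nonneg)
  also have "\<dots> = (\<Sum>i\<in>UNIV. (L2_norm \<Omega> (\<lambda>x. g x $ i))\<^sup>2) + (\<Sum>i\<in>UNIV. (\<xi> $ i)\<^sup>2) * (L2_norm \<Omega> \<phi>)\<^sup>2"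
    by (simp only: comp sum.distrib sum_distrib_right)
  also have "(\<Sum>i\<in>UNIV. (L2_norm \<Omega> (\<lambda>x. g x $ i))\<^sup>2) = (L2_norm \<Omega> g)\<^sup>2"
    unfolding L2_norm_vec[OF L2(2)] by (simp add: sum_nonneg)
  also have "(\<Sum>i\<in>UNIV. (\<xi> $ i)\<^sup>2) = (norm \<xi>)\<^sup>2"
    by (simp add: norm_vec_def L2_set_def sum_nonneg)
  finally show ?thesis .
qed

end

subsection \<open>Gaussian integrals\<close>

lemma (in pair_sigma_finite) integrable_mult_pair:
  fixes f :: "'a \<Rightarrow> 'c::{real_normed_field,banach,second_countable_topology}"
  assumes f: "integrable M1 f" and g: "integrable M2 g"
  shows "integrable (M1 \<Otimes>\<^sub>M M2) (\<lambda>p. f (fst p) * g (snd p))"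
    and "(LINT p|(M1 \<Otimes>\<^sub>M M2). f (fst p) * g (snd p)) = (LINT x|M1. f x) * (LINT y|M2. g y)"
proof -
  note [measurable] = borel_measurable_integrable[OF f] borel_measurable_integrable[OF g]
  show int: "integrable (M1 \<Otimes>\<^sub>M M2) (\<lambda>p. f (fst p) * g (snd p))"
  proof (rule Fubini_integrable)
    show "(\<lambda>p. f (fst p) * g (snd p)) \<in> borel_measurable (M1 \<Otimes>\<^sub>M M2)" by measurable
    show "integrable M1 (\<lambda>x. LINT y|M2. norm (f (fst (x, y)) * g (snd (x, y))))"
      using f by (simp add: norm_mult integrable_norm)
    show "AE x in M1. integrable M2 (\<lambda>y. f (fst (x, y)) * g (snd (x, y)))"
      using g by simp
  qed
  show "(LINT p|(M1 \<Otimes>\<^sub>M M2). f (fst p) * g (snd p)) = (LINT x|M1. f x) * (LINT y|M2. g y)"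
    using integral_fst'[OF int] f g by simp
qed

text \<open>The substitution x = c s with c^2 = 2 a reduces both claims to the standard normal
  density and its characteristic function exp(- z^2 / 2).\<close>

lemma gaussian_char_real:
  fixes a z :: real
  assumes "a > 0"
  shows "integrable lborel (\<lambda>s. complex_of_real (exp (- a * s\<^sup>2)) * exp (\<i> * of_real (z * s)))"
    and "(LINT s|lborel. complex_of_real (exp (- a * s\<^sup>2)) * exp (\<i> * of_real (z * s)))
      = of_real (sqrt (pi / a) * exp (- z\<^sup>2 / (4 * a)))"
proof -
  define c where "c = sqrt (2 * a)"
  have c: "c > 0" "c\<^sup>2 = 2 * a" using assms by (auto simp: c_def)
  define F where "F x = complex_of_real (exp (- x\<^sup>2 / 2)) * exp (\<i> * of_real (z / c * x))" for x
  have cx: "(c * x)\<^sup>2 / 2 = a * x\<^sup>2" for x by (simp add: power_mult_distrib c)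
  have F_c: "F (0 + c * x) = complex_of_real (exp (- a * x\<^sup>2)) * exp (\<i> * of_real (z * x))" for x
    using c(1) by (simp add: F_def cx)
  have "integrable lborel (\<lambda>x. complex_of_real (exp (- x\<^sup>2 / 2)))"
  proof -
    have "integrable lborel (\<lambda>x. sqrt (2 * pi) * std_normal_density x)"
      by (intro integrable_mult_right integrable_normal_density) simp
    then have "integrable lborel (\<lambda>x::real. exp (- x\<^sup>2 / 2))"
      by (simp add: std_normal_density_def)
    then show ?thesis by (rule integrable_of_real)
  qed
  moreover have "F \<in> borel_measurable lborel"
    unfolding F_def[abs_def] by measurable
  ultimately have intF: "integrable lborel F"
    by (rule Bochner_Integration.integrable_bound) (simp add: F_def norm_mult)
  show "integrable lborel (\<lambda>s. complex_of_real (exp (- a * s\<^sup>2)) * exp (\<i> * of_real (z * s)))"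
    using lborel_integrable_real_affine[OF intF, of c 0] c(1) unfolding F_c by simp
  have "complex_of_real (exp (- ((z / c)\<^sup>2) / 2)) = (LINT x|std_normal_distribution. exp (\<i> * of_real (z / c * x)))"
    using char_std_normal_distribution unfolding char_def by metis
  also have "\<dots> = (LINT x|lborel. std_normal_density x *\<^sub>R exp (\<i> * of_real (z / c * x)))"
    by (rule integral_density) (auto simp: normal_density_nonneg)
  also have "\<dots> = (LINT x|lborel. of_real (1 / sqrt (2 * pi)) * F x)"
    by (simp add: F_def std_normal_density_def scaleR_conv_of_real mult.assoc)
  also have "\<dots> = of_real (1 / sqrt (2 * pi)) * (LINT x|lborel. F x)"
    by (rule integral_mult_right_zero)
  also have "(LINT x|lborel. F x) = c *\<^sub>R (LINT s|lborel. complex_of_real (exp (- a * s\<^sup>2)) * exp (\<i> * of_real (z * s)))"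
    using lborel_integral_real_affine[of c F 0] c(1) unfolding F_c by simp
  finally have "complex_of_real (exp (- ((z / c)\<^sup>2) / 2)) = of_real (c / sqrt (2 * pi)) *
      (LINT s|lborel. complex_of_real (exp (- a * s\<^sup>2)) * exp (\<i> * of_real (z * s)))" (is "_ = _ * ?I")
    by (simp add: scaleR_conv_of_real)
  then have "?I = of_real (sqrt (2 * pi) / c) * complex_of_real (exp (- ((z / c)\<^sup>2) / 2))"
    using c(1) by (simp add: field_simps)
  also have "sqrt (2 * pi) / c = sqrt (pi / a)"
    unfolding c_def by (simp add: real_sqrt_mult real_sqrt_divide)
  also have "- ((z / c)\<^sup>2) / 2 = - z\<^sup>2 / (4 * a)"
    by (simp add: power_divide c)
  finally show "?I = of_real (sqrt (pi / a) * exp (- z\<^sup>2 / (4 * a)))" by simp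
qed

text \<open>Lebesgue measure is the image of the product measure over \<open>Basis\<close>, and in
  coordinates the integrand is a product of one-dimensional Gaussian characters.\<close>

lemma gaussian_char:
  fixes z :: "'a::euclidean_space"
  assumes "a > 0"
  shows "integrable lborel (\<lambda>x. complex_of_real (exp (- a * (norm x)\<^sup>2)) * exp (\<i> * of_real (z \<bullet> x)))"
    and "(LINT x|lborel. complex_of_real (exp (- a * (norm x)\<^sup>2)) * exp (\<i> * of_real (z \<bullet> x)))
      = of_real ((pi / a) powr (real DIM('a) / 2) * exp (- (norm z)\<^sup>2 / (4 * a)))"
proof -
  interpret product_sigma_finite "\<lambda>b::'a. lborel :: real measure"
    by standard
  define f where "f b s = complex_of_real (exp (- a * s\<^sup>2)) * exp (\<i> * of_real ((z \<bullet> b) * s))" for b s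
  let ?T = "\<lambda>g. \<Sum>b\<in>Basis. g b *\<^sub>R b :: 'a"
  let ?F = "\<lambda>x. complex_of_real (exp (- a * (norm x)\<^sup>2)) * exp (\<i> * of_real (z \<bullet> x))"
  have T: "?T \<in> measurable (\<Pi>\<^sub>M b\<in>Basis. lborel) borel" by measurable
  have F: "?F \<in> borel_measurable borel" by measurable
  have eq: "?F (?T g) = (\<Prod>b\<in>Basis. f b (g b))" for g
  proof -
    have "(norm (?T g))\<^sup>2 = (\<Sum>b\<in>Basis. (g b)\<^sup>2)"
      unfolding power2_norm_eq_inner
      by (subst euclidean_inner) (simp add: inner_sum_left_Basis power2_eq_square)
    moreover have "z \<bullet> ?T g = (\<Sum>b\<in>Basis. (z \<bullet> b) * g b)"
      by (simp add: inner_sum_right mult.commute)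
    ultimately show ?thesis
      by (simp add: f_def prod.distrib exp_sum[symmetric] sum_distrib_left sum_negf of_real_prod[symmetric]
          flip: of_real_exp)
  qed
  have int: "integrable (\<Pi>\<^sub>M b\<in>Basis. lborel) (\<lambda>g. \<Prod>b\<in>Basis. f b (g b))"
    unfolding f_def by (intro product_integrable_prod gaussian_char_real assms) simp
  show "integrable lborel ?F"
    unfolding lborel_eq[where 'a='a] using int
    by (subst integrable_distr_eq[OF T F]) (simp only: eq)
  have "(LINT x|lborel. ?F x) = (LINT g|(\<Pi>\<^sub>M b\<in>Basis. lborel). (\<Prod>b\<in>Basis. f b (g b)))"
    by (subst lborel_eq, subst integral_distr[OF T F]) (simp only: eq)
  also have "\<dots> = (\<Prod>b\<in>Basis. (LINT s|lborel. f b s))"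
    by (rule product_integral_prod) (simp_all add: f_def gaussian_char_real(1)[OF assms, simplified])
  also have "\<dots> = (\<Prod>b\<in>(Basis::'a set). of_real (sqrt (pi / a) * exp (- (z \<bullet> b)\<^sup>2 / (4 * a))))"
    unfolding f_def by (simp only: gaussian_char_real(2)[OF assms])
  also have "\<dots> = of_real (sqrt (pi / a) ^ DIM('a) * exp (\<Sum>b\<in>(Basis::'a set). - (z \<bullet> b)\<^sup>2 / (4 * a)))"
    by (simp add: exp_sum prod.distrib)
  also have "(\<Sum>b\<in>(Basis::'a set). - (z \<bullet> b)\<^sup>2 / (4 * a)) = - (norm z)\<^sup>2 / (4 * a)"
    unfolding power2_norm_eq_inner
    by (subst euclidean_inner) (simp add: power2_eq_square sum_negf sum_divide_distrib)
  also have "sqrt (pi / a) ^ DIM('a) = (pi / a) powr (real DIM('a) / 2)"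
    using assms by (simp add: powr_half_sqrt[symmetric] powr_powr flip: powr_realpow)
  finally show "(LINT x|lborel. ?F x) = of_real ((pi / a) powr (real DIM('a) / 2) * exp (- (norm z)\<^sup>2 / (4 * a)))" .
qed

lemma gaussian_integral:
  assumes "a > 0"
  shows "integrable lborel (\<lambda>x::'a::euclidean_space. exp (- a * (norm x)\<^sup>2))"
    and "(LINT x|lborel. exp (- a * (norm (x::'a))\<^sup>2)) = (pi / a) powr (real DIM('a) / 2)"
proof -
  have 1: "integrable lborel (\<lambda>x::'a. complex_of_real (exp (- a * (norm x)\<^sup>2)))"
    using gaussian_char(1)[OF assms, of "0::'a"] by simp
  then show "integrable lborel (\<lambda>x::'a. exp (- a * (norm x)\<^sup>2))"
    by (simp only: complex_of_real_integrable_eq)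
  have "complex_of_real (LINT x|lborel. exp (- a * (norm (x::'a))\<^sup>2)) = of_real ((pi / a) powr (real DIM('a) / 2))"
    using gaussian_char(2)[OF assms, of "0::'a"] by (simp flip: integral_complex_of_real)
  then show "(LINT x|lborel. exp (- a * (norm (x::'a))\<^sup>2)) = (pi / a) powr (real DIM('a) / 2)"
    by (simp only: of_real_eq_iff)
qed

text \<open>The Fourier transform of exp(- a |\<xi>|^2), deliberately not normalised: its total mass
  is \<open>(4 * pi\<^sup>2) powr (d / 2)\<close>, that is (2 pi)^d, independently of a. It
  concentrates at 0 as a tends to 0.\<close>

definition gauss_kernel :: "real \<Rightarrow> 'a::euclidean_space \<Rightarrow> real" where
  "gauss_kernel a z = (pi / a) powr (real DIM('a) / 2) * exp (- (norm z)\<^sup>2 / (4 * a))"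

lemma gauss_kernel_nonneg [simp]: "0 \<le> gauss_kernel a z"
  by (simp add: gauss_kernel_def)

lemma gauss_kernel_measurable [measurable]: "gauss_kernel a \<in> borel_measurable borel"
  unfolding gauss_kernel_def[abs_def] by measurable

lemma gauss_kernel_commute: "gauss_kernel a (x - y) = gauss_kernel a (y - x)"
  by (simp add: gauss_kernel_def norm_minus_commute)

lemma gauss_kernel_integral:
  assumes "a > 0"
  shows "integrable lborel (gauss_kernel a :: 'a::euclidean_space \<Rightarrow> real)"
    and "(LINT z|lborel. gauss_kernel a (z::'a)) = (4 * pi\<^sup>2) powr (real DIM('a) / 2)"
proof -
  have pos: "1 / (4 * a) > 0" using assms by simp
  have eq: "gauss_kernel a z = (pi / a) powr (real DIM('a) / 2) * exp (- (1 / (4 * a)) * (norm z)\<^sup>2)" for z :: 'a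
    by (simp add: gauss_kernel_def)
  show "integrable lborel (gauss_kernel a :: 'a \<Rightarrow> real)"
    unfolding eq[abs_def] by (intro integrable_mult_right gaussian_integral pos)
  have "(LINT z|lborel. gauss_kernel a (z::'a)) = (pi / a) powr (real DIM('a) / 2) * (pi / (1 / (4 * a))) powr (real DIM('a) / 2)"
    unfolding eq using gaussian_integral(2)[OF pos, where 'a='a] by simp
  also have "\<dots> = (pi / a * (pi / (1 / (4 * a)))) powr (real DIM('a) / 2)"
    using assms by (intro powr_mult[symmetric])
  also have "pi / a * (pi / (1 / (4 * a))) = 4 * pi\<^sup>2"
    using assms by (simp add: power2_eq_square)
  finally show "(LINT z|lborel. gauss_kernel a (z::'a)) = (4 * pi\<^sup>2) powr (real DIM('a) / 2)" .
qed

text \<open>From \<open>y \<le> exp y\<close> with \<open>y = |z|\<^sup>2 / (8 a)\<close>, which costs a factor in the constant but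
  avoids computing second moments.\<close>

lemma gauss_kernel_second_moment:
  assumes "a > 0"
  shows "integrable lborel (\<lambda>z::'a::euclidean_space. gauss_kernel a z * (norm z)\<^sup>2)"
    and "(LINT z|lborel. gauss_kernel a (z::'a) * (norm z)\<^sup>2) \<le> 8 * a * (8 * pi\<^sup>2) powr (real DIM('a) / 2)"
proof -
  \<comment> \<open>Half of the decay rate 1 / (4 a) of the kernel: one half absorbs |z|^2, the
    other keeps the integral finite. The mass constant 4 pi^2 thereby becomes 8 pi^2.\<close>
  define b where "b = 1 / (8 * a)"
  have b: "b > 0" using assms by (simp add: b_def)
  let ?c = "(pi / a) powr (real DIM('a) / 2) * (8 * a)"
  have le: "gauss_kernel a z * (norm z)\<^sup>2 \<le> ?c * exp (- b * (norm z)\<^sup>2)" for z :: 'a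
  proof -
    have "b * (norm z)\<^sup>2 \<le> exp (b * (norm z)\<^sup>2)"
      using exp_ge_add_one_self[of "b * (norm z)\<^sup>2"] by linarith
    then have "(norm z)\<^sup>2 \<le> 8 * a * exp (b * (norm z)\<^sup>2)"
      using assms by (simp add: b_def field_simps)
    then have "gauss_kernel a z * (norm z)\<^sup>2 \<le> gauss_kernel a z * (8 * a * exp (b * (norm z)\<^sup>2))"
      by (rule mult_left_mono) simp
    also have "\<dots> = ?c * (exp (- (norm z)\<^sup>2 / (4 * a)) * exp (b * (norm z)\<^sup>2))"
      by (simp add: gauss_kernel_def)
    also have "exp (- (norm z)\<^sup>2 / (4 * a)) * exp (b * (norm z)\<^sup>2) = exp (- b * (norm z)\<^sup>2)"
      using assms unfolding exp_add[symmetric] b_def by (simp add: field_simps)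
    finally show ?thesis .
  qed
  have int: "integrable lborel (\<lambda>z::'a. ?c * exp (- b * (norm z)\<^sup>2))"
    by (intro integrable_mult_right gaussian_integral b)
  show int2: "integrable lborel (\<lambda>z::'a. gauss_kernel a z * (norm z)\<^sup>2)"
  proof (rule Bochner_Integration.integrable_bound[OF int])
    show "AE z in lborel. norm (gauss_kernel a (z::'a) * (norm z)\<^sup>2) \<le> norm (?c * exp (- b * (norm z)\<^sup>2))"
      using le assms by (intro AE_I2) (simp add: abs_mult)
  qed measurable
  have "(LINT z|lborel. gauss_kernel a (z::'a) * (norm z)\<^sup>2) \<le> (LINT z|lborel. ?c * exp (- b * (norm (z::'a))\<^sup>2))"
    by (intro integral_mono int int2 le)
  also have "\<dots> = ?c * (pi / b) powr (real DIM('a) / 2)"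
    using gaussian_integral(2)[OF b, where 'a='a] by simp
  also have "\<dots> = 8 * a * (pi / a * (pi / b)) powr (real DIM('a) / 2)"
    unfolding powr_mult by simp
  also have "pi / a * (pi / b) = 8 * pi\<^sup>2"
    using assms by (simp add: b_def power2_eq_square)
  finally show "(LINT z|lborel. gauss_kernel a (z::'a) * (norm z)\<^sup>2) \<le> 8 * a * (8 * pi\<^sup>2) powr (real DIM('a) / 2)" .
qed

subsection \<open>Gaussian averages of the Fourier transform\<close>

context bounded_open
begin

lemma snd_dom_measurable [measurable]: "snd \<in> borel_measurable (N \<Otimes>\<^sub>M lebesgue_on \<Omega>)"
  by (rule measurable_compose[OF measurable_snd continuous_borel_measurable_dom[OF continuous_on_id]])

lemma fst_dom_measurable [measurable]: "fst \<in> borel_measurable (lebesgue_on \<Omega> \<Otimes>\<^sub>M N)"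
  by (rule measurable_compose[OF measurable_fst continuous_borel_measurable_dom[OF continuous_on_id]])

lemma plane_wave_L2: "plane_wave \<xi> \<in> L2 \<Omega>"
  by (rule bounded_L2[of _ 1]) (use Ck_plane_wave[of 0 \<xi>] in \<open>auto intro: continuous_borel_measurable_dom\<close>)

lemma L2_norm_plane_wave: "L2_norm \<Omega> (plane_wave \<xi>) = sqrt (measure lebesgue \<Omega>)"
  using measure_dom by (simp add: L2_norm_def)

lemma fourier_bound:
  assumes "f \<in> L2 \<Omega>"
  shows "norm (L2_inner \<Omega> f (plane_wave \<xi>)) \<le> L2_norm \<Omega> f * sqrt (measure lebesgue \<Omega>)"
  using L2_inner_Cauchy_Schwarz[OF assms plane_wave_L2] by (simp add: L2_norm_plane_wave)

lemma fourier_measurable [measurable]: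
  assumes "f \<in> L2 \<Omega>"
  shows "(\<lambda>\<xi>. L2_inner \<Omega> f (plane_wave \<xi>)) \<in> borel_measurable borel"
proof -
  note [measurable] = L2_borel_measurable[OF assms]
  have "(\<lambda>p. f (snd p) * cnj (exp (\<i> * of_real (fst p \<bullet> snd p)))) \<in> borel_measurable (borel \<Otimes>\<^sub>M lebesgue_on \<Omega>)"
    by measurable
  then show ?thesis
    unfolding L2_inner_def plane_wave_def
    by (intro dom.borel_measurable_lebesgue_integral) (simp add: case_prod_beta)
qed

text \<open>The inner product with \<open>plane_wave \<xi>\<close> is the unnormalised Fourier
  transform of \<open>f\<close> extended by zero. It is bounded because \<Omega> has finite measure,
  so the Gaussian weight alone makes the integral converge, and square integrability of the
  transform never enters.\<close>

definition fourier_energy :: "real \<Rightarrow> (real ^ 'n \<Rightarrow> complex) \<Rightarrow> real" where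
  "fourier_energy a f = (LINT \<xi>|lborel. exp (- a * (norm \<xi>)\<^sup>2) * (norm (L2_inner \<Omega> f (plane_wave \<xi>)))\<^sup>2)"

lemma fourier_energy_integrable:
  assumes f: "f \<in> L2 \<Omega>" and "a > 0"
  shows "integrable lborel (\<lambda>\<xi>. exp (- a * (norm \<xi>)\<^sup>2) * (norm (L2_inner \<Omega> f (plane_wave \<xi>)))\<^sup>2)"
proof (rule Bochner_Integration.integrable_bound)
  let ?C = "(L2_norm \<Omega> f * sqrt (measure lebesgue \<Omega>))\<^sup>2"
  show "integrable lborel (\<lambda>\<xi>::real^'n. ?C * exp (- a * (norm \<xi>)\<^sup>2))"
    by (intro integrable_mult_right gaussian_integral assms)
  have "(norm (L2_inner \<Omega> f (plane_wave \<xi>)))\<^sup>2 \<le> ?C" for \<xi>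
    by (intro power_mono fourier_bound f) simp
  then show "AE \<xi> in lborel. norm (exp (- a * (norm \<xi>)\<^sup>2) * (norm (L2_inner \<Omega> f (plane_wave \<xi>)))\<^sup>2)
      \<le> norm (?C * exp (- a * (norm \<xi>)\<^sup>2))"
    by (intro AE_I2) (simp add: abs_mult mult.commute)
  note [measurable] = fourier_measurable[OF f]
  show "(\<lambda>\<xi>. exp (- a * (norm \<xi>)\<^sup>2) * (norm (L2_inner \<Omega> f (plane_wave \<xi>)))\<^sup>2) \<in> borel_measurable lborel"
    by measurable
qed

lemma fourier_energy_nonneg: "0 \<le> fourier_energy a f"
  unfolding fourier_energy_def by (intro Bochner_Integration.integral_nonneg) simp

text \<open>The squared modulus of the transform is a double integral over \<Omega> \<times>
  \<Omega>. Performing the \<xi>-integration first leaves the Fourier transform of the Gaussian at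
  the difference of the two points, which is \<open>gauss_kernel\<close>.\<close>

lemma fourier_energy_eq:
  assumes a: "a > 0" and f: "f \<in> L2 \<Omega>"
  defines "F \<equiv> (\<lambda>p. f (fst p) * cnj (f (snd p)) * of_real (gauss_kernel a (fst p - snd p)))"
  shows "integrable (lebesgue_on \<Omega> \<Otimes>\<^sub>M lebesgue_on \<Omega>) F"
    and "of_real (fourier_energy a f) = (LINT p|(lebesgue_on \<Omega> \<Otimes>\<^sub>M lebesgue_on \<Omega>). F p)"
proof -
  let ?M = "lebesgue_on \<Omega>"
  interpret N: pair_sigma_finite ?M ?M ..
  interpret P: pair_sigma_finite lborel "?M \<Otimes>\<^sub>M ?M"
    by (intro pair_sigma_finite.intro lborel.sigma_finite_measure_axioms N.sigma_finite_measure_axioms)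
  note [measurable] = L2_borel_measurable[OF f]
  define h where "h \<xi> p = complex_of_real (exp (- a * (norm \<xi>)\<^sup>2)) *
      ((f (fst p) * cnj (plane_wave \<xi> (fst p))) * cnj (f (snd p) * cnj (plane_wave \<xi> (snd p))))" for \<xi> p
  have intf: "integrable ?M f" "integrable ?M (\<lambda>x. cnj (f x))"
    using L2_integrable1[OF f] L2_integrable1[OF L2_cnj[OF f]] .
  have hat: "of_real ((norm (L2_inner \<Omega> f (plane_wave \<xi>)))\<^sup>2)
      = (LINT p|(?M \<Otimes>\<^sub>M ?M). (f (fst p) * cnj (plane_wave \<xi> (fst p))) * cnj (f (snd p) * cnj (plane_wave \<xi> (snd p))))" for \<xi>
  proof -
    have int: "integrable ?M (\<lambda>x. f x * cnj (plane_wave \<xi> x))"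
      by (intro L2_mult_integrable f L2_cnj plane_wave_L2)
    then have int2: "integrable ?M (\<lambda>x. cnj (f x * cnj (plane_wave \<xi> x)))"
      by (simp only: complex_integrable_cnj)
    have "of_real ((norm (L2_inner \<Omega> f (plane_wave \<xi>)))\<^sup>2)
        = (LINT x|?M. f x * cnj (plane_wave \<xi> x)) * (LINT x|?M. cnj (f x * cnj (plane_wave \<xi> x)))"
      unfolding complex_norm_square by (simp only: L2_inner_def Bochner_Integration.integral_cnj)
    also have "\<dots> = (LINT p|(?M \<Otimes>\<^sub>M ?M). (f (fst p) * cnj (plane_wave \<xi> (fst p))) * cnj (f (snd p) * cnj (plane_wave \<xi> (snd p))))"
      by (rule N.integrable_mult_pair(2)[OF int int2, symmetric])
    finally show ?thesis .
  qed
  have g: "integrable lborel (\<lambda>\<xi>::real^'n. complex_of_real (exp (- a * (norm \<xi>)\<^sup>2)))"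
    by (intro integrable_of_real gaussian_integral a)
  have h_meas: "case_prod h \<in> borel_measurable (lborel \<Otimes>\<^sub>M (?M \<Otimes>\<^sub>M ?M))"
  proof -
    have m1: "(\<lambda>q. fst (snd q)) \<in> borel_measurable (lborel \<Otimes>\<^sub>M (?M \<Otimes>\<^sub>M ?M))"
      by (rule measurable_compose[OF measurable_snd fst_dom_measurable])
    have m2: "(\<lambda>q. snd (snd q)) \<in> borel_measurable (lborel \<Otimes>\<^sub>M (?M \<Otimes>\<^sub>M ?M))"
      by (rule measurable_compose[OF measurable_snd snd_dom_measurable])
    note [measurable] = m1 m2
    show ?thesis
      unfolding h_def plane_wave_def case_prod_beta by measurable
  qed
  \<comment> \<open>Plane waves have modulus 1, so the integrand is dominated by a product of
    functions of the three separate variables, each integrable.\<close>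
  have h_int: "integrable (lborel \<Otimes>\<^sub>M (?M \<Otimes>\<^sub>M ?M)) (case_prod h)"
  proof (rule Bochner_Integration.integrable_bound[OF P.integrable_mult_pair(1)[OF g N.integrable_mult_pair(1)[OF intf]] h_meas])
    show "AE q in lborel \<Otimes>\<^sub>M (?M \<Otimes>\<^sub>M ?M). norm (case_prod h q)
      \<le> norm (complex_of_real (exp (- a * (norm (fst q))\<^sup>2)) * (f (fst (snd q)) * cnj (f (snd (snd q)))))"
      by (intro AE_I2) (simp add: h_def case_prod_beta norm_mult)
  qed
  have F_eq: "(LINT \<xi>|lborel. h \<xi> p) = F p" for p
  proof -
    have "(LINT \<xi>|lborel. h \<xi> p) = (LINT \<xi>|lborel. (f (fst p) * cnj (f (snd p))) *
        (complex_of_real (exp (- a * (norm \<xi>)\<^sup>2)) * exp (\<i> * of_real ((snd p - fst p) \<bullet> \<xi>))))"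
    proof (rule Bochner_Integration.integral_cong[OF refl])
      fix \<xi>
      have "cnj (plane_wave \<xi> (fst p)) * plane_wave \<xi> (snd p) = exp (\<i> * of_real ((snd p - fst p) \<bullet> \<xi>))"
        by (simp add: plane_wave_def exp_cnj inner_diff_left inner_commute algebra_simps flip: exp_add)
      then show "h \<xi> p = (f (fst p) * cnj (f (snd p))) *
        (complex_of_real (exp (- a * (norm \<xi>)\<^sup>2)) * exp (\<i> * of_real ((snd p - fst p) \<bullet> \<xi>)))"
        by (simp add: h_def mult_ac)
    qed
    also have "\<dots> = (f (fst p) * cnj (f (snd p))) * of_real (gauss_kernel a (snd p - fst p))"
      by (subst integral_mult_right_zero, subst gaussian_char(2)[OF a]) (simp add: gauss_kernel_def)
    also have "gauss_kernel a (snd p - fst p) = gauss_kernel a (fst p - snd p)"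
      by (rule gauss_kernel_commute)
    finally show ?thesis by (simp add: F_def)
  qed
  show "integrable (?M \<Otimes>\<^sub>M ?M) F"
    using P.integrable_snd[of h, OF h_int] by (simp add: F_eq)
  have "of_real (fourier_energy a f) = (LINT \<xi>|lborel. complex_of_real (exp (- a * (norm \<xi>)\<^sup>2)) *
      of_real ((norm (L2_inner \<Omega> f (plane_wave \<xi>)))\<^sup>2))"
    unfolding fourier_energy_def by (subst integral_complex_of_real[symmetric]) simp
  also have "\<dots> = (LINT \<xi>|lborel. (LINT p|(?M \<Otimes>\<^sub>M ?M). h \<xi> p))"
    unfolding hat h_def by (simp only: integral_mult_right_zero)
  also have "\<dots> = (LINT p|(?M \<Otimes>\<^sub>M ?M). (LINT \<xi>|lborel. h \<xi> p))"
    by (rule P.Fubini_integral[symmetric, OF h_int])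
  finally show "of_real (fourier_energy a f) = (LINT p|(?M \<Otimes>\<^sub>M ?M). F p)"
    by (simp only: F_eq)
qed

lemma nn_integral_dom_le_lborel:
  assumes [measurable]: "g \<in> borel_measurable borel"
  shows "(\<integral>\<^sup>+x. g x \<partial>lebesgue_on \<Omega>) \<le> (\<integral>\<^sup>+x. g x \<partial>lborel)"
proof -
  have "(\<integral>\<^sup>+x. g x \<partial>lebesgue_on \<Omega>) = (\<integral>\<^sup>+x. g x * indicator \<Omega> x \<partial>lebesgue)"
    by (rule nn_integral_restrict_space) simp
  also have "\<dots> \<le> (\<integral>\<^sup>+x. g x \<partial>lebesgue)"
    by (intro nn_integral_mono) (simp add: indicator_def)
  also have "\<dots> = (\<integral>\<^sup>+x. g x \<partial>lborel)"
    by (rule nn_integral_completion)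
  finally show ?thesis .
qed

lemma nn_integral_lborel_translate:
  fixes g :: "real ^ 'n \<Rightarrow> ennreal"
  assumes "g \<in> borel_measurable borel"
  shows "(\<integral>\<^sup>+x. g (x + c) \<partial>lborel) = (\<integral>\<^sup>+x. g x \<partial>lborel)"
proof -
  have "(\<integral>\<^sup>+x. g x \<partial>lborel) = (\<integral>\<^sup>+x. g x \<partial>distr lborel borel ((+) c))"
    by (simp add: lborel_distr_plus)
  also have "\<dots> = (\<integral>\<^sup>+x. g (c + x) \<partial>lborel)"
    using assms by (subst nn_integral_distr) auto
  finally show ?thesis by (simp add: add.commute)
qed

lemma nn_integral_gauss_kernel_dom:
  assumes a: "a > 0"
  shows "(\<integral>\<^sup>+y. ennreal (gauss_kernel a (y - x)) \<partial>lebesgue_on \<Omega>) \<le> ennreal ((4 * pi\<^sup>2) powr (real CARD('n) / 2))"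
proof -
  have "(\<integral>\<^sup>+y. ennreal (gauss_kernel a (y - x)) \<partial>lebesgue_on \<Omega>) \<le> (\<integral>\<^sup>+y. ennreal (gauss_kernel a (y - x)) \<partial>lborel)"
    by (rule nn_integral_dom_le_lborel) measurable
  also have "\<dots> = (\<integral>\<^sup>+y. ennreal (gauss_kernel a (y::real^'n)) \<partial>lborel)"
    using nn_integral_lborel_translate[of "\<lambda>y. ennreal (gauss_kernel a y)" "- x"] by simp
  also have "\<dots> = ennreal ((4 * pi\<^sup>2) powr (real CARD('n) / 2))"
    using gauss_kernel_integral[OF a, where 'a="real^'n"] by (simp add: nn_integral_eq_integral)
  finally show ?thesis .
qed

text \<open>A Schur test: 2 |f(x)| |f(y)| \<le> |f(x)|^2 + |f(y)|^2, and in either variable the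
  kernel has mass at most (2 pi)^d over \<Omega>. This is the upper half of Plancherel, uniformly in
  a.\<close>

lemma fourier_energy_le:
  assumes a: "a > 0" and f: "f \<in> L2 \<Omega>"
  shows "fourier_energy a f \<le> ((4 * pi\<^sup>2) powr (real CARD('n) / 2)) * (L2_norm \<Omega> f)\<^sup>2"
proof -
  let ?M = "lebesgue_on \<Omega>"
  let ?K = "\<lambda>p. gauss_kernel a (fst p - snd p)"
  interpret N: pair_sigma_finite ?M ?M ..
  note [measurable] = L2_borel_measurable[OF f]
  have sq: "(\<integral>\<^sup>+x. ennreal ((norm (f x))\<^sup>2) \<partial>?M) = ennreal ((L2_norm \<Omega> f)\<^sup>2)"
    unfolding L2_norm_power2 by (rule nn_integral_eq_integral[OF L2_integrable[OF f]]) simp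
  have 1: "(\<integral>\<^sup>+p. ennreal ((norm (f (fst p)))\<^sup>2 * ?K p) \<partial>(?M \<Otimes>\<^sub>M ?M)) \<le> ennreal (((4 * pi\<^sup>2) powr (real CARD('n) / 2)) * (L2_norm \<Omega> f)\<^sup>2)"
  proof -
    have "(\<integral>\<^sup>+p. ennreal ((norm (f (fst p)))\<^sup>2 * ?K p) \<partial>(?M \<Otimes>\<^sub>M ?M))
        = (\<integral>\<^sup>+x. (\<integral>\<^sup>+y. ennreal ((norm (f x))\<^sup>2 * gauss_kernel a (x - y)) \<partial>?M) \<partial>?M)"
      by (subst dom.nn_integral_fst[symmetric]) simp_all
    also have "\<dots> = (\<integral>\<^sup>+x. ennreal ((norm (f x))\<^sup>2) * (\<integral>\<^sup>+y. ennreal (gauss_kernel a (y - x)) \<partial>?M) \<partial>?M)"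
    proof (rule nn_integral_cong)
      fix x
      have [measurable]: "(\<lambda>y. y) \<in> borel_measurable ?M"
        by (rule continuous_borel_measurable_dom) (rule continuous_on_id)
      have "(\<integral>\<^sup>+y. ennreal ((norm (f x))\<^sup>2 * gauss_kernel a (x - y)) \<partial>?M)
          = (\<integral>\<^sup>+y. ennreal ((norm (f x))\<^sup>2) * ennreal (gauss_kernel a (y - x)) \<partial>?M)"
        by (intro nn_integral_cong) (simp add: ennreal_mult gauss_kernel_commute)
      also have "\<dots> = ennreal ((norm (f x))\<^sup>2) * (\<integral>\<^sup>+y. ennreal (gauss_kernel a (y - x)) \<partial>?M)"
        by (rule nn_integral_cmult) measurable
      finally show "(\<integral>\<^sup>+y. ennreal ((norm (f x))\<^sup>2 * gauss_kernel a (x - y)) \<partial>?M)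
          = ennreal ((norm (f x))\<^sup>2) * (\<integral>\<^sup>+y. ennreal (gauss_kernel a (y - x)) \<partial>?M)" .
    qed
    also have "\<dots> \<le> (\<integral>\<^sup>+x. ennreal ((norm (f x))\<^sup>2) * ennreal ((4 * pi\<^sup>2) powr (real CARD('n) / 2)) \<partial>?M)"
      by (intro nn_integral_mono mult_left_mono nn_integral_gauss_kernel_dom a) simp
    also have "\<dots> = ennreal (((4 * pi\<^sup>2) powr (real CARD('n) / 2)) * (L2_norm \<Omega> f)\<^sup>2)"
      by (subst nn_integral_multc) (simp_all add: sq ennreal_mult mult.commute)
    finally show ?thesis .
  qed
  have 2: "(\<integral>\<^sup>+p. ennreal ((norm (f (snd p)))\<^sup>2 * ?K p) \<partial>(?M \<Otimes>\<^sub>M ?M))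
      = (\<integral>\<^sup>+p. ennreal ((norm (f (fst p)))\<^sup>2 * ?K p) \<partial>(?M \<Otimes>\<^sub>M ?M))"
  proof -
    have "(\<integral>\<^sup>+p. ennreal ((norm (f (snd p)))\<^sup>2 * ?K p) \<partial>(?M \<Otimes>\<^sub>M ?M))
        = (\<integral>\<^sup>+y. (\<integral>\<^sup>+x. ennreal ((norm (f y))\<^sup>2 * gauss_kernel a (x - y)) \<partial>?M) \<partial>?M)"
      using N.nn_integral_snd[of "\<lambda>p. ennreal ((norm (f (snd p)))\<^sup>2 * ?K p)"] by simp
    also have "\<dots> = (\<integral>\<^sup>+y. (\<integral>\<^sup>+x. ennreal ((norm (f y))\<^sup>2 * gauss_kernel a (y - x)) \<partial>?M) \<partial>?M)"
      by (intro nn_integral_cong) (simp add: gauss_kernel_commute)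
    also have "\<dots> = (\<integral>\<^sup>+p. ennreal ((norm (f (fst p)))\<^sup>2 * ?K p) \<partial>(?M \<Otimes>\<^sub>M ?M))"
      by (subst dom.nn_integral_fst[symmetric]) simp_all
    finally show ?thesis .
  qed
  let ?F = "\<lambda>p. f (fst p) * cnj (f (snd p)) * of_real (?K p)"
  have "ennreal (2 * fourier_energy a f) = ennreal (2 * norm (complex_of_real (fourier_energy a f)))"
    using fourier_energy_nonneg[of a f] by simp
  also have "\<dots> \<le> ennreal (2 * (LINT p|(?M \<Otimes>\<^sub>M ?M). norm (?F p)))"
    unfolding fourier_energy_eq(2)[OF a f] by (intro ennreal_leI mult_left_mono integral_norm_bound) simp
  also have "\<dots> = (\<integral>\<^sup>+p. ennreal (2 * norm (?F p)) \<partial>(?M \<Otimes>\<^sub>M ?M))"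
    using fourier_energy_eq(1)[OF a f]
    by (subst nn_integral_eq_integral) (simp_all add: integrable_norm)
  also have "\<dots> \<le> (\<integral>\<^sup>+p. ennreal ((norm (f (fst p)))\<^sup>2 * ?K p) + ennreal ((norm (f (snd p)))\<^sup>2 * ?K p) \<partial>(?M \<Otimes>\<^sub>M ?M))"
  proof (rule nn_integral_mono)
    fix p
    have "2 * norm (?F p) = (2 * norm (f (fst p)) * norm (f (snd p))) * ?K p"
      by (simp add: norm_mult)
    also have "\<dots> \<le> ((norm (f (fst p)))\<^sup>2 + (norm (f (snd p)))\<^sup>2) * ?K p"
      by (intro mult_right_mono sum_squares_bound) simp
    finally show "ennreal (2 * norm (?F p)) \<le> ennreal ((norm (f (fst p)))\<^sup>2 * ?K p) + ennreal ((norm (f (snd p)))\<^sup>2 * ?K p)"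
      by (simp add: distrib_right ennreal_leI flip: ennreal_plus)
  qed
  also have "\<dots> = (\<integral>\<^sup>+p. ennreal ((norm (f (fst p)))\<^sup>2 * ?K p) \<partial>(?M \<Otimes>\<^sub>M ?M)) + (\<integral>\<^sup>+p. ennreal ((norm (f (snd p)))\<^sup>2 * ?K p) \<partial>(?M \<Otimes>\<^sub>M ?M))"
    by (rule nn_integral_add) measurable
  also have "\<dots> \<le> ennreal (((4 * pi\<^sup>2) powr (real CARD('n) / 2)) * (L2_norm \<Omega> f)\<^sup>2) + ennreal (((4 * pi\<^sup>2) powr (real CARD('n) / 2)) * (L2_norm \<Omega> f)\<^sup>2)"
    unfolding 2 by (intro add_mono 1)
  also have "\<dots> = ennreal (2 * (((4 * pi\<^sup>2) powr (real CARD('n) / 2)) * (L2_norm \<Omega> f)\<^sup>2))"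
    by (simp flip: ennreal_plus)
  finally show ?thesis
    by (subst (asm) ennreal_le_iff) simp_all
qed

end

section \<open>Translation estimates for test functions\<close>

lemma grad_measurable:
  assumes "\<psi> \<in> test_functions \<Omega>"
  shows "(\<lambda>x. norm (grad \<psi> x)) \<in> borel_measurable borel"
proof -
  have "continuous_on UNIV (\<lambda>x. norm (grad \<psi> x))"
    unfolding grad_def
    by (intro continuous_intros continuous_on_vec_lambda test_functions_continuous[OF test_functions_partial[OF assms]])
  then show ?thesis by (rule borel_measurable_continuous_onI)
qed

text \<open>The fundamental theorem of calculus on the segment from x to x + z, followed by the
  Cauchy-Schwarz inequality in the parameter s. The nonnegative integral on the right is ready for
  Tonelli.\<close>

lemma test_function_increment_bound:
  assumes \<psi>: "\<psi> \<in> test_functions \<Omega>"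
  shows "ennreal ((norm (\<psi> (x + z) - \<psi> x))\<^sup>2)
    \<le> (\<integral>\<^sup>+s. ennreal ((norm z)\<^sup>2 * (norm (grad \<psi> (x + s *\<^sub>R z)))\<^sup>2) * indicator {0..1} s \<partial>lborel)"
proof -
  define h where "h s = (\<Sum>i\<in>UNIV. of_real (z $ i) * partial i \<psi> (x + s *\<^sub>R z))" for s
  have h: "(h has_integral \<psi> (x + z) - \<psi> x) {0..1}"
    unfolding h_def by (rule test_function_line_integral[OF \<psi>])
  have cont: "continuous_on UNIV h"
    unfolding h_def
    by (intro continuous_intros continuous_on_compose2[OF test_functions_continuous[OF test_functions_partial[OF \<psi>]]]) auto
  then have [measurable]: "h \<in> borel_measurable borel"
    by (rule borel_measurable_continuous_onI)
  have nh: "(\<lambda>s. norm (h s)) integrable_on {0..1}"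
    using cont by (intro integrable_continuous_interval continuous_intros) (auto intro: continuous_on_subset)
  let ?I = "\<integral>\<^sup>+s. ennreal (norm (h s)) * indicator {0..1} s \<partial>lborel"
  have "norm (\<psi> (x + z) - \<psi> x) \<le> integral {0..1} (\<lambda>s. norm (h s))"
    using integral_norm_bound_integral[OF has_integral_integrable[OF h] nh] integral_unique[OF h] by simp
  then have "ennreal (norm (\<psi> (x + z) - \<psi> x)) \<le> ennreal (integral {0..1} (\<lambda>s. norm (h s)))"
    by (rule ennreal_leI)
  also have "\<dots> = ?I"
  proof -
    have eq: "(\<lambda>s. norm (h s) * indicator {0..1} s) = (\<lambda>s. if s \<in> {0..1} then norm (h s) else 0)"
      by (auto simp: indicator_def)
    have "((\<lambda>s. norm (h s) * indicator {0..1} s) has_integral integral {0..1} (\<lambda>s. norm (h s))) UNIV"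
      unfolding eq has_integral_restrict_UNIV by (rule integrable_integral[OF nh])
    then have "(\<integral>\<^sup>+s. ennreal (norm (h s) * indicator {0..1} s) \<partial>lborel) = ennreal (integral {0..1} (\<lambda>s. norm (h s)))"
      by (intro nn_integral_has_integral_lborel) simp_all
    then show ?thesis
      by (simp add: ennreal_mult ennreal_indicator)
  qed
  finally have "ennreal (norm (\<psi> (x + z) - \<psi> x)) ^ 2 \<le> ?I ^ 2"
    by (rule power_mono) simp
  \<comment> \<open>The indicator is idempotent. Doubling it makes the second factor in
    Cauchy-Schwarz the indicator of the unit interval, whose square has integral 1.\<close>
  also have "?I = (\<integral>\<^sup>+s. (ennreal (norm (h s)) * indicator {0..1} s) * indicator {0..1} s \<partial>lborel)"
    by (intro nn_integral_cong) (simp add: indicator_def)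
  also have "\<dots> ^ 2 \<le> (\<integral>\<^sup>+s. (ennreal (norm (h s)) * indicator {0..1} s) ^ 2 \<partial>lborel) * (\<integral>\<^sup>+s. (indicator {0..1::real} s) ^ 2 \<partial>lborel)"
    by (rule Cauchy_Schwarz_nn_integral) measurable
  also have "(\<integral>\<^sup>+s. (indicator {0..1::real} s :: ennreal) ^ 2 \<partial>lborel) = (\<integral>\<^sup>+s. indicator {0..1::real} s \<partial>lborel)"
    by (intro nn_integral_cong) (simp add: indicator_def)
  also have "\<dots> = 1" by simp
  also have "(\<integral>\<^sup>+s. (ennreal (norm (h s)) * indicator {0..1} s) ^ 2 \<partial>lborel) * 1
      \<le> (\<integral>\<^sup>+s. ennreal ((norm z)\<^sup>2 * (norm (grad \<psi> (x + s *\<^sub>R z)))\<^sup>2) * indicator {0..1} s \<partial>lborel)"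
    unfolding mult_1_right
  proof (rule nn_integral_mono)
    fix s
    have "norm (h s) \<le> (\<Sum>i\<in>UNIV. \<bar>z $ i\<bar> * \<bar>norm (partial i \<psi> (x + s *\<^sub>R z))\<bar>)"
      unfolding h_def by (rule order.trans[OF norm_sum]) (simp add: norm_mult)
    also have "\<dots> \<le> L2_set (($) z) UNIV * L2_set (\<lambda>i. norm (partial i \<psi> (x + s *\<^sub>R z))) UNIV"
      by (rule L2_set_mult_ineq)
    also have "\<dots> = norm z * norm (grad \<psi> (x + s *\<^sub>R z))"
      by (simp add: norm_vec_def L2_set_def)
    finally have "(norm (h s))\<^sup>2 \<le> (norm z * norm (grad \<psi> (x + s *\<^sub>R z)))\<^sup>2"
      by (rule power_mono) simp
    then show "(ennreal (norm (h s)) * indicator {0..1} s) ^ 2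
        \<le> ennreal ((norm z)\<^sup>2 * (norm (grad \<psi> (x + s *\<^sub>R z)))\<^sup>2) * indicator {0..1} s"
      by (simp add: indicator_def ennreal_power power_mult_distrib ennreal_leI)
  qed
  finally show ?thesis by (simp add: ennreal_power)
qed

context bounded_open
begin

lemma grad_norm_lborel:
  assumes \<psi>: "\<psi> \<in> test_functions \<Omega>"
  shows "(\<integral>\<^sup>+x. ennreal ((norm (grad \<psi> x))\<^sup>2) \<partial>lborel) = ennreal ((L2_norm \<Omega> (grad \<psi>))\<^sup>2)"
proof -
  note [measurable] = grad_measurable[OF \<psi>]
  have zero: "(norm (grad \<psi> x))\<^sup>2 = 0" if "x \<notin> \<Omega>" for x
    using test_functions_support[OF test_functions_partial[OF \<psi>] that] by (simp add: norm_vec_power2)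
  have "integrable lborel (\<lambda>x. (norm (grad \<psi> x))\<^sup>2)"
    by (subst integrable_lborel_iff) (use zero L2_integrable[OF grad_test_function_L2[OF \<psi>]] in auto)
  then have "(\<integral>\<^sup>+x. ennreal ((norm (grad \<psi> x))\<^sup>2) \<partial>lborel) = ennreal (LINT x|lborel. (norm (grad \<psi> x))\<^sup>2)"
    by (rule nn_integral_eq_integral) simp
  also have "(LINT x|lborel. (norm (grad \<psi> x))\<^sup>2) = (L2_norm \<Omega> (grad \<psi>))\<^sup>2"
    unfolding L2_norm_power2 by (rule integral_eq_lborel[symmetric]) (use zero in auto)
  finally show ?thesis .
qed

text \<open>Integrating the pointwise increment bound over x and exchanging integrals, the inner
  integral no longer depends on s, because Lebesgue measure is invariant under the shift by s
  z.\<close>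

lemma translation_estimate:
  assumes \<psi>: "\<psi> \<in> test_functions \<Omega>"
  shows "(\<integral>\<^sup>+x. ennreal ((norm (\<psi> (x + z) - \<psi> x))\<^sup>2) \<partial>lborel) \<le> ennreal ((norm z)\<^sup>2 * (L2_norm \<Omega> (grad \<psi>))\<^sup>2)"
proof -
  note [measurable] = grad_measurable[OF \<psi>]
  let ?G = "\<lambda>x s. ennreal ((norm z)\<^sup>2 * (norm (grad \<psi> (x + s *\<^sub>R z)))\<^sup>2) * indicator {0..1} s"
  have "(\<integral>\<^sup>+x. ennreal ((norm (\<psi> (x + z) - \<psi> x))\<^sup>2) \<partial>lborel) \<le> (\<integral>\<^sup>+x. (\<integral>\<^sup>+s. ?G x s \<partial>lborel) \<partial>lborel)"
    by (intro nn_integral_mono test_function_increment_bound[OF \<psi>])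
  also have "\<dots> = (\<integral>\<^sup>+s. (\<integral>\<^sup>+x. ?G x s \<partial>lborel) \<partial>lborel)"
    by (rule lborel_pair.Fubini') measurable
  also have "\<dots> = (\<integral>\<^sup>+s. ennreal ((norm z)\<^sup>2 * (L2_norm \<Omega> (grad \<psi>))\<^sup>2) * indicator {0..1::real} s \<partial>lborel)"
  proof (rule nn_integral_cong)
    fix s :: real
    have "(\<integral>\<^sup>+x. ?G x s \<partial>lborel) = (\<integral>\<^sup>+x. ennreal ((norm z)\<^sup>2) * ennreal ((norm (grad \<psi> (x + s *\<^sub>R z)))\<^sup>2) \<partial>lborel) * indicator {0..1} s"
      by (subst nn_integral_multc) (simp_all add: ennreal_mult)
    also have "\<dots> = ennreal ((norm z)\<^sup>2) * (\<integral>\<^sup>+x. ennreal ((norm (grad \<psi> (x + s *\<^sub>R z)))\<^sup>2) \<partial>lborel) * indicator {0..1} s"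
      by (subst nn_integral_cmult) simp_all
    also have "(\<integral>\<^sup>+x. ennreal ((norm (grad \<psi> (x + s *\<^sub>R z)))\<^sup>2) \<partial>lborel) = ennreal ((L2_norm \<Omega> (grad \<psi>))\<^sup>2)"
      using nn_integral_lborel_translate[of "\<lambda>x. ennreal ((norm (grad \<psi> x))\<^sup>2)" "s *\<^sub>R z"]
      by (simp add: grad_norm_lborel[OF \<psi>])
    finally show "(\<integral>\<^sup>+x. ?G x s \<partial>lborel) = ennreal ((norm z)\<^sup>2 * (L2_norm \<Omega> (grad \<psi>))\<^sup>2) * indicator {0..1} s"
      by (simp add: ennreal_mult)
  qed
  also have "\<dots> = ennreal ((norm z)\<^sup>2 * (L2_norm \<Omega> (grad \<psi>))\<^sup>2)"
    by (subst nn_integral_cmult_indicator) simp_all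
  finally show ?thesis .
qed

text \<open>Expanding |\<psi>(x + z) - \<psi>(x)|^2 and integrating gives twice the squared norm
  minus twice the real part of the autocorrelation; \<open>translation_estimate\<close> bounds this
  from above.\<close>

lemma autocorrelation_bound:
  assumes \<psi>: "\<psi> \<in> test_functions \<Omega>"
  shows "(L2_norm \<Omega> \<psi>)\<^sup>2 - (norm z)\<^sup>2 * (L2_norm \<Omega> (grad \<psi>))\<^sup>2 / 2 \<le> Re (LINT x|lborel. \<psi> x * cnj (\<psi> (x + z)))"
proof -
  note [measurable] = test_functions_borel[OF \<psi>]
  have sq: "integrable lborel (\<lambda>x. (norm (\<psi> x))\<^sup>2)" "(LINT x|lborel. (norm (\<psi> x))\<^sup>2) = (L2_norm \<Omega> \<psi>)\<^sup>2"
  proof -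
    show "integrable lborel (\<lambda>x. (norm (\<psi> x))\<^sup>2)"
      by (subst integrable_lborel_iff)
        (use test_functions_support[OF \<psi>] L2_integrable[OF test_functions_L2[OF \<psi>]] in auto)
    show "(LINT x|lborel. (norm (\<psi> x))\<^sup>2) = (L2_norm \<Omega> \<psi>)\<^sup>2"
      unfolding L2_norm_power2
      by (rule integral_eq_lborel[symmetric]) (use test_functions_support[OF \<psi>] in auto)
  qed
  have sqz: "integrable lborel (\<lambda>x. (norm (\<psi> (x + z)))\<^sup>2)"
  proof -
    have "integrable (distr lborel borel ((+) z)) (\<lambda>x. (norm (\<psi> x))\<^sup>2)"
      using sq by (simp add: lborel_distr_plus)
    then show ?thesis
      by (subst (asm) integrable_distr_eq) (auto simp: add.commute)
  qed
  obtain B where B: "\<And>x. norm (\<psi> x) \<le> B"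
    using test_functions_bounded[OF \<psi>] by blast
  have prod: "integrable lborel (\<lambda>x. \<psi> x * cnj (\<psi> (x + z)))"
  proof (rule Bochner_Integration.integrable_bound)
    show "integrable lborel (\<lambda>x. \<psi> x * of_real B)"
      by (intro integrable_mult_left test_functions_integrable \<psi>)
    have "norm (\<psi> x) * norm (\<psi> (x + z)) \<le> norm (\<psi> x) * \<bar>B\<bar>" for x
      using B[of "x + z"] by (intro mult_left_mono) auto
    then show "AE x in lborel. norm (\<psi> x * cnj (\<psi> (x + z))) \<le> norm (\<psi> x * of_real B)"
      by (intro AE_I2) (simp add: norm_mult)
  qed measurable
  have expand: "(norm (\<psi> (x + z) - \<psi> x))\<^sup>2 = (norm (\<psi> (x + z)))\<^sup>2 + (norm (\<psi> x))\<^sup>2 - 2 * Re (\<psi> x * cnj (\<psi> (x + z)))" for x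
    unfolding cmod_power2 by (simp add: power2_eq_square algebra_simps)
  have int: "integrable lborel (\<lambda>x. (norm (\<psi> (x + z) - \<psi> x))\<^sup>2)"
    unfolding expand
    by (intro Bochner_Integration.integrable_diff Bochner_Integration.integrable_add integrable_mult_right
        integrable_Re sq sqz prod)
  have "ennreal (LINT x|lborel. (norm (\<psi> (x + z) - \<psi> x))\<^sup>2) \<le> ennreal ((norm z)\<^sup>2 * (L2_norm \<Omega> (grad \<psi>))\<^sup>2)"
    using translation_estimate[OF \<psi>, of z] by (subst (asm) nn_integral_eq_integral[OF int]) simp_all
  then have "(LINT x|lborel. (norm (\<psi> (x + z) - \<psi> x))\<^sup>2) \<le> (norm z)\<^sup>2 * (L2_norm \<Omega> (grad \<psi>))\<^sup>2"
    by (subst (asm) ennreal_le_iff) simp_all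
  moreover have "(LINT x|lborel. (norm (\<psi> (x + z) - \<psi> x))\<^sup>2)
      = 2 * (L2_norm \<Omega> \<psi>)\<^sup>2 - 2 * Re (LINT x|lborel. \<psi> x * cnj (\<psi> (x + z)))"
  proof -
    have "(LINT x|lborel. (norm (\<psi> (x + z)))\<^sup>2) = (L2_norm \<Omega> \<psi>)\<^sup>2"
      using integral_lborel_translate[of "\<lambda>x. (norm (\<psi> x))\<^sup>2" z] sq by simp
    moreover define R where "R x = Re (\<psi> x * cnj (\<psi> (x + z)))" for x
    moreover have "integrable lborel R" "(LINT x|lborel. R x) = Re (LINT x|lborel. \<psi> x * cnj (\<psi> (x + z)))"
      unfolding R_def using integrable_Re[OF prod] integral_Re[OF prod] by simp_all
    ultimately show ?thesis
      unfolding expand R_def[symmetric] using sq sqz by simp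
  qed
  ultimately show ?thesis by simp
qed

text \<open>In position space \<open>fourier_energy a \<psi>\<close> is the average of the autocorrelation of \<open>\<psi>\<close> against the
  Gauss kernel, which makes a Plancherel theorem unnecessary.\<close>

lemma fourier_energy_test_function_ge:
  assumes a: "a > 0" and \<psi>: "\<psi> \<in> test_functions \<Omega>"
  shows "((4 * pi\<^sup>2) powr (real CARD('n) / 2)) * (L2_norm \<Omega> \<psi>)\<^sup>2
      - 4 * a * (8 * pi\<^sup>2) powr (real CARD('n) / 2) * (L2_norm \<Omega> (grad \<psi>))\<^sup>2 \<le> fourier_energy a \<psi>"
proof -
  let ?M = "lebesgue_on \<Omega>"
  let ?K = "gauss_kernel a :: real^'n \<Rightarrow> real"
  interpret N: pair_sigma_finite ?M ?M ..
  note [measurable] = test_functions_borel[OF \<psi>]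
  have f: "\<psi> \<in> L2 \<Omega>" by (rule test_functions_L2[OF \<psi>])
  obtain B where B: "\<And>x. norm (\<psi> x) \<le> B"
    using test_functions_bounded[OF \<psi>] by blast
  have intK: "integrable lborel (\<lambda>z. complex_of_real (?K z * B))"
    by (intro integrable_of_real integrable_mult_left gauss_kernel_integral a)
  have int: "integrable (lborel \<Otimes>\<^sub>M lborel) (\<lambda>(x, z). \<psi> x * cnj (\<psi> (x + z)) * of_real (?K z))"
  proof (rule Bochner_Integration.integrable_bound[OF lborel_pair.integrable_mult_pair(1)[OF test_functions_integrable[OF \<psi>] intK]])
    show "(\<lambda>(x, z). \<psi> x * cnj (\<psi> (x + z)) * of_real (?K z)) \<in> borel_measurable (lborel \<Otimes>\<^sub>M lborel)"
      by measurable
    have "norm (\<psi> x) * norm (\<psi> (x + z)) * ?K z \<le> norm (\<psi> x) * (\<bar>?K z\<bar> * \<bar>B\<bar>)" for x z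
    proof -
      have "norm (\<psi> (x + z)) * ?K z \<le> \<bar>B\<bar> * ?K z"
        using B[of "x + z"] by (intro mult_right_mono) auto
      then have "norm (\<psi> x) * (norm (\<psi> (x + z)) * ?K z) \<le> norm (\<psi> x) * (\<bar>B\<bar> * ?K z)"
        by (intro mult_left_mono) auto
      then show ?thesis by (simp add: mult_ac)
    qed
    then show "AE p in lborel \<Otimes>\<^sub>M lborel. norm (case p of (x, z) \<Rightarrow> \<psi> x * cnj (\<psi> (x + z)) * of_real (?K z))
        \<le> norm (\<psi> (fst p) * complex_of_real (?K (snd p) * B))"
      by (intro AE_I2) (simp add: case_prod_beta norm_mult abs_mult)
  qed
  have "of_real (fourier_energy a \<psi>) = (LINT x|?M. (LINT y|?M. \<psi> x * cnj (\<psi> y) * of_real (?K (x - y))))"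
    unfolding fourier_energy_eq(2)[OF a f]
    by (subst N.integral_fst'[OF fourier_energy_eq(1)[OF a f], symmetric]) simp
  also have "\<dots> = (LINT x|?M. (LINT y|lborel. \<psi> x * cnj (\<psi> y) * of_real (?K (x - y))))"
    by (intro Bochner_Integration.integral_cong[OF refl] integral_eq_lborel)
      (simp_all add: test_functions_support[OF \<psi>])
  also have "\<dots> = (LINT x|lborel. (LINT y|lborel. \<psi> x * cnj (\<psi> y) * of_real (?K (x - y))))"
  proof (rule integral_eq_lborel)
    have "(\<lambda>x. LINT y|lborel. \<psi> x * cnj (\<psi> y) * of_real (?K (x - y))) \<in> borel_measurable lborel"
      by (rule lborel.borel_measurable_lebesgue_integral) measurable
    then show "(\<lambda>x. LINT y|lborel. \<psi> x * cnj (\<psi> y) * of_real (?K (x - y))) \<in> borel_measurable borel"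
      by simp
  qed (simp add: test_functions_support[OF \<psi>])
  \<comment> \<open>Substitution y = x + z in the inner integral; the kernel is even, so its
    argument x - y = - z may be replaced by z.\<close>
  also have "\<dots> = (LINT x|lborel. (LINT z|lborel. \<psi> x * cnj (\<psi> (x + z)) * of_real (?K z)))"
  proof (rule Bochner_Integration.integral_cong[OF refl])
    fix x
    show "(LINT y|lborel. \<psi> x * cnj (\<psi> y) * of_real (?K (x - y))) = (LINT z|lborel. \<psi> x * cnj (\<psi> (x + z)) * of_real (?K z))"
      using integral_lborel_translate[of "\<lambda>y. \<psi> x * cnj (\<psi> y) * of_real (?K (x - y))" x]
        gauss_kernel_commute[of a "0::real^'n"]
      by (simp add: add.commute)
  qed
  also have "\<dots> = (LINT z|lborel. (LINT x|lborel. \<psi> x * cnj (\<psi> (x + z)) * of_real (?K z)))"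
    by (rule lborel_pair.Fubini_integral[symmetric, OF int])
  also have "\<dots> = (LINT z|lborel. (LINT x|lborel. \<psi> x * cnj (\<psi> (x + z))) * of_real (?K z))"
    by (simp only: integral_mult_left_zero)
  finally have eq: "of_real (fourier_energy a \<psi>) = (LINT z|lborel. (LINT x|lborel. \<psi> x * cnj (\<psi> (x + z))) * of_real (?K z))" .
  have intR: "integrable lborel (\<lambda>z. (LINT x|lborel. \<psi> x * cnj (\<psi> (x + z))) * of_real (?K z))"
    using lborel_pair.integrable_snd[OF int] by (simp only: integral_mult_left_zero)
  have int1: "integrable lborel (\<lambda>z. ?K z * (L2_norm \<Omega> \<psi>)\<^sup>2)"
    by (intro integrable_mult_left gauss_kernel_integral a)
  have int2: "integrable lborel (\<lambda>z. ?K z * (norm z)\<^sup>2 * ((L2_norm \<Omega> (grad \<psi>))\<^sup>2 / 2))"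
    by (intro integrable_mult_left gauss_kernel_second_moment a)
  \<comment> \<open>The factor 4 a arises as 8 a from \<open>gauss_kernel_second_moment\<close>
    times the 1/2 in \<open>autocorrelation_bound\<close>; the regrouping separates the two.\<close>
  have "((4 * pi\<^sup>2) powr (real CARD('n) / 2)) * (L2_norm \<Omega> \<psi>)\<^sup>2
      - 4 * a * (8 * pi\<^sup>2) powr (real CARD('n) / 2) * (L2_norm \<Omega> (grad \<psi>))\<^sup>2
      = ((4 * pi\<^sup>2) powr (real CARD('n) / 2)) * (L2_norm \<Omega> \<psi>)\<^sup>2
      - (8 * a * (8 * pi\<^sup>2) powr (real CARD('n) / 2)) * ((L2_norm \<Omega> (grad \<psi>))\<^sup>2 / 2)"
    by simp
  also have "\<dots> \<le> (LINT z|lborel. ?K z) * (L2_norm \<Omega> \<psi>)\<^sup>2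
      - (LINT z|lborel. ?K z * (norm z)\<^sup>2) * ((L2_norm \<Omega> (grad \<psi>))\<^sup>2 / 2)"
    using gauss_kernel_integral(2)[OF a, where 'a="real^'n"] gauss_kernel_second_moment(2)[OF a, where 'a="real^'n"]
    by (intro diff_mono mult_right_mono) simp_all
  also have "\<dots> = (LINT z|lborel. ?K z * (L2_norm \<Omega> \<psi>)\<^sup>2 - ?K z * (norm z)\<^sup>2 * ((L2_norm \<Omega> (grad \<psi>))\<^sup>2 / 2))"
    by (subst Bochner_Integration.integral_diff[OF int1 int2]) (simp only: integral_mult_left_zero)
  also have "\<dots> \<le> (LINT z|lborel. Re ((LINT x|lborel. \<psi> x * cnj (\<psi> (x + z))) * of_real (?K z)))"
  proof (rule integral_mono)
    fix z :: "real^'n"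
    have "?K z * (L2_norm \<Omega> \<psi>)\<^sup>2 - ?K z * (norm z)\<^sup>2 * ((L2_norm \<Omega> (grad \<psi>))\<^sup>2 / 2)
        = ((L2_norm \<Omega> \<psi>)\<^sup>2 - (norm z)\<^sup>2 * (L2_norm \<Omega> (grad \<psi>))\<^sup>2 / 2) * ?K z"
      by (simp add: algebra_simps)
    also have "\<dots> \<le> Re (LINT x|lborel. \<psi> x * cnj (\<psi> (x + z))) * ?K z"
      by (intro mult_right_mono autocorrelation_bound \<psi>) simp
    finally show "?K z * (L2_norm \<Omega> \<psi>)\<^sup>2 - ?K z * (norm z)\<^sup>2 * ((L2_norm \<Omega> (grad \<psi>))\<^sup>2 / 2)
        \<le> Re ((LINT x|lborel. \<psi> x * cnj (\<psi> (x + z))) * of_real (?K z))"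
      by simp
  qed (intro Bochner_Integration.integrable_diff int1 int2 integrable_Re intR)+
  also have "\<dots> = Re (of_real (fourier_energy a \<psi>))"
    unfolding eq by (rule integral_Re[OF intR])
  finally show ?thesis by simp
qed

text \<open>Dominated convergence: for a bounded sequence a multiple of the Gaussian weight is a
  majorant. Pointwise convergence of the transforms suffices, without convergence in norm, which is
  what makes the functional useful for compactness.\<close>

lemma fourier_energy_tendsto:
  assumes a: "a > 0" and F: "\<And>k. F k \<in> L2 \<Omega>" and f: "f \<in> L2 \<Omega>"
    and bounded: "\<And>k. L2_norm \<Omega> (F k) \<le> C"
    and lim: "\<And>\<xi>. (\<lambda>k. L2_inner \<Omega> (F k) (plane_wave \<xi>)) \<longlonglongrightarrow> L2_inner \<Omega> f (plane_wave \<xi>)"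
  shows "(\<lambda>k. fourier_energy a (F k)) \<longlonglongrightarrow> fourier_energy a f"
  unfolding fourier_energy_def
proof (rule integral_dominated_convergence[where w = "\<lambda>\<xi>. (C * sqrt (measure lebesgue \<Omega>))\<^sup>2 * exp (- a * (norm \<xi>)\<^sup>2)"])
  show "integrable lborel (\<lambda>\<xi>::real^'n. (C * sqrt (measure lebesgue \<Omega>))\<^sup>2 * exp (- a * (norm \<xi>)\<^sup>2))"
    by (intro integrable_mult_right gaussian_integral a)
  show "AE \<xi> in lborel. (\<lambda>k. exp (- a * (norm \<xi>)\<^sup>2) * (norm (L2_inner \<Omega> (F k) (plane_wave \<xi>)))\<^sup>2)
      \<longlonglongrightarrow> exp (- a * (norm \<xi>)\<^sup>2) * (norm (L2_inner \<Omega> f (plane_wave \<xi>)))\<^sup>2"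
    by (intro AE_I2 tendsto_intros lim)
  show "AE \<xi> in lborel. norm (exp (- a * (norm \<xi>)\<^sup>2) * (norm (L2_inner \<Omega> (F k) (plane_wave \<xi>)))\<^sup>2)
      \<le> (C * sqrt (measure lebesgue \<Omega>))\<^sup>2 * exp (- a * (norm \<xi>)\<^sup>2)" for k
  proof (intro AE_I2)
    fix \<xi>
    have "norm (L2_inner \<Omega> (F k) (plane_wave \<xi>)) \<le> C * sqrt (measure lebesgue \<Omega>)"
      using fourier_bound[OF F, of k \<xi>] bounded[of k] mult_right_mono[OF bounded[of k], of "sqrt (measure lebesgue \<Omega>)"]
      by (simp add: order.trans)
    then have "(norm (L2_inner \<Omega> (F k) (plane_wave \<xi>)))\<^sup>2 \<le> (C * sqrt (measure lebesgue \<Omega>))\<^sup>2"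
      by (rule power_mono) simp
    then show "norm (exp (- a * (norm \<xi>)\<^sup>2) * (norm (L2_inner \<Omega> (F k) (plane_wave \<xi>)))\<^sup>2)
      \<le> (C * sqrt (measure lebesgue \<Omega>))\<^sup>2 * exp (- a * (norm \<xi>)\<^sup>2)"
      by (simp add: abs_mult mult.commute)
  qed
qed (rule borel_measurable_integrable, rule fourier_energy_integrable[OF _ a], rule f F)+

text \<open>Both sides are continuous along test functions approximating \<open>u\<close> together
  with its gradient. The inequality says that the mass of \<open>u\<close> invisible to the weighted
  transform is at most of order a times the energy.\<close>

lemma fourier_energy_ge:
  assumes a: "a > 0" and ug: "h10_grad \<Omega> u g"
  shows "((4 * pi\<^sup>2) powr (real CARD('n) / 2)) * (L2_norm \<Omega> u)\<^sup>2
      - 4 * a * (8 * pi\<^sup>2) powr (real CARD('n) / 2) * (L2_norm \<Omega> g)\<^sup>2 \<le> fourier_energy a u"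
proof -
  obtain \<psi> where \<psi>: "\<And>k. \<psi> k \<in> test_functions \<Omega>"
    "(\<lambda>k. L2_norm \<Omega> (\<lambda>x. \<psi> k x - u x)) \<longlonglongrightarrow> 0"
    "(\<lambda>k. L2_norm \<Omega> (\<lambda>x. grad (\<psi> k) x - g x)) \<longlonglongrightarrow> 0"
    and L2: "u \<in> L2 \<Omega>" "g \<in> L2 \<Omega>"
    using ug unfolding h10_grad_def by blast
  have n1: "(\<lambda>k. L2_norm \<Omega> (\<psi> k)) \<longlonglongrightarrow> L2_norm \<Omega> u"
    by (rule L2_norm_tendsto[OF test_functions_L2[OF \<psi>(1)] L2(1) \<psi>(2)])
  have n2: "(\<lambda>k. L2_norm \<Omega> (grad (\<psi> k))) \<longlonglongrightarrow> L2_norm \<Omega> g"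
    by (rule L2_norm_tendsto[OF grad_test_function_L2[OF \<psi>(1)] L2(2) \<psi>(3)])
  obtain C where C: "\<And>k. L2_norm \<Omega> (\<psi> k) \<le> C"
    using convergent_imp_Bseq[OF convergentI[OF n1]] unfolding Bseq_def by auto
  have "(\<lambda>k. L2_inner \<Omega> (\<psi> k) (plane_wave \<xi>)) \<longlonglongrightarrow> L2_inner \<Omega> u (plane_wave \<xi>)" for \<xi>
    by (rule L2_inner_tendsto[OF test_functions_L2[OF \<psi>(1)] L2(1) plane_wave_L2 plane_wave_L2 \<psi>(2)])
      (simp add: L2_norm_def)
  then have lim: "(\<lambda>k. fourier_energy a (\<psi> k)) \<longlonglongrightarrow> fourier_energy a u"
    by (intro fourier_energy_tendsto[OF a test_functions_L2[OF \<psi>(1)] L2(1) C])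
  show ?thesis
  proof (rule LIMSEQ_le[OF _ lim])
    show "(\<lambda>k. ((4 * pi\<^sup>2) powr (real CARD('n) / 2)) * (L2_norm \<Omega> (\<psi> k))\<^sup>2
        - 4 * a * (8 * pi\<^sup>2) powr (real CARD('n) / 2) * (L2_norm \<Omega> (grad (\<psi> k)))\<^sup>2)
      \<longlonglongrightarrow> ((4 * pi\<^sup>2) powr (real CARD('n) / 2)) * (L2_norm \<Omega> u)\<^sup>2
        - 4 * a * (8 * pi\<^sup>2) powr (real CARD('n) / 2) * (L2_norm \<Omega> g)\<^sup>2"
      by (intro tendsto_intros n1 n2)
  qed (use fourier_energy_test_function_ge[OF a \<psi>(1)] in blast)
qed

end

subsection \<open>Spectral theory of compact quadratic forms\<close>

text \<open>Functions equal almost everywhere are not identified, so the forms are only semidefinite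
  on functions. The same generality covers the form a - m b in the variational argument, for which
  the minimiser is a null vector. The single operation f + c g in \<open>lincomb\<close> and
  \<open>add_left\<close> yields differences (c = -1) and multiples (g = f).\<close>

locale semi_inner =
  fixes V :: "('a \<Rightarrow> complex) set" and B :: "('a \<Rightarrow> complex) \<Rightarrow> ('a \<Rightarrow> complex) \<Rightarrow> complex"
  assumes lincomb: "f \<in> V \<Longrightarrow> g \<in> V \<Longrightarrow> (\<lambda>x. f x + c * g x) \<in> V"
    and add_left: "f \<in> V \<Longrightarrow> g \<in> V \<Longrightarrow> h \<in> V \<Longrightarrow> B (\<lambda>x. f x + c * g x) h = B f h + c * B g h"
    and herm: "f \<in> V \<Longrightarrow> g \<in> V \<Longrightarrow> B g f = cnj (B f g)"
    and nonneg: "f \<in> V \<Longrightarrow> 0 \<le> Re (B f f)"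
begin

lemma add_right:
  assumes "f \<in> V" "g \<in> V" "h \<in> V"
  shows "B h (\<lambda>x. f x + c * g x) = B h f + cnj c * B h g"
  using herm[OF lincomb[OF assms(1,2)] assms(3), of c] assms
  by (simp add: add_left herm[OF assms(1,3)] herm[OF assms(2,3)])

lemma diff_in: "f \<in> V \<Longrightarrow> g \<in> V \<Longrightarrow> (\<lambda>x. f x - g x) \<in> V"
  using lincomb[of f g "-1"] by simp

lemma diff_left: "f \<in> V \<Longrightarrow> g \<in> V \<Longrightarrow> h \<in> V \<Longrightarrow> B (\<lambda>x. f x - g x) h = B f h - B g h"
  using add_left[of f g h "-1"] by simp

lemma scale_in: "f \<in> V \<Longrightarrow> (\<lambda>x. c * f x) \<in> V"
  using lincomb[of f f "c - 1"] by (simp add: algebra_simps)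

lemma scale_left: "f \<in> V \<Longrightarrow> h \<in> V \<Longrightarrow> B (\<lambda>x. c * f x) h = c * B f h"
  using add_left[of f f h "c - 1"] by (simp add: algebra_simps)

lemma quadratic:
  assumes "f \<in> V" "g \<in> V"
  shows "Re (B (\<lambda>x. f x + c * g x) (\<lambda>x. f x + c * g x))
    = Re (B f f) + 2 * Re (c * B g f) + (norm c)\<^sup>2 * Re (B g g)"
proof -
  have "B (\<lambda>x. f x + c * g x) (\<lambda>x. f x + c * g x)
      = B f f + cnj c * cnj (B g f) + c * (B g f + cnj c * B g g)"
    using assms by (simp add: add_left add_right lincomb herm[OF assms(2,1)])
  moreover have "c * (cnj c * B g g) = of_real ((norm c)\<^sup>2) * B g g"
    by (simp only: complex_norm_square mult.assoc)
  ultimately show ?thesis by (simp add: distrib_left)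
qed

text \<open>Nonnegativity of the form at f - s B(f, g) g is a quadratic inequality in the real
  number s. Its minimising s settles the nondegenerate case; if g is a null vector the inequality is
  affine in s, which forces B(f, g) = 0.\<close>

lemma Cauchy_Schwarz:
  assumes f: "f \<in> V" and g: "g \<in> V"
  shows "(norm (B f g))\<^sup>2 \<le> Re (B f f) * Re (B g g)"
proof -
  let ?n = "(norm (B f g))\<^sup>2"
  have key: "0 \<le> Re (B f f) - 2 * s * ?n + s\<^sup>2 * ?n * Re (B g g)" for s :: real
  proof -
    let ?c = "- of_real s * B f g"
    have "?c * B g f = of_real (- s * ?n)"
      unfolding herm[OF f g] of_real_mult complex_norm_square by simp
    then have "Re (?c * B g f) = - s * ?n" by (simp only: Re_complex_of_real)
    moreover have "(norm ?c)\<^sup>2 = s\<^sup>2 * ?n"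
      by (simp add: norm_mult power_mult_distrib)
    ultimately show ?thesis
      using nonneg[OF lincomb[OF f g], of ?c] unfolding quadratic[OF f g] by simp
  qed
  show ?thesis
  proof (cases "Re (B g g) = 0")
    case True
    have "?n = 0"
    proof (rule ccontr)
      assume "?n \<noteq> 0"
      then have "?n > 0" by simp
      \<comment> \<open>With \<open>Re (B g g) = 0\<close> this s makes the right-hand side equal to
        -1.\<close>
      with key[of "(Re (B f f) + 1) / (2 * ?n)"] True show False
        by (simp add: field_simps)
    qed
    with True show ?thesis by simp
  next
    case False
    then have pos: "Re (B g g) > 0" using nonneg[OF g] by simp
    from key[of "1 / Re (B g g)"] pos have "0 \<le> Re (B f f) - ?n / Re (B g g)"
      by (simp add: power2_eq_square field_simps)
    with pos show ?thesis by (simp add: field_simps)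
  qed
qed

lemma parallelogram:
  assumes "f \<in> V" "g \<in> V"
  shows "Re (B (\<lambda>x. f x + g x) (\<lambda>x. f x + g x)) + Re (B (\<lambda>x. f x - g x) (\<lambda>x. f x - g x))
    = 2 * Re (B f f) + 2 * Re (B g g)"
  using quadratic[OF assms, of 1] quadratic[OF assms, of "-1"] by simp

lemma tendsto_left:
  assumes "\<And>n. F n \<in> V" "f \<in> V" "g \<in> V"
    and lim: "(\<lambda>n. Re (B (\<lambda>x. F n x - f x) (\<lambda>x. F n x - f x))) \<longlonglongrightarrow> 0"
  shows "(\<lambda>n. B (F n) g) \<longlonglongrightarrow> B f g"
proof -
  have "(\<lambda>n. B (F n) g - B f g) \<longlonglongrightarrow> 0"
  proof (rule Lim_null_comparison)
    have "norm (B (F n) g - B f g) \<le> sqrt (Re (B (\<lambda>x. F n x - f x) (\<lambda>x. F n x - f x)) * Re (B g g))" for n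
      using Cauchy_Schwarz[OF diff_in[OF assms(1,2)] assms(3), of n] diff_left[OF assms(1,2,3), of n]
      by (simp add: real_le_rsqrt)
    then show "\<forall>\<^sub>F n in sequentially. norm (B (F n) g - B f g)
        \<le> sqrt (Re (B (\<lambda>x. F n x - f x) (\<lambda>x. F n x - f x)) * Re (B g g))"
      by simp
    have "(\<lambda>n. sqrt (Re (B (\<lambda>x. F n x - f x) (\<lambda>x. F n x - f x)) * Re (B g g))) \<longlonglongrightarrow> sqrt (0 * Re (B g g))"
      by (intro tendsto_intros lim)
    then show "(\<lambda>n. sqrt (Re (B (\<lambda>x. F n x - f x) (\<lambda>x. F n x - f x)) * Re (B g g))) \<longlonglongrightarrow> 0"
      by simp
  qed
  then show ?thesis by (simp add: LIM_zero_iff)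
qed

lemma tendsto_right:
  assumes "\<And>n. F n \<in> V" "f \<in> V" "g \<in> V"
    and "(\<lambda>n. Re (B (\<lambda>x. F n x - f x) (\<lambda>x. F n x - f x))) \<longlonglongrightarrow> 0"
  shows "(\<lambda>n. B g (F n)) \<longlonglongrightarrow> B g f"
  using tendsto_cnj[OF tendsto_left[OF assms]] assms(1-3) by (simp add: herm[symmetric])

lemma tendsto_self:
  assumes F: "\<And>n. F n \<in> V" and f: "f \<in> V"
    and lim: "(\<lambda>n. Re (B (\<lambda>x. F n x - f x) (\<lambda>x. F n x - f x))) \<longlonglongrightarrow> 0"
  shows "(\<lambda>n. Re (B (F n) (F n))) \<longlonglongrightarrow> Re (B f f)"
proof -
  have "Re (B (F n) (F n)) = Re (B (\<lambda>x. F n x - f x) (\<lambda>x. F n x - f x)) + 2 * Re (B (F n) f) - Re (B f f)" for n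
  proof -
    have "B f (F n) = cnj (B (F n) f)" by (rule herm[OF F f])
    then show ?thesis
      using quadratic[OF F f, of n "-1"] by simp
  qed
  moreover have "(\<lambda>n. Re (B (\<lambda>x. F n x - f x) (\<lambda>x. F n x - f x)) + 2 * Re (B (F n) f) - Re (B f f))
      \<longlonglongrightarrow> 0 + 2 * Re (B f f) - Re (B f f)"
    by (intro tendsto_intros lim tendsto_left F f)
  ultimately show ?thesis by simp
qed

text \<open>The remainder of the expansion of \<open>v\<close> after N terms. Its recursion
  \<open>resid_Suc\<close> subtracts one term at a time, so its properties follow by induction from
  \<open>add_left\<close> and \<open>quadratic\<close>.\<close>

definition resid :: "(nat \<Rightarrow> 'a \<Rightarrow> complex) \<Rightarrow> nat \<Rightarrow> ('a \<Rightarrow> complex) \<Rightarrow> 'a \<Rightarrow> complex" where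
  "resid u N v x = v x - (\<Sum>j<N. B v (u j) * u j x)"

lemma resid_0: "resid u 0 v = v"
  by (simp add: resid_def fun_eq_iff)

lemma resid_Suc: "resid u (Suc N) v = (\<lambda>x. resid u N v x + (- B v (u N)) * u N x)"
  by (simp add: resid_def fun_eq_iff)

context
  fixes u :: "nat \<Rightarrow> 'a \<Rightarrow> complex"
  assumes u: "\<And>j. u j \<in> V" and orthonormal: "\<And>i j. B (u i) (u j) = (if i = j then 1 else 0)"
begin

lemma resid_in: "v \<in> V \<Longrightarrow> resid u N v \<in> V"
  by (induction N) (simp_all only: resid_0 resid_Suc lincomb u)

lemma resid_coeff:
  assumes v: "v \<in> V" shows "B (resid u N v) (u i) = (if i < N then 0 else B v (u i))"
proof (induction N)
  case (Suc N)
  show ?case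
    unfolding resid_Suc add_left[OF resid_in[OF v] u u] Suc.IH orthonormal by (auto simp: less_Suc_eq)
qed (simp add: resid_0)

lemma resid_norm:
  assumes v: "v \<in> V"
  shows "Re (B (resid u N v) (resid u N v)) = Re (B v v) - (\<Sum>j<N. (norm (B v (u j)))\<^sup>2)"
proof (induction N)
  case (Suc N)
  let ?p = "resid u N v" and ?c = "B v (u N)"
  have p: "?p \<in> V" by (rule resid_in[OF v])
  have bup: "B (u N) ?p = cnj ?c"
    using herm[OF p u] by (simp add: resid_coeff[OF v])
  have "Re (B (resid u (Suc N) v) (resid u (Suc N) v)) = Re (B ?p ?p) + (2 * Re (- ?c * cnj ?c) + (norm (- ?c))\<^sup>2)"
    unfolding resid_Suc quadratic[OF p u] bup orthonormal by simp
  also have "2 * Re (- ?c * cnj ?c) + (norm (- ?c))\<^sup>2 = - (norm ?c)\<^sup>2"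
    by (simp flip: complex_norm_square)
  finally show ?case unfolding Suc.IH by simp
qed (simp add: resid_0)

lemma Bessel: "v \<in> V \<Longrightarrow> (\<Sum>j<N. (norm (B v (u j)))\<^sup>2) \<le> Re (B v v)"
  using resid_norm[of v N] nonneg[OF resid_in[of v N]] by simp

end

end

text \<open>Here b plays the role of the inner product and a that of the energy. Completeness of
  \<open>u\<close> is the goal, so it is replaced by the weaker \<open>exhaustive\<close>: an
  eigenvector orthogonal to all \<open>u j\<close> is null. \<open>complete\<close> concerns the
  norm of b + a, while \<open>compact\<close> extracts b-Cauchy subsequences from sets bounded in
  both forms.\<close>

locale compact_form = b: semi_inner V b + a: semi_inner V a
  for V :: "('a \<Rightarrow> complex) set" and b a :: "('a \<Rightarrow> complex) \<Rightarrow> ('a \<Rightarrow> complex) \<Rightarrow> complex" +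
  fixes lam :: "nat \<Rightarrow> real" and u :: "nat \<Rightarrow> 'a \<Rightarrow> complex"
  assumes complete: "\<And>f. (\<And>n. f n \<in> V) \<Longrightarrow>
      (\<And>e. e > 0 \<Longrightarrow> \<exists>N. \<forall>m\<ge>N. \<forall>n\<ge>N. Re (b (\<lambda>x. f m x - f n x) (\<lambda>x. f m x - f n x))
        + Re (a (\<lambda>x. f m x - f n x) (\<lambda>x. f m x - f n x)) < e) \<Longrightarrow>
      \<exists>g\<in>V. (\<lambda>n. Re (b (\<lambda>x. f n x - g x) (\<lambda>x. f n x - g x))) \<longlonglongrightarrow> 0
        \<and> (\<lambda>n. Re (a (\<lambda>x. f n x - g x) (\<lambda>x. f n x - g x))) \<longlonglongrightarrow> 0"
    and compact: "\<And>f C. (\<And>n. f n \<in> V) \<Longrightarrow> (\<And>n. Re (b (f n) (f n)) \<le> C) \<Longrightarrow> (\<And>n. Re (a (f n) (f n)) \<le> C) \<Longrightarrow>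
      \<exists>r. strict_mono (r :: nat \<Rightarrow> nat) \<and> (\<forall>e>0. \<exists>N. \<forall>m\<ge>N. \<forall>n\<ge>N.
        Re (b (\<lambda>x. f (r m) x - f (r n) x) (\<lambda>x. f (r m) x - f (r n) x)) < e)"
    and u_in: "\<And>j. u j \<in> V"
    and eigen: "\<And>j v. v \<in> V \<Longrightarrow> a (u j) v = of_real (lam j) * b (u j) v"
    and orthonormal: "\<And>i j. b (u i) (u j) = (if i = j then 1 else 0)"
    and exhaustive: "\<And>w \<mu>. w \<in> V \<Longrightarrow> (\<And>v. v \<in> V \<Longrightarrow> a w v = of_real \<mu> * b w v) \<Longrightarrow>
      (\<And>j. b w (u j) = 0) \<Longrightarrow> Re (b w w) = 0"
begin

lemma eigen_right: "v \<in> V \<Longrightarrow> a v (u j) = of_real (lam j) * b v (u j)"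
  using eigen[of v j] a.herm[OF u_in, of v j] b.herm[OF u_in, of v j] by simp

lemma lam_nonneg: "0 \<le> lam j"
  using a.nonneg[OF u_in, of j] eigen[OF u_in, of j j] orthonormal[of j j] by simp

lemmas resid_in = b.resid_in[OF u_in orthonormal]
  and resid_coeff = b.resid_coeff[OF u_in orthonormal]
  and resid_norm = b.resid_norm[OF u_in orthonormal]

text \<open>The eigenvalue equation turns b-orthogonality into a-orthogonality, so removing the
  component along \<open>u N\<close> lowers the energy by exactly \<open>lam N\<close> times the
  squared coefficient.\<close>

lemma resid_energy:
  assumes v: "v \<in> V"
  shows "Re (a (b.resid u N v) (b.resid u N v)) = Re (a v v) - (\<Sum>j<N. lam j * (norm (b v (u j)))\<^sup>2)"
proof (induction N)
  case (Suc N)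
  let ?p = "b.resid u N v" and ?c = "b v (u N)"
  have p: "?p \<in> V" by (rule resid_in[OF v])
  have bup: "b (u N) ?p = cnj ?c"
    using b.herm[OF p u_in] by (simp add: resid_coeff[OF v])
  have "Re (- ?c * (of_real (lam N) * cnj ?c)) = lam N * - Re (?c * cnj ?c)"
    by (simp add: algebra_simps)
  then have q: "2 * Re (- ?c * (of_real (lam N) * cnj ?c)) + (norm (- ?c))\<^sup>2 * lam N = - lam N * (norm ?c)\<^sup>2"
    by (simp flip: complex_norm_square)
  have "Re (a (b.resid u (Suc N) v) (b.resid u (Suc N) v)) = Re (a ?p ?p) + (2 * Re (- ?c * (of_real (lam N) * cnj ?c)) + (norm (- ?c))\<^sup>2 * lam N)"
    unfolding b.resid_Suc a.quadratic[OF p u_in] eigen[OF p] eigen[OF u_in] bup orthonormal by simp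
  then show ?case
    unfolding q Suc.IH by simp
qed (simp add: b.resid_0)

lemma coeff_summable:
  assumes v: "v \<in> V"
  shows "summable (\<lambda>j. (norm (b v (u j)))\<^sup>2)"
    and "summable (\<lambda>j. lam j * (norm (b v (u j)))\<^sup>2)"
    and "(\<Sum>j. lam j * (norm (b v (u j)))\<^sup>2) \<le> Re (a v v)"
proof -
  have 1: "(\<Sum>j<N. (norm (b v (u j)))\<^sup>2) \<le> Re (b v v)" for N
    by (rule b.Bessel[OF u_in orthonormal v])
  have 2: "(\<Sum>j<N. lam j * (norm (b v (u j)))\<^sup>2) \<le> Re (a v v)" for N
    using resid_energy[OF v, of N] a.nonneg[OF resid_in[OF v], of N] by simp
  show "summable (\<lambda>j. (norm (b v (u j)))\<^sup>2)"
    by (rule summableI_nonneg_bounded[OF _ 1]) simp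
  show s: "summable (\<lambda>j. lam j * (norm (b v (u j)))\<^sup>2)"
    by (rule summableI_nonneg_bounded[OF _ 2]) (simp add: lam_nonneg)
  show "(\<Sum>j. lam j * (norm (b v (u j)))\<^sup>2) \<le> Re (a v v)"
    by (rule suminf_le_const[OF s 2])
qed

text \<open>The two residuals differ by a combination of the \<open>u j\<close> with M \<le> j < N,
  to which the later residual is orthogonal in both forms. Hence the squared distance of two
  residuals is the difference of their squared norms.\<close>

lemma resid_cross:
  assumes v: "v \<in> V" and "M \<le> N"
  shows "b (b.resid u N v) (b.resid u M v) = b (b.resid u N v) (b.resid u N v)" and "a (b.resid u N v) (b.resid u M v) = a (b.resid u N v) (b.resid u N v)"
  using \<open>M \<le> N\<close>
proof (induction M rule: inc_induct)
  case (step M)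
  have p: "b.resid u M v \<in> V" "b.resid u N v \<in> V" by (rule resid_in[OF v])+
  have "b (b.resid u N v) (u M) = 0"
    using step.hyps by (simp add: resid_coeff[OF v])
  moreover from this have "a (b.resid u N v) (u M) = 0" by (simp add: eigen_right[OF p(2)])
  ultimately show "b (b.resid u N v) (b.resid u M v) = b (b.resid u N v) (b.resid u N v)" "a (b.resid u N v) (b.resid u M v) = a (b.resid u N v) (b.resid u N v)"
    using step.IH unfolding b.resid_Suc b.add_right[OF p(1) u_in p(2)] a.add_right[OF p(1) u_in p(2)] by simp_all
qed simp_all

text \<open>By \<open>resid_cross\<close> the squared distance of two residuals in b + a is the
  difference of the values \<open>?E\<close>, and \<open>?E\<close> converges because the
  coefficient series do. The residuals are therefore Cauchy, and each coefficient of the limit is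
  eventually 0 along the sequence.\<close>

lemma resid_limit:
  assumes v: "v \<in> V"
  shows "\<exists>w\<in>V. (\<forall>j. b w (u j) = 0)
    \<and> (\<lambda>N. Re (b (\<lambda>x. b.resid u N v x - w x) (\<lambda>x. b.resid u N v x - w x))) \<longlonglongrightarrow> 0
    \<and> (\<lambda>N. Re (a (\<lambda>x. b.resid u N v x - w x) (\<lambda>x. b.resid u N v x - w x))) \<longlonglongrightarrow> 0"
proof -
  have p: "b.resid u N v \<in> V" for N by (rule resid_in[OF v])
  let ?E = "\<lambda>N. Re (b (b.resid u N v) (b.resid u N v)) + Re (a (b.resid u N v) (b.resid u N v))"
  let ?D = "\<lambda>m n. Re (b (\<lambda>x. b.resid u m v x - b.resid u n v x) (\<lambda>x. b.resid u m v x - b.resid u n v x))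
      + Re (a (\<lambda>x. b.resid u m v x - b.resid u n v x) (\<lambda>x. b.resid u m v x - b.resid u n v x))"
  have D: "?D m n = \<bar>?E m - ?E n\<bar>" for m n
  proof -
    have *: "?D m n = ?E n - ?E m \<and> ?D n m = ?E n - ?E m" if "n \<le> m" for m n
    proof -
      have "Re (b (b.resid u m v) (b.resid u n v)) = Re (b (b.resid u m v) (b.resid u m v))"
        "Re (a (b.resid u m v) (b.resid u n v)) = Re (a (b.resid u m v) (b.resid u m v))"
        using resid_cross[OF v that] by simp_all
      moreover from this have "Re (b (b.resid u n v) (b.resid u m v)) = Re (b (b.resid u m v) (b.resid u m v))"
        "Re (a (b.resid u n v) (b.resid u m v)) = Re (a (b.resid u m v) (b.resid u m v))"
        using b.herm[OF p[of m] p[of n]] a.herm[OF p[of m] p[of n]] by simp_all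
      ultimately show ?thesis
        using b.quadratic[OF p[of m] p[of n], of "-1"] a.quadratic[OF p[of m] p[of n], of "-1"]
          b.quadratic[OF p[of n] p[of m], of "-1"] a.quadratic[OF p[of n] p[of m], of "-1"] by simp
    qed
    moreover have "0 \<le> ?D m n"
      by (intro add_nonneg_nonneg b.nonneg a.nonneg b.diff_in p)
    ultimately show ?thesis
    proof (cases "n \<le> m")
      case False
      then have "?D m n = ?E m - ?E n" using *[of m n] by simp
      with \<open>0 \<le> ?D m n\<close> show ?thesis by linarith
    qed (use *[of n m] in linarith)
  qed
  have "convergent ?E"
    unfolding resid_energy[OF v] resid_norm[OF v]
    using coeff_summable(1,2)[OF v]
    by (intro convergent_add convergent_diff convergent_const) (simp_all add: summable_iff_convergent)
  then have "Cauchy ?E" by (rule convergent_Cauchy)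
  then have "\<exists>N. \<forall>m\<ge>N. \<forall>n\<ge>N. ?D m n < e" if "e > 0" for e
    using that unfolding D Cauchy_def dist_real_def by blast
  then obtain w where w: "w \<in> V"
    "(\<lambda>N. Re (b (\<lambda>x. b.resid u N v x - w x) (\<lambda>x. b.resid u N v x - w x))) \<longlonglongrightarrow> 0"
    "(\<lambda>N. Re (a (\<lambda>x. b.resid u N v x - w x) (\<lambda>x. b.resid u N v x - w x))) \<longlonglongrightarrow> 0"
    using complete[of "\<lambda>N. b.resid u N v", OF p] by blast
  have "b w (u j) = 0" for j
  proof -
    have "(\<lambda>N. b (b.resid u N v) (u j)) \<longlonglongrightarrow> b w (u j)"
      by (rule b.tendsto_left[OF p w(1) u_in w(2)])
    moreover have "(\<lambda>N. b (b.resid u N v) (u j)) \<longlonglongrightarrow> 0"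
      by (rule tendsto_eventually)
        (use eventually_gt_at_top[of j] in \<open>eventually_elim, simp add: resid_coeff[OF v]\<close>)
    ultimately show ?thesis by (rule LIMSEQ_unique)
  qed
  with w show ?thesis by blast
qed

text \<open>A minimiser of \<open>a\<close> on the unit sphere of the orthogonal complement would be an
  eigenvector that \<open>u\<close> misses.\<close>

lemma orthogonal_complement_trivial:
  assumes v0: "v0 \<in> V" "\<And>j. b v0 (u j) = 0"
  shows "Re (b v0 v0) = 0"
proof (rule ccontr)
  assume ne: "Re (b v0 v0) \<noteq> 0"
  define W where "W = {v \<in> V. \<forall>j. b v (u j) = 0}"
  define S where "S = {Re (a f f) |f. f \<in> W \<and> Re (b f f) = 1}"
  define m where "m = Inf S"
  have W_V: "f \<in> V" if "f \<in> W" for f using that by (simp add: W_def)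
  have W_lin: "(\<lambda>x. f x + c * g x) \<in> W" if "f \<in> W" "g \<in> W" for f g c
    using that by (simp add: W_def b.lincomb b.add_left u_in)
  have W_scale: "(\<lambda>x. c * f x) \<in> W" if "f \<in> W" for f c
    using that by (simp add: W_def b.scale_in b.scale_left u_in)
  have scale_sq: "Re (b (\<lambda>x. of_real c * f x) (\<lambda>x. of_real c * f x)) = c\<^sup>2 * Re (b f f)"
    "Re (a (\<lambda>x. of_real c * f x) (\<lambda>x. of_real c * f x)) = c\<^sup>2 * Re (a f f)" if "f \<in> V" for f c
    using b.quadratic[OF that that, of "of_real c - 1"] a.quadratic[OF that that, of "of_real c - 1"]
      norm_of_real[of "c - 1", where 'a = complex]
    by (simp_all add: algebra_simps power2_eq_square)
  have normalize: "\<exists>g\<in>W. Re (b g g) = 1 \<and> Re (a g g) = Re (a f f) / Re (b f f)" if "f \<in> W" "Re (b f f) \<noteq> 0" for f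
  proof -
    have pos: "Re (b f f) > 0" using b.nonneg[OF W_V[OF that(1)]] that(2) by simp
    let ?c = "1 / sqrt (Re (b f f))"
    have "?c\<^sup>2 = 1 / Re (b f f)" using pos by (simp add: power_divide)
    then show ?thesis
      using scale_sq[OF W_V[OF that(1)], of ?c] pos
      by (intro bexI[OF _ W_scale[OF that(1), of "of_real ?c"]]) simp
  qed
  have "v0 \<in> W" using v0 by (simp add: W_def)
  then have "S \<noteq> {}" using normalize[OF _ ne] unfolding S_def by blast
  have bdd: "bdd_below S"
    by (rule bdd_belowI[of _ 0]) (use a.nonneg W_V in \<open>auto simp: S_def\<close>)
  have m_le: "m \<le> Re (a f f)" if "f \<in> W" "Re (b f f) = 1" for f
    unfolding m_def by (rule cInf_lower[OF _ bdd]) (use that in \<open>auto simp: S_def\<close>)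
  have m_nonneg: "0 \<le> m"
    unfolding m_def by (rule cInf_greatest[OF \<open>S \<noteq> {}\<close>]) (use a.nonneg W_V in \<open>auto simp: S_def\<close>)
  have rayleigh: "m * Re (b f f) \<le> Re (a f f)" if f: "f \<in> W" for f
  proof (cases "Re (b f f) = 0")
    case False
    then have pos: "Re (b f f) > 0" using b.nonneg[OF W_V[OF f]] by simp
    obtain g where "g \<in> W" "Re (b g g) = 1" "Re (a g g) = Re (a f f) / Re (b f f)"
      using normalize[OF f False] by blast
    then have "m \<le> Re (a f f) / Re (b f f)" using m_le by metis
    with pos show ?thesis by (simp add: field_simps)
  qed (use a.nonneg[OF W_V[OF f]] in simp)
  have "\<exists>f. f \<in> W \<and> Re (b f f) = 1 \<and> Re (a f f) < m + inverse (real (Suc n))" for n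
  proof -
    have "Inf S < m + inverse (real (Suc n))" by (simp add: m_def)
    from cInf_lessD[OF \<open>S \<noteq> {}\<close> this] show ?thesis by (auto simp: S_def)
  qed
  then obtain f where f: "\<And>n. f n \<in> W" "\<And>n. Re (b (f n) (f n)) = 1"
    "\<And>n. Re (a (f n) (f n)) < m + inverse (real (Suc n))"
    by metis
  have inv1: "inverse (real (Suc n)) \<le> 1" for n by (simp add: field_simps)
  have fV: "f n \<in> V" for n by (rule W_V[OF f(1)])
  have fb: "Re (b (f n) (f n)) \<le> m + 1" "Re (a (f n) (f n)) \<le> m + 1" for n
    using f(2)[of n] f(3)[of n] inv1[of n] m_nonneg by linarith+
  obtain r :: "nat \<Rightarrow> nat" where r: "strict_mono r" "\<forall>e>0. \<exists>N. \<forall>k\<ge>N. \<forall>n\<ge>N.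
      Re (b (\<lambda>x. f (r k) x - f (r n) x) (\<lambda>x. f (r k) x - f (r n) x)) < e"
    using compact[of f, OF fV fb] by blast
  let ?db = "\<lambda>k n. Re (b (\<lambda>x. f k x - f n x) (\<lambda>x. f k x - f n x))"
  let ?da = "\<lambda>k n. Re (a (\<lambda>x. f k x - f n x) (\<lambda>x. f k x - f n x))"
  \<comment> \<open>The sum of two members of the minimising sequence has energy at least m times
    its squared norm. The parallelogram law then bounds the energy of the difference by the excess
    of the two energies over m plus m times the squared distance, so b-convergence upgrades to
    convergence in energy.\<close>
  have da: "?da k n \<le> 2 * inverse (real (Suc k)) + 2 * inverse (real (Suc n)) + m * ?db k n" for k n
  proof -
    have "(\<lambda>x. f k x + f n x) \<in> W" using W_lin[OF f(1) f(1), of k 1 n] by simp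
    moreover have "Re (b (\<lambda>x. f k x + f n x) (\<lambda>x. f k x + f n x)) = 4 - ?db k n"
      using b.parallelogram[OF fV fV, of k n] f(2)[of k] f(2)[of n] by simp
    ultimately have "m * (4 - ?db k n) \<le> Re (a (\<lambda>x. f k x + f n x) (\<lambda>x. f k x + f n x))"
      using rayleigh by metis
    then show ?thesis
      using a.parallelogram[OF fV fV, of k n] f(3)[of k] f(3)[of n] by (simp add: algebra_simps)
  qed
  have "\<exists>N. \<forall>k\<ge>N. \<forall>n\<ge>N. ?db (r k) (r n) + ?da (r k) (r n) < e" if epos: "e > 0" for e
  proof -
    \<comment> \<open>The b-distance is counted 1 + m times, once itself and m times through
      \<open>da\<close>; together this uses up e / 2.\<close>
    obtain N1 where N1: "\<And>k n. k \<ge> N1 \<Longrightarrow> n \<ge> N1 \<Longrightarrow> ?db (r k) (r n) < e / (2 * (1 + m))"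
      using r(2)[rule_format, of "e / (2 * (1 + m))"] epos m_nonneg by auto
    obtain N2 where N2: "inverse (real (Suc N2)) < e / 8"
      using reals_Archimedean[of "e / 8"] epos by auto
    have small: "inverse (real (Suc (r k))) < e / 8" if "k \<ge> N2" for k
    proof -
      have "N2 \<le> r k" using seq_suble[OF r(1), of k] that by simp
      then have "inverse (real (Suc (r k))) \<le> inverse (real (Suc N2))" by (intro le_imp_inverse_le) simp_all
      with N2 show ?thesis by linarith
    qed
    show ?thesis
    proof (intro exI allI impI)
      fix k n assume "max N1 N2 \<le> k" "max N1 N2 \<le> n"
      then have "(1 + m) * ?db (r k) (r n) < e / 2"
        using N1[of k n] m_nonneg by (simp add: field_simps)
      moreover have "?da (r k) (r n) < e / 2 + m * ?db (r k) (r n)"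
        using da[of "r k" "r n"] small[of k] small[of n] \<open>max N1 N2 \<le> k\<close> \<open>max N1 N2 \<le> n\<close> by simp
      ultimately show "?db (r k) (r n) + ?da (r k) (r n) < e"
        by (simp add: algebra_simps)
    qed
  qed
  then obtain w where w: "w \<in> V"
    "(\<lambda>n. Re (b (\<lambda>x. f (r n) x - w x) (\<lambda>x. f (r n) x - w x))) \<longlonglongrightarrow> 0"
    "(\<lambda>n. Re (a (\<lambda>x. f (r n) x - w x) (\<lambda>x. f (r n) x - w x))) \<longlonglongrightarrow> 0"
    using complete[of "\<lambda>n. f (r n)", OF fV] by blast
  have wW: "w \<in> W"
  proof -
    have "b w (u j) = 0" for j
      using b.tendsto_left[OF fV w(1) u_in w(2), of j] f(1) by (simp add: W_def LIMSEQ_const_iff)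
    with w(1) show ?thesis by (simp add: W_def)
  qed
  have bw: "Re (b w w) = 1"
    using b.tendsto_self[OF fV w(1,2)] f(2) by (simp add: LIMSEQ_const_iff)
  have "Re (a w w) \<le> m + 0"
  proof (rule LIMSEQ_le[OF a.tendsto_self[OF fV w(1,3)]])
    show "(\<lambda>n. m + inverse (real (Suc (r n)))) \<longlonglongrightarrow> m + 0"
      by (intro tendsto_add tendsto_const LIMSEQ_subseq_LIMSEQ[OF LIMSEQ_inverse_real_of_nat r(1), unfolded o_def])
  qed (use f(3) in \<open>blast intro: less_imp_le\<close>)
  then have aw: "Re (a w w) = m" using m_le[OF wW bw] by simp
  \<comment> \<open>The Rayleigh bound makes a - m b semidefinite on W, and \<open>w\<close> is null
    for it. Cauchy-Schwarz then gives the Euler-Lagrange equation of the minimiser without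
    differentiating.\<close>
  interpret c: semi_inner W "\<lambda>f g. a f g - of_real m * b f g"
  proof
    fix f g h c assume "f \<in> W" "g \<in> W" "h \<in> W"
    then show "a (\<lambda>x. f x + c * g x) h - of_real m * b (\<lambda>x. f x + c * g x) h
        = a f h - of_real m * b f h + c * (a g h - of_real m * b g h)"
      by (simp add: a.add_left b.add_left W_V algebra_simps)
  next
    fix f g assume "f \<in> W" "g \<in> W"
    then show "a g f - of_real m * b g f = cnj (a f g - of_real m * b f g)"
      using a.herm[OF W_V W_V, of f g] b.herm[OF W_V W_V, of f g] by simp
  next
    fix f assume "f \<in> W"
    then show "0 \<le> Re (a f f - of_real m * b f f)"
      using rayleigh by simp
  qed (rule W_lin)
  have eigW: "a w v = of_real m * b w v" if "v \<in> W" for v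
    using c.Cauchy_Schwarz[OF wW that] aw bw by simp
  \<comment> \<open>The equation must hold against all of V. Replacing v by the limit v' of its
    residuals, which lies in W, changes neither side, because \<open>w\<close> is orthogonal to
    every \<open>u j\<close> in both forms.\<close>
  have "a w v = of_real m * b w v" if v: "v \<in> V" for v
  proof -
    obtain v' where v': "v' \<in> V" "\<And>j. b v' (u j) = 0"
      "(\<lambda>N. Re (b (\<lambda>x. b.resid u N v x - v' x) (\<lambda>x. b.resid u N v x - v' x))) \<longlonglongrightarrow> 0"
      "(\<lambda>N. Re (a (\<lambda>x. b.resid u N v x - v' x) (\<lambda>x. b.resid u N v x - v' x))) \<longlonglongrightarrow> 0"
      using resid_limit[OF v] by blast
    have p: "b.resid u N v \<in> V" for N by (rule resid_in[OF v])
    have wu: "b w (u j) = 0" "a w (u j) = 0" for j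
      using wW eigen_right[OF w(1), of j] by (simp_all add: W_def)
    have "b w (b.resid u N v) = b w v \<and> a w (b.resid u N v) = a w v" for N
    proof (induction N)
      case (Suc N)
      then show ?case
        unfolding b.resid_Suc b.add_right[OF p u_in w(1)] a.add_right[OF p u_in w(1)] by (simp add: wu)
    qed (simp add: b.resid_0)
    then have "a w v = a w v'" "b w v = b w v'"
      using a.tendsto_right[OF p v'(1) w(1) v'(4)] b.tendsto_right[OF p v'(1) w(1) v'(3)]
      by (simp_all add: LIMSEQ_const_iff)
    moreover have "v' \<in> W" using v' by (simp add: W_def)
    ultimately show ?thesis using eigW by simp
  qed
  moreover have "b w (u j) = 0" for j using wW by (simp add: W_def)
  ultimately have "Re (b w w) = 0" using exhaustive[OF w(1)] by blast
  with bw show False by simp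
qed

text \<open>The residuals converge to a vector orthogonal to every \<open>u j\<close>, which has
  norm 0 by \<open>orthogonal_complement_trivial\<close>; the squared norm of a residual is exactly
  the defect in Bessel's inequality.\<close>

theorem Parseval:
  assumes v: "v \<in> V"
  shows "(\<lambda>j. (norm (b v (u j)))\<^sup>2) sums Re (b v v)"
proof -
  obtain w where w: "w \<in> V" "\<And>j. b w (u j) = 0"
    "(\<lambda>N. Re (b (\<lambda>x. b.resid u N v x - w x) (\<lambda>x. b.resid u N v x - w x))) \<longlonglongrightarrow> 0"
    using resid_limit[OF v] by blast
  have "(\<lambda>N. Re (b (b.resid u N v) (b.resid u N v))) \<longlonglongrightarrow> Re (b w w)"
    by (rule b.tendsto_self[OF resid_in[OF v] w(1,3)])
  then have "(\<lambda>N. Re (b v v) - (\<Sum>j<N. (norm (b v (u j)))\<^sup>2)) \<longlonglongrightarrow> 0"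
    unfolding resid_norm[OF v] using orthogonal_complement_trivial[OF w(1,2)] by simp
  from tendsto_diff[OF tendsto_const[of "Re (b v v)"] this]
  show ?thesis by (simp add: sums_def)
qed

end

text \<open>Gaussian elimination by induction on the equations: one equation is solved for a pivot
  unknown, which leaves one equation and one unknown fewer. It serves to count dimensions in an
  eigenspace, where vectors are equal only almost everywhere.\<close>

lemma homogeneous_system_nontrivial_solution:
  fixes A :: "'k \<Rightarrow> 'i \<Rightarrow> 'a::field"
  assumes "finite I" "finite K" "card I < card K"
  shows "\<exists>\<alpha>. (\<exists>k\<in>K. \<alpha> k \<noteq> 0) \<and> (\<forall>i\<in>I. (\<Sum>k\<in>K. \<alpha> k * A k i) = 0)"
  using assms
proof (induction I arbitrary: K A rule: finite_induct)
  case empty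
  then have "K \<noteq> {}" by auto
  then show ?case by (intro exI[of _ "\<lambda>_. 1"]) auto
next
  case (insert i0 I)
  show ?case
  proof (cases "\<forall>k\<in>K. A k i0 = 0")
    case True
    have "card I < card K" using insert by simp
    from insert.IH[OF insert.prems(1) this, of A] True show ?thesis by auto
  next
    case False
    then obtain p where p: "p \<in> K" "A p i0 \<noteq> 0" by blast
    define K' where "K' = K - {p}"
    have K': "finite K'" "card I < card K'" "p \<notin> K'" "K = insert p K'"
      using insert p by (auto simp: K'_def card_Diff_singleton)
    obtain \<alpha> where \<alpha>: "\<exists>k\<in>K'. \<alpha> k \<noteq> 0"
      "\<And>i. i \<in> I \<Longrightarrow> (\<Sum>k\<in>K'. \<alpha> k * (A k i - A k i0 / A p i0 * A p i)) = 0"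
      using insert.IH[OF K'(1,2), of "\<lambda>k i. A k i - A k i0 / A p i0 * A p i"] by blast
    \<comment> \<open>The value at the pivot solves equation \<open>i0\<close>; in the remaining
      equations it reproduces the eliminated coefficients.\<close>
    define \<beta> where "\<beta> = \<alpha>(p := - (\<Sum>k\<in>K'. \<alpha> k * (A k i0 / A p i0)))"
    have sum: "(\<Sum>k\<in>K. \<beta> k * A k i) = (\<Sum>k\<in>K'. \<alpha> k * (A k i - A k i0 / A p i0 * A p i))" for i
    proof -
      have "(\<Sum>k\<in>K. \<beta> k * A k i) = \<beta> p * A p i + (\<Sum>k\<in>K'. \<beta> k * A k i)"
        using K' by simp
      also have "(\<Sum>k\<in>K'. \<beta> k * A k i) = (\<Sum>k\<in>K'. \<alpha> k * A k i)"
        using K'(3) by (intro sum.cong) (auto simp: \<beta>_def)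
      also have "\<beta> p * A p i = - (\<Sum>k\<in>K'. \<alpha> k * (A k i0 / A p i0 * A p i))"
        by (simp add: \<beta>_def sum_distrib_right mult.assoc)
      finally show ?thesis by (simp add: sum_subtractf right_diff_distrib)
    qed
    have "\<exists>k\<in>K. \<beta> k \<noteq> 0" using \<alpha>(1) K'(3,4) by (auto simp: \<beta>_def)
    moreover have "(\<Sum>k\<in>K. \<beta> k * A k i0) = 0" unfolding sum using p(2) by simp
    ultimately show ?thesis using sum \<alpha>(2) by (intro exI[of _ \<beta>]) auto
  qed
qed

subsection \<open>Compactness of the Dirichlet form\<close>

lemma L2_inner_commute: "L2_inner \<Omega> g f = cnj (L2_inner \<Omega> f g)"
  unfolding L2_inner_def Bochner_Integration.integral_cnj[symmetric] by (simp add: mult.commute)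

lemma L2_inner_add_left:
  assumes "f \<in> L2 \<Omega>" "g \<in> L2 \<Omega>" "h \<in> L2 \<Omega>"
  shows "L2_inner \<Omega> (\<lambda>x. f x + c * g x) h = L2_inner \<Omega> f h + c * L2_inner \<Omega> g h"
proof -
  have "L2_inner \<Omega> (\<lambda>x. f x + c * g x) h = (LINT x|lebesgue_on \<Omega>. f x * cnj (h x) + c * (g x * cnj (h x)))"
    by (simp add: L2_inner_def distrib_right mult.assoc)
  also have "\<dots> = L2_inner \<Omega> f h + c * L2_inner \<Omega> g h"
    using L2_mult_integrable[OF assms(1) L2_cnj[OF assms(3)]] L2_mult_integrable[OF assms(2) L2_cnj[OF assms(3)]]
    by (simp add: L2_inner_def)
  finally show ?thesis .
qed

lemma grad_inner_commute: "grad_inner \<Omega> h g = cnj (grad_inner \<Omega> g h)"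
  unfolding grad_inner_def cnj_sum by (intro sum.cong refl L2_inner_commute)

lemma grad_inner_add_left:
  assumes "f \<in> L2 \<Omega>" "g \<in> L2 \<Omega>" "h \<in> L2 \<Omega>"
  shows "grad_inner \<Omega> (\<lambda>x. \<chi> i. f x $ i + c * g x $ i) h = grad_inner \<Omega> f h + c * grad_inner \<Omega> g h"
  using assms by (simp add: grad_inner_def L2_inner_add_left L2_vec_nth sum.distrib sum_distrib_left)

interpretation L2: semi_inner "L2 \<Omega>" "L2_inner \<Omega>" for \<Omega> :: "(real ^ 'n) set"
proof
  fix f g :: "real ^ 'n \<Rightarrow> complex" and c assume "f \<in> L2 \<Omega>" "g \<in> L2 \<Omega>"
  then show "(\<lambda>x. f x + c * g x) \<in> L2 \<Omega>" by (intro L2_add L2_scale)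
next
  fix f :: "real ^ 'n \<Rightarrow> complex"
  show "0 \<le> Re (L2_inner \<Omega> f f)" by (simp add: L2_inner_self del: of_real_power)
qed (rule L2_inner_add_left L2_inner_commute; assumption?)+

lemma norm_plane_wave_diff: "norm (plane_wave \<xi> x - plane_wave \<eta> x) \<le> norm (\<xi> - \<eta>) * norm x"
proof -
  have "plane_wave \<xi> x - plane_wave \<eta> x = plane_wave \<eta> x * (exp (\<i> * of_real ((\<xi> - \<eta>) \<bullet> x)) - 1)"
    by (simp add: plane_wave_def inner_diff_left algebra_simps flip: exp_add)
  then have "norm (plane_wave \<xi> x - plane_wave \<eta> x) = norm (exp (\<i> * of_real ((\<xi> - \<eta>) \<bullet> x)) - 1)"
    by (simp add: norm_mult)
  also have "\<dots> \<le> \<bar>(\<xi> - \<eta>) \<bullet> x\<bar>"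
    using iexp_approx1[of "(\<xi> - \<eta>) \<bullet> x" 0] by simp
  also have "\<dots> \<le> norm (\<xi> - \<eta>) * norm x"
    by (rule Cauchy_Schwarz_ineq2)
  finally show ?thesis .
qed

context bounded_open
begin

text \<open>Frees the form from the choice in \<open>weak_grad\<close>: explicit gradients, such as
  those of limits and of modulated functions, may be inserted.\<close>

lemma dirichlet_form_h10:
  assumes "h10_grad \<Omega> u g" "h10_grad \<Omega> v h"
  shows "dirichlet_form \<Omega> u v = grad_inner \<Omega> g h"
proof -
  have "g \<in> L2 \<Omega>" "h \<in> L2 \<Omega>" using assms by (simp_all add: h10_grad_def)
  then show ?thesis
    unfolding dirichlet_form_eq_grad_inner
    using h10_grad_weak_grad[OF assms(1)] h10_grad_weak_grad[OF assms(2)] weak_grad_L2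
    by (intro grad_inner_cong_AE) blast+
qed

lemma H10_lincomb:
  assumes "u \<in> H10 \<Omega>" "v \<in> H10 \<Omega>"
  shows "(\<lambda>x. u x + c * v x) \<in> H10 \<Omega>"
  using h10_grad_lincomb[OF H10_imp_h10_grad[OF assms(1)] H10_imp_h10_grad[OF assms(2)]]
  by (rule h10_grad_weak_grad(2))

sublocale H10: semi_inner "H10 \<Omega>" "L2_inner \<Omega>"
  by standard (auto intro: H10_lincomb L2.add_left L2.herm L2.nonneg H10_L2)

sublocale form: semi_inner "H10 \<Omega>" "dirichlet_form \<Omega>"
proof
  fix f g h c assume fgh: "f \<in> H10 \<Omega>" "g \<in> H10 \<Omega>" "h \<in> H10 \<Omega>"
  show "dirichlet_form \<Omega> (\<lambda>x. f x + c * g x) h = dirichlet_form \<Omega> f h + c * dirichlet_form \<Omega> g h"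
    using fgh unfolding dirichlet_form_h10[OF h10_grad_lincomb[OF H10_imp_h10_grad H10_imp_h10_grad] H10_imp_h10_grad, OF fgh]
    by (simp add: grad_inner_add_left weak_grad_L2 dirichlet_form_eq_grad_inner)
next
  fix f assume "f \<in> H10 \<Omega>"
  then show "0 \<le> Re (dirichlet_form \<Omega> f f)"
    by (simp add: dirichlet_form_eq_grad_inner grad_inner_self weak_grad_L2 del: of_real_power)
next
  fix f g show "dirichlet_form \<Omega> g f = cnj (dirichlet_form \<Omega> f g)"
    unfolding dirichlet_form_eq_grad_inner by (rule grad_inner_commute)
qed (rule H10_lincomb)

lemma Re_L2_inner_self: "Re (L2_inner \<Omega> f f) = (L2_norm \<Omega> f)\<^sup>2"
  by (simp add: L2_inner_self del: of_real_power)

lemma Re_dirichlet_form_self: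
  assumes "h10_grad \<Omega> f g"
  shows "Re (dirichlet_form \<Omega> f f) = (L2_norm \<Omega> g)\<^sup>2"
proof -
  have "g \<in> L2 \<Omega>" using assms by (simp add: h10_grad_def)
  then show ?thesis
    unfolding dirichlet_form_h10[OF assms assms] by (simp add: grad_inner_self del: of_real_power)
qed

lemma h10_grad_diff:
  assumes "h10_grad \<Omega> u g" "h10_grad \<Omega> v h"
  shows "h10_grad \<Omega> (\<lambda>x. u x - v x) (\<lambda>x. g x - h x)"
proof -
  have "(\<lambda>x. \<chi> i. g x $ i + (- 1) * h x $ i) = (\<lambda>x. g x - h x)"
    by (simp add: fun_eq_iff vec_eq_iff)
  with h10_grad_lincomb[OF assms, of "-1"] show ?thesis by simp
qed

text \<open>The functions and their gradients are separately Cauchy in L^2, and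
  \<open>h10_grad_closed\<close> says that the pair of limits is again a function with its
  gradient.\<close>

lemma H10_complete:
  fixes f :: "nat \<Rightarrow> real ^ 'n \<Rightarrow> complex"
  assumes f: "\<And>n. f n \<in> H10 \<Omega>"
    and Cauchy: "\<And>e. e > 0 \<Longrightarrow> \<exists>N. \<forall>m\<ge>N. \<forall>n\<ge>N. Re (L2_inner \<Omega> (\<lambda>x. f m x - f n x) (\<lambda>x. f m x - f n x))
        + Re (dirichlet_form \<Omega> (\<lambda>x. f m x - f n x) (\<lambda>x. f m x - f n x)) < e"
  shows "\<exists>g\<in>H10 \<Omega>. (\<lambda>n. Re (L2_inner \<Omega> (\<lambda>x. f n x - g x) (\<lambda>x. f n x - g x))) \<longlonglongrightarrow> 0
        \<and> (\<lambda>n. Re (dirichlet_form \<Omega> (\<lambda>x. f n x - g x) (\<lambda>x. f n x - g x))) \<longlonglongrightarrow> 0"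
proof -
  let ?G = "\<lambda>n. weak_grad \<Omega> (f n)"
  have fG: "h10_grad \<Omega> (f n) (?G n)" for n by (rule H10_imp_h10_grad[OF f])
  have eq: "Re (L2_inner \<Omega> (\<lambda>x. f m x - f n x) (\<lambda>x. f m x - f n x))
      + Re (dirichlet_form \<Omega> (\<lambda>x. f m x - f n x) (\<lambda>x. f m x - f n x))
      = (L2_norm \<Omega> (\<lambda>x. f m x - f n x))\<^sup>2 + (L2_norm \<Omega> (\<lambda>x. ?G m x - ?G n x))\<^sup>2" for m n
    by (simp add: Re_L2_inner_self Re_dirichlet_form_self[OF h10_grad_diff[OF fG fG]])
  have C: "\<exists>N. \<forall>m\<ge>N. \<forall>n\<ge>N. L2_norm \<Omega> (\<lambda>x. f m x - f n x) < e \<and> L2_norm \<Omega> (\<lambda>x. ?G m x - ?G n x) < e"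
    if e: "e > 0" for e
  proof -
    obtain N where N: "\<And>m n. m \<ge> N \<Longrightarrow> n \<ge> N \<Longrightarrow>
        (L2_norm \<Omega> (\<lambda>x. f m x - f n x))\<^sup>2 + (L2_norm \<Omega> (\<lambda>x. ?G m x - ?G n x))\<^sup>2 < e\<^sup>2"
      using Cauchy[of "e\<^sup>2"] e unfolding eq by auto
    have small: "a < e \<and> b < e" if "a\<^sup>2 + b\<^sup>2 < e\<^sup>2" for a b :: real
    proof -
      have "a\<^sup>2 < e\<^sup>2" "b\<^sup>2 < e\<^sup>2" using that zero_le_power2[of a] zero_le_power2[of b] by linarith+
      then show ?thesis using e power2_less_imp_less by fastforce
    qed
    show ?thesis using small[OF N] by blast
  qed
  have C1: "\<exists>N. \<forall>m\<ge>N. \<forall>n\<ge>N. L2_norm \<Omega> (\<lambda>x. f m x - f n x) < e"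
    and C2: "\<exists>N. \<forall>m\<ge>N. \<forall>n\<ge>N. L2_norm \<Omega> (\<lambda>x. ?G m x - ?G n x) < e" if "e > 0" for e
    using C[OF that] by meson+
  obtain v where v: "v \<in> L2 \<Omega>" "(\<lambda>n. L2_norm \<Omega> (\<lambda>x. f n x - v x)) \<longlonglongrightarrow> 0"
    using L2_complete[OF H10_L2[OF f] C1] by blast
  obtain h where h: "h \<in> L2 \<Omega>" "(\<lambda>n. L2_norm \<Omega> (\<lambda>x. ?G n x - h x)) \<longlonglongrightarrow> 0"
    using L2_complete[of ?G, OF weak_grad_L2[OF f] C2] by blast
  have vh: "h10_grad \<Omega> v h"
    by (rule h10_grad_closed[OF fG v(1) h(1) v(2) h(2)])
  have "(\<lambda>n. (L2_norm \<Omega> (\<lambda>x. f n x - v x))\<^sup>2) \<longlonglongrightarrow> 0\<^sup>2" "(\<lambda>n. (L2_norm \<Omega> (\<lambda>x. ?G n x - h x))\<^sup>2) \<longlonglongrightarrow> 0\<^sup>2"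
    by (intro tendsto_power v h)+
  then show ?thesis
    using h10_grad_weak_grad(2)[OF vh]
    by (intro bexI[of _ v]) (simp_all add: Re_L2_inner_self Re_dirichlet_form_self[OF h10_grad_diff[OF fG vh]])
qed

text \<open>On a set of radius R a plane wave changes by at most R |\<xi> - \<eta>| when the
  frequency changes. The transforms of an L^2-bounded family are therefore equicontinuous.\<close>

lemma fourier_lipschitz:
  assumes f: "f \<in> L2 \<Omega>" and R: "\<And>x. x \<in> \<Omega> \<Longrightarrow> norm x \<le> R"
  shows "norm (L2_inner \<Omega> f (plane_wave \<xi>) - L2_inner \<Omega> f (plane_wave \<eta>))
    \<le> R * norm (\<xi> - \<eta>) * (L2_norm \<Omega> f * sqrt (measure lebesgue \<Omega>))"
proof -
  have int: "integrable (lebesgue_on \<Omega>) (\<lambda>x. f x * cnj (plane_wave \<xi> x))" for \<xi>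
    by (intro L2_mult_integrable f L2_cnj plane_wave_L2)
  have "norm (L2_inner \<Omega> f (plane_wave \<xi>) - L2_inner \<Omega> f (plane_wave \<eta>))
      = norm (LINT x|lebesgue_on \<Omega>. f x * cnj (plane_wave \<xi> x) - f x * cnj (plane_wave \<eta> x))"
    unfolding L2_inner_def by (simp add: int)
  also have "\<dots> \<le> (LINT x|lebesgue_on \<Omega>. norm (f x * cnj (plane_wave \<xi> x) - f x * cnj (plane_wave \<eta> x)))"
    by (rule integral_norm_bound)
  also have "\<dots> \<le> (LINT x|lebesgue_on \<Omega>. R * norm (\<xi> - \<eta>) * norm (f x))"
  proof (rule integral_mono)
    show "integrable (lebesgue_on \<Omega>) (\<lambda>x. norm (f x * cnj (plane_wave \<xi> x) - f x * cnj (plane_wave \<eta> x)))"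
      by (intro integrable_norm Bochner_Integration.integrable_diff int)
    show "integrable (lebesgue_on \<Omega>) (\<lambda>x. R * norm (\<xi> - \<eta>) * norm (f x))"
      by (intro integrable_mult_right integrable_norm L2_integrable1 f)
    fix x assume "x \<in> space (lebesgue_on \<Omega>)"
    then have "norm x \<le> R" using R by (simp add: space_restrict_space)
    have "norm (f x * cnj (plane_wave \<xi> x) - f x * cnj (plane_wave \<eta> x)) = norm (f x) * norm (plane_wave \<xi> x - plane_wave \<eta> x)"
      by (simp flip: right_diff_distrib complex_cnj_diff add: norm_mult)
    also have "\<dots> \<le> norm (f x) * (norm (\<xi> - \<eta>) * R)"
      using \<open>norm x \<le> R\<close>
      by (intro mult_left_mono order.trans[OF norm_plane_wave_diff] mult_left_mono) auto
    finally show "norm (f x * cnj (plane_wave \<xi> x) - f x * cnj (plane_wave \<eta> x)) \<le> R * norm (\<xi> - \<eta>) * norm (f x)"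
      by (simp add: mult_ac)
  qed
  also have "\<dots> = R * norm (\<xi> - \<eta>) * (LINT x|lebesgue_on \<Omega>. norm (f x))"
    by simp
  \<comment> \<open>The bound \<open>R\<close> may be negative if \<Omega> is empty, but then both
    integrals vanish.\<close>
  also have "\<dots> \<le> R * norm (\<xi> - \<eta>) * (L2_norm \<Omega> f * sqrt (measure lebesgue \<Omega>))"
  proof (cases "\<Omega> = {}")
    case True
    then show ?thesis by (simp add: integral_restrict_space L2_norm_def)
  next
    case False
    then obtain x where "x \<in> \<Omega>" by blast
    then have "0 \<le> R" using R[of x] norm_ge_zero order_trans by blast
    then show ?thesis by (intro mult_left_mono L1_norm_le f) simp
  qed
  finally show ?thesis .
qed

text \<open>The Arzela-Ascoli argument: a diagonal subsequence converges on a countable dense set of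
  frequencies, and the common Lipschitz constant extends the Cauchy property to all
  frequencies.\<close>

lemma fourier_subsequence:
  fixes f :: "nat \<Rightarrow> real ^ 'n \<Rightarrow> complex"
  assumes f: "\<And>n. f n \<in> L2 \<Omega>" and C: "\<And>n. L2_norm \<Omega> (f n) \<le> C"
  shows "\<exists>r :: nat \<Rightarrow> nat. strict_mono r \<and> (\<forall>\<xi>. convergent (\<lambda>n. L2_inner \<Omega> (f (r n)) (plane_wave \<xi>)))"
proof -
  let ?F = "\<lambda>n \<xi>. L2_inner \<Omega> (f n) (plane_wave \<xi>)"
  let ?s = "sqrt (measure lebesgue \<Omega>)"
  obtain D :: "(real^'n) set" where D: "countable D" "\<And>X. open X \<Longrightarrow> X \<noteq> {} \<Longrightarrow> \<exists>d\<in>D. d \<in> X"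
    using countable_dense_exists by blast
  have bound: "norm (?F n \<xi>) \<le> C * ?s" for n \<xi>
    by (rule order.trans[OF fourier_bound[OF f] mult_right_mono[OF C]]) simp
  obtain r where r: "strict_mono (r :: nat \<Rightarrow> nat)" "\<And>\<xi>. \<xi> \<in> D \<Longrightarrow> \<exists>l. (\<lambda>n. ?F (r n) \<xi>) \<longlonglongrightarrow> l"
    using function_convergent_subsequence[OF D(1), of ?F "C * ?s"] bound by blast
  obtain R0 where "\<forall>x\<in>\<Omega>. norm x \<le> R0"
    using bounded_dom bounded_iff by metis
  then have R: "norm x \<le> max 1 R0" if "x \<in> \<Omega>" for x using that by fastforce
  \<comment> \<open>The additional 1 makes the Lipschitz constant positive, so that the radius e /
    (3 L) is meaningful.\<close>
  define L where "L = max 1 R0 * (\<bar>C\<bar> * ?s) + 1"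
  have L: "L > 0" unfolding L_def by (intro add_nonneg_pos) auto
  have lip: "norm (?F n \<xi> - ?F n \<eta>) \<le> L * norm (\<xi> - \<eta>)" for n \<xi> \<eta>
  proof -
    have "norm (?F n \<xi> - ?F n \<eta>) \<le> max 1 R0 * norm (\<xi> - \<eta>) * (L2_norm \<Omega> (f n) * ?s)"
      by (rule fourier_lipschitz[OF f R])
    also have "\<dots> \<le> max 1 R0 * norm (\<xi> - \<eta>) * (\<bar>C\<bar> * ?s)"
      using C[of n] by (intro mult_left_mono mult_right_mono) auto
    also have "\<dots> \<le> L * norm (\<xi> - \<eta>)" by (simp add: L_def algebra_simps)
    finally show ?thesis .
  qed
  have "Cauchy (\<lambda>n. ?F (r n) \<xi>)" for \<xi>
  proof (rule metric_CauchyI)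
    fix e :: real assume e: "e > 0"
    obtain d where d: "d \<in> D" "d \<in> ball \<xi> (e / (3 * L))"
      using D(2)[OF open_ball, of \<xi> "e / (3 * L)"] e L by (metis centre_in_ball divide_pos_pos empty_iff mult_pos_pos zero_less_numeral)
    have near: "norm (?F n \<xi> - ?F n d) < e / 3" for n
    proof -
      have "L * norm (\<xi> - d) < L * (e / (3 * L))"
        using d(2) L by (intro mult_strict_left_mono) (simp_all add: dist_norm)
      also have "\<dots> = e / 3" using L by simp
      finally show ?thesis using lip[of n \<xi> d] by linarith
    qed
    have "Cauchy (\<lambda>n. ?F (r n) d)"
      using r(2)[OF d(1)] convergent_Cauchy convergent_def by blast
    then obtain M where M: "\<And>m n. m \<ge> M \<Longrightarrow> n \<ge> M \<Longrightarrow> norm (?F (r m) d - ?F (r n) d) < e / 3"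
      using e unfolding Cauchy_iff by (metis divide_pos_pos zero_less_numeral)
    show "\<exists>M. \<forall>m\<ge>M. \<forall>n\<ge>M. dist (?F (r m) \<xi>) (?F (r n) \<xi>) < e"
    proof (intro exI allI impI)
      fix m n assume "m \<ge> M" "n \<ge> M"
      have "?F (r m) \<xi> - ?F (r n) \<xi> = (?F (r m) \<xi> - ?F (r m) d) + (?F (r m) d - ?F (r n) d) - (?F (r n) \<xi> - ?F (r n) d)"
        by simp
      then have "norm (?F (r m) \<xi> - ?F (r n) \<xi>)
          \<le> norm (?F (r m) \<xi> - ?F (r m) d) + norm (?F (r m) d - ?F (r n) d) + norm (?F (r n) \<xi> - ?F (r n) d)"
        by (metis norm_triangle_ineq norm_triangle_ineq4 add_right_mono order_trans)
      then show "dist (?F (r m) \<xi>) (?F (r n) \<xi>) < e"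
        using near[of "r m"] near[of "r n"] M[OF \<open>m \<ge> M\<close> \<open>n \<ge> M\<close>] unfolding dist_norm by linarith
    qed
  qed
  with r(1) show ?thesis by (auto simp: Cauchy_convergent_iff)
qed

text \<open>Pointwise convergence of the Fourier transforms controls the low frequencies, and
  \<open>fourier_energy_ge\<close> the high ones.\<close>

theorem Rellich:
  fixes f :: "nat \<Rightarrow> real ^ 'n \<Rightarrow> complex"
  assumes f: "\<And>n. f n \<in> H10 \<Omega>"
    and C: "\<And>n. Re (L2_inner \<Omega> (f n) (f n)) \<le> C" "\<And>n. Re (dirichlet_form \<Omega> (f n) (f n)) \<le> C"
  shows "\<exists>r. strict_mono (r :: nat \<Rightarrow> nat) \<and> (\<forall>e>0. \<exists>N. \<forall>m\<ge>N. \<forall>n\<ge>N.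
    Re (L2_inner \<Omega> (\<lambda>x. f (r m) x - f (r n) x) (\<lambda>x. f (r m) x - f (r n) x)) < e)"
proof -
  let ?P = "(4 * pi\<^sup>2) powr (real CARD('n) / 2)" and ?Q = "(8 * pi\<^sup>2) powr (real CARD('n) / 2)"
  have L2: "f n \<in> L2 \<Omega>" for n by (rule H10_L2[OF f])
  have nf: "L2_norm \<Omega> (f n) \<le> sqrt C" for n
    using C(1)[of n] by (intro real_le_rsqrt) (simp add: Re_L2_inner_self)
  obtain r :: "nat \<Rightarrow> nat" where r: "strict_mono r" "\<And>\<xi>. convergent (\<lambda>n. L2_inner \<Omega> (f (r n)) (plane_wave \<xi>))"
    using fourier_subsequence[of f, OF L2 nf] by blast
  have "\<exists>N. \<forall>m\<ge>N. \<forall>n\<ge>N. Re (L2_inner \<Omega> (\<lambda>x. f (r m) x - f (r n) x) (\<lambda>x. f (r m) x - f (r n) x)) < e"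
    if e: "e > 0" for e
  proof (rule ccontr)
    assume "\<not> ?thesis"
    then have "\<forall>N. \<exists>m n. m \<ge> N \<and> n \<ge> N \<and>
        e \<le> Re (L2_inner \<Omega> (\<lambda>x. f (r m) x - f (r n) x) (\<lambda>x. f (r m) x - f (r n) x))"
      by (meson not_less)
    then obtain \<mu> \<nu> where \<mu>\<nu>: "\<And>N. \<mu> N \<ge> N" "\<And>N. \<nu> N \<ge> N"
      "\<And>N. e \<le> Re (L2_inner \<Omega> (\<lambda>x. f (r (\<mu> N)) x - f (r (\<nu> N)) x) (\<lambda>x. f (r (\<mu> N)) x - f (r (\<nu> N)) x))"
      by metis
    \<comment> \<open>A failure of the Cauchy property provides differences with squared norm at
      least e whose transforms nevertheless tend to 0 pointwise, since both indices tend to infinity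
      along a subsequence with convergent transforms.\<close>
    define h where "h N x = f (r (\<mu> N)) x - f (r (\<nu> N)) x" for N x
    have hH: "h N \<in> H10 \<Omega>" for N unfolding h_def by (intro H10.diff_in f)
    have h_form: "Re (dirichlet_form \<Omega> (h N) (h N)) \<le> 4 * C" for N
      using form.parallelogram[OF f f, of "r (\<mu> N)" "r (\<nu> N)"] C(2)[of "r (\<mu> N)"] C(2)[of "r (\<nu> N)"]
        form.nonneg[OF H10.lincomb[OF f f], of "r (\<mu> N)" 1 "r (\<nu> N)"]
      unfolding h_def by simp
    have h_norm: "L2_norm \<Omega> (h N) \<le> 2 * sqrt C" for N
    proof -
      have "L2_norm \<Omega> (h N) \<le> L2_norm \<Omega> (f (r (\<mu> N))) + L2_norm \<Omega> (f (r (\<nu> N)))"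
        using L2_norm_triangle[OF L2 L2_minus[OF L2], of "r (\<mu> N)" "r (\<nu> N)"] L2_norm_minus[of \<Omega> "f (r (\<nu> N))"]
        unfolding h_def by simp
      then show ?thesis using nf[of "r (\<mu> N)"] nf[of "r (\<nu> N)"] by linarith
    qed
    have "0 \<le> C" using H10.nonneg[OF f, of 0] C(1)[of 0] by linarith
    \<comment> \<open>Chosen so that the gradient term 4 a Q (4 (C + 1)) is exactly half of P e; the
      weighted Fourier energy of each \<open>h N\<close> then stays above the other half. Using C +
      1 keeps the denominator positive.\<close>
    define a where "a = ?P * e / (32 * ?Q * (C + 1))"
    have a: "a > 0" unfolding a_def using e \<open>0 \<le> C\<close> by (intro divide_pos_pos mult_pos_pos) auto
    have lim: "(\<lambda>N. L2_inner \<Omega> (h N) (plane_wave \<xi>)) \<longlonglongrightarrow> L2_inner \<Omega> (\<lambda>x. 0) (plane_wave \<xi>)" for \<xi>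
    proof -
      obtain l where l: "(\<lambda>n. L2_inner \<Omega> (f (r n)) (plane_wave \<xi>)) \<longlonglongrightarrow> l"
        using r(2) unfolding convergent_def by blast
      have "filterlim \<mu> at_top sequentially" "filterlim \<nu> at_top sequentially"
        by (rule filterlim_at_top_mono[OF filterlim_ident]; simp add: \<mu>\<nu>)+
      then have "(\<lambda>N. L2_inner \<Omega> (f (r (\<mu> N))) (plane_wave \<xi>) - L2_inner \<Omega> (f (r (\<nu> N))) (plane_wave \<xi>)) \<longlonglongrightarrow> l - l"
        by (intro tendsto_diff filterlim_compose[OF l])
      then show ?thesis
        unfolding h_def by (simp add: L2.diff_left L2 plane_wave_L2) (simp add: L2_inner_def)
    qed
    have "(\<lambda>N. fourier_energy a (h N)) \<longlonglongrightarrow> fourier_energy a (\<lambda>x. 0)"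
      by (rule fourier_energy_tendsto[OF a H10_L2[OF hH] _ h_norm lim]) (simp add: L2_def)
    then have "(\<lambda>N. fourier_energy a (h N)) \<longlonglongrightarrow> 0"
      by (simp add: fourier_energy_def L2_inner_def)
    moreover have "?P * e / 2 \<le> fourier_energy a (h N)" for N
    proof -
      have hg: "h10_grad \<Omega> (h N) (weak_grad \<Omega> (h N))" by (rule H10_imp_h10_grad[OF hH])
      have "4 * a * ?Q * (L2_norm \<Omega> (weak_grad \<Omega> (h N)))\<^sup>2 \<le> 4 * a * ?Q * (4 * C)"
        using h_form[of N] a unfolding Re_dirichlet_form_self[OF hg] by (intro mult_left_mono) auto
      also have "\<dots> \<le> 4 * a * ?Q * (4 * (C + 1))"
        using a by (intro mult_left_mono) auto
      also have "\<dots> = ?P * e / 2"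
      proof -
        have "32 * ?Q * (C + 1) \<noteq> 0" using \<open>0 \<le> C\<close> by simp
        then have "a * (32 * ?Q * (C + 1)) = ?P * e" unfolding a_def by (rule nonzero_eq_divide_eq[THEN iffD1, OF _ refl])
        then show ?thesis by (simp add: algebra_simps)
      qed
      finally have "4 * a * ?Q * (L2_norm \<Omega> (weak_grad \<Omega> (h N)))\<^sup>2 \<le> ?P * e / 2" .
      moreover have "?P * e \<le> ?P * (L2_norm \<Omega> (h N))\<^sup>2"
        using \<mu>\<nu>(3)[of N] unfolding h_def[symmetric] Re_L2_inner_self by (intro mult_left_mono) auto
      ultimately show ?thesis
        using fourier_energy_ge[OF a hg] by linarith
    qed
    ultimately have "?P * e / 2 \<le> 0"
      by (intro LIMSEQ_le_const) auto
    moreover have "?P * e > 0" using e by (intro mult_pos_pos) auto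
    ultimately show False by linarith
  qed
  with r(1) show ?thesis by blast
qed

end

subsection \<open>Heat trace estimates\<close>

lemma power_over_fact_le_exp:
  fixes x :: real
  assumes "0 \<le> x" shows "x ^ n / fact n \<le> exp x"
proof -
  have "sum (\<lambda>k. x ^ k /\<^sub>R fact k) {n} \<le> (\<Sum>k. x ^ k /\<^sub>R fact k)"
    using assms by (intro sum_le_suminf summable_exp_generic) auto
  then show ?thesis by (simp add: exp_def divide_inverse mult.commute)
qed

text \<open>The tangent of \<open>\<lambda> \<mapsto> exp (- t \<lambda>)\<close> at the mean \<open>E / S\<close> lies below the graph.\<close>

lemma exp_Jensen:
  fixes p lam :: "nat \<Rightarrow> real"
  assumes p: "\<And>j. 0 \<le> p j" "p sums S" "S > 0" and lam: "\<And>j. 0 \<le> lam j"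
    and energy: "summable (\<lambda>j. lam j * p j)" "(\<Sum>j. lam j * p j) \<le> E" and t: "t > 0"
  shows "summable (\<lambda>j. exp (- lam j * t) * p j)" "S * exp (- (E / S) * t) \<le> (\<Sum>j. exp (- lam j * t) * p j)"
proof -
  let ?r = "E / S"
  show s: "summable (\<lambda>j. exp (- lam j * t) * p j)"
    by (rule summable_comparison_test'[OF sums_summable[OF p(2)], of 0])
      (use p lam t in \<open>auto simp: abs_mult intro!: mult_left_le_one_le\<close>)
  let ?T = "\<lambda>j. exp (- ?r * t) * ((1 + ?r * t) * p j - t * (lam j * p j))"
  have T: "?T sums (exp (- ?r * t) * ((1 + ?r * t) * S - t * (\<Sum>j. lam j * p j)))"
    by (intro sums_mult sums_diff p(2) summable_sums energy(1))
  \<comment> \<open>The tangent has negative slope in the eigenvalue, so the upper bound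
    \<open>E\<close> for the energy yields a lower bound here.\<close>
  have "S * exp (- ?r * t) \<le> exp (- ?r * t) * ((1 + ?r * t) * S - t * (\<Sum>j. lam j * p j))"
  proof -
    have "t * (\<Sum>j. lam j * p j) \<le> t * E" using energy(2) t by (intro mult_left_mono) auto
    then have "S \<le> (1 + ?r * t) * S - t * (\<Sum>j. lam j * p j)"
      using p(3) by (simp add: algebra_simps)
    then show ?thesis using mult_left_mono[of S _ "exp (- ?r * t)"] by (simp add: mult.commute)
  qed
  also have "\<dots> = (\<Sum>j. ?T j)"
    by (rule sums_unique[OF T])
  also have "\<dots> \<le> (\<Sum>j. exp (- lam j * t) * p j)"
  proof (rule suminf_le[OF _ sums_summable[OF T] s])
    fix j
    have "1 + (?r - lam j) * t \<le> exp ((?r - lam j) * t)" by (rule exp_ge_add_one_self)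
    then have "exp (- ?r * t) * (1 + (?r - lam j) * t) \<le> exp (- ?r * t) * exp ((?r - lam j) * t)"
      by (intro mult_left_mono) auto
    also have "\<dots> = exp (- lam j * t)"
      unfolding exp_add[symmetric] by (simp add: algebra_simps)
    finally have "exp (- ?r * t) * (1 + (?r - lam j) * t) * p j \<le> exp (- lam j * t) * p j"
      using p(1) by (intro mult_right_mono) auto
    then show "?T j \<le> exp (- lam j * t) * p j"
      by (simp add: algebra_simps)
  qed
  finally show "S * exp (- (E / S) * t) \<le> (\<Sum>j. exp (- lam j * t) * p j)" .
qed

text \<open>\<open>real_of_ereal\<close> sends infinite values to 0, so both have to be excluded:
  the value \<infinity> by membership in \<open>Linf\<close>, and - \<infinity> because it would
  make \<phi> vanish almost everywhere.\<close>

lemma Linf_norm_bound: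
  assumes "\<phi> \<in> Linf \<Omega>" and nz: "\<not> (AE x in lebesgue_on \<Omega>. \<phi> x = 0)"
  shows "AE x in lebesgue_on \<Omega>. \<bar>\<phi> x\<bar> \<le> Linf_norm \<Omega> \<phi>" and "Linf_norm \<Omega> \<phi> > 0"
proof -
  let ?s = "esssup (lebesgue_on \<Omega>) (\<lambda>x. ereal \<bar>\<phi> x\<bar>)"
  have [measurable]: "\<phi> \<in> borel_measurable (lebesgue_on \<Omega>)" and fin: "?s < \<infinity>"
    using assms(1) by (auto simp: Linf_def)
  have ae: "AE x in lebesgue_on \<Omega>. ereal \<bar>\<phi> x\<bar> \<le> ?s"
    by (rule esssup_AE)
  have "?s \<noteq> - \<infinity>"
  proof
    assume "?s = - \<infinity>"
    with ae have "AE x in lebesgue_on \<Omega>. \<phi> x = 0" by (auto elim: eventually_mono)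
    with nz show False by simp
  qed
  with fin have s: "?s = ereal (Linf_norm \<Omega> \<phi>)"
    unfolding Linf_norm_def by (cases ?s) auto
  show bound: "AE x in lebesgue_on \<Omega>. \<bar>\<phi> x\<bar> \<le> Linf_norm \<Omega> \<phi>"
    using ae unfolding s by simp
  show "Linf_norm \<Omega> \<phi> > 0"
  proof (rule ccontr)
    assume "\<not> Linf_norm \<Omega> \<phi> > 0"
    with bound have "AE x in lebesgue_on \<Omega>. \<phi> x = 0" by (auto elim!: eventually_mono)
    with nz show False by simp
  qed
qed

locale dirichlet_spectrum = bounded_open \<Omega> for \<Omega> :: "(real ^ 'n) set" +
  fixes lam :: "nat \<Rightarrow> real" and u :: "nat \<Rightarrow> real ^ 'n \<Rightarrow> complex"
  assumes eigenvalues: "dirichlet_eigenvalues \<Omega> lam"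
    and eigenfunctions: "\<And>j. u j \<in> eigenspace \<Omega> (lam j)"
    and orthonormal: "\<And>i j. L2_inner \<Omega> (u i) (u j) = (if i = j then 1 else 0)"
begin

lemma eigenspace_iff:
  "w \<in> eigenspace \<Omega> \<mu> \<longleftrightarrow> w \<in> H10 \<Omega> \<and> (\<forall>v\<in>H10 \<Omega>. dirichlet_form \<Omega> w v = of_real \<mu> * L2_inner \<Omega> w v)"
  by (auto simp: eigenspace_def dirichlet_laplacian_def L2_scale H10_L2 L2.scale_left)

lemma u_H10: "u j \<in> H10 \<Omega>" and u_L2: "u j \<in> L2 \<Omega>"
  using eigenfunctions[of j] by (auto simp: eigenspace_iff H10_L2)

text \<open>A dimension count: the eigenspace of \<mu> is spanned by as many functions as there are
  indices j with \<open>lam j = \<mu>\<close>, so those \<open>u j\<close> together with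
  \<open>w\<close> are linearly dependent. Pairing the relation with each \<open>u j\<close> kills
  its coefficient; the coefficient of \<open>w\<close> is then nonzero, and pairing with
  \<open>w\<close> gives norm 0. If \<mu> is not an eigenvalue the index set is empty and the
  argument still applies.\<close>

lemma eigenvectors_exhausted:
  assumes w: "w \<in> eigenspace \<Omega> \<mu>" and orth: "\<And>j. L2_inner \<Omega> w (u j) = 0"
  shows "L2_norm \<Omega> w = 0"
proof -
  define J where "J = {j. lam j = \<mu>}"
  have J: "finite J" "has_multiplicity \<Omega> \<mu> (card J)"
    using eigenvalues by (auto simp: dirichlet_eigenvalues_def J_def)
  then obtain b where b: "\<And>v. v \<in> eigenspace \<Omega> \<mu> \<Longrightarrow>
      \<exists>c::nat \<Rightarrow> complex. AE x in lebesgue_on \<Omega>. v x = (\<Sum>i<card J. c i * b i x)"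
    unfolding has_multiplicity_def by blast
  \<comment> \<open>The index type \<open>nat option\<close> adjoins the additional vector
    \<open>w\<close> as \<open>None\<close> to the eigenfunctions.\<close>
  define F where "F k = (case k of None \<Rightarrow> w | Some j \<Rightarrow> u j)" for k
  define K where "K = insert None (Some ` J)"
  have K: "finite K" "card K = Suc (card J)"
    using J(1) by (simp_all add: K_def card_image)
  have F_eig: "F k \<in> eigenspace \<Omega> \<mu>" if "k \<in> K" for k
    using that w eigenfunctions by (auto simp: K_def F_def J_def)
  have F_L2: "F k \<in> L2 \<Omega>" for k
    using w u_L2 by (auto simp: F_def eigenspace_iff H10_L2 split: option.split)
  have "\<forall>k\<in>K. \<exists>c::nat \<Rightarrow> complex. AE x in lebesgue_on \<Omega>. F k x = (\<Sum>i<card J. c i * b i x)"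
    using b[OF F_eig] by blast
  then obtain A :: "nat option \<Rightarrow> nat \<Rightarrow> complex"
    where A: "\<And>k. k \<in> K \<Longrightarrow> AE x in lebesgue_on \<Omega>. F k x = (\<Sum>i<card J. A k i * b i x)"
    by metis
  obtain \<alpha> where \<alpha>: "\<exists>k\<in>K. \<alpha> k \<noteq> 0" "\<And>i. i < card J \<Longrightarrow> (\<Sum>k\<in>K. \<alpha> k * A k i) = 0"
    using homogeneous_system_nontrivial_solution[of "{..<card J}" K A] K by auto
  have "AE x in lebesgue_on \<Omega>. \<forall>k\<in>K. F k x = (\<Sum>i<card J. A k i * b i x)"
    by (subst AE_finite_all[OF K(1)]) (use A in blast)
  then have zero: "AE x in lebesgue_on \<Omega>. (\<Sum>k\<in>K. \<alpha> k * F k x) = 0"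
  proof eventually_elim
    case (elim x)
    have "(\<Sum>k\<in>K. \<alpha> k * F k x) = (\<Sum>k\<in>K. \<Sum>i<card J. \<alpha> k * A k i * b i x)"
      using elim by (intro sum.cong refl) (simp add: sum_distrib_left mult.assoc)
    also have "\<dots> = (\<Sum>i<card J. (\<Sum>k\<in>K. \<alpha> k * A k i) * b i x)"
      by (subst sum.swap) (simp add: sum_distrib_right)
    also have "\<dots> = 0" using \<alpha>(2) by simp
    finally show ?case .
  qed
  have inner: "(\<Sum>k\<in>K. \<alpha> k * L2_inner \<Omega> (F k) h) = 0" if h: "h \<in> L2 \<Omega>" for h
  proof -
    have int: "integrable (lebesgue_on \<Omega>) (\<lambda>x. F k x * cnj (h x))" for k
      by (intro L2_mult_integrable F_L2 L2_cnj h)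
    have "(\<Sum>k\<in>K. \<alpha> k * L2_inner \<Omega> (F k) h) = (LINT x|lebesgue_on \<Omega>. (\<Sum>k\<in>K. \<alpha> k * (F k x * cnj (h x))))"
      unfolding L2_inner_def using int by (subst Bochner_Integration.integral_sum) simp_all
    also have "\<dots> = (LINT x|lebesgue_on \<Omega>. 0)"
    proof (rule integral_cong_AE)
      show "AE x in lebesgue_on \<Omega>. (\<Sum>k\<in>K. \<alpha> k * (F k x * cnj (h x))) = 0"
        using zero by eventually_elim (simp flip: mult.assoc sum_distrib_right)
      show "(\<lambda>x. \<Sum>k\<in>K. \<alpha> k * (F k x * cnj (h x))) \<in> borel_measurable (lebesgue_on \<Omega>)"
        by (intro borel_measurable_sum borel_measurable_times borel_measurable_const borel_measurable_cnj
            L2_borel_measurable F_L2 h)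
    qed simp
    finally show ?thesis by simp
  qed
  have \<alpha>J: "\<alpha> (Some j) = 0" if "j \<in> J" for j
  proof -
    have "(\<Sum>k\<in>K. \<alpha> k * L2_inner \<Omega> (F k) (u j)) = \<alpha> (Some j)"
      using J(1) that by (simp add: K_def F_def sum.reindex orth orthonormal if_distrib[of "(*) _"] sum.delta cong: if_cong)
    with inner[OF u_L2] show ?thesis by simp
  qed
  then have "\<alpha> None \<noteq> 0" using \<alpha>(1) by (auto simp: K_def)
  moreover have "(\<Sum>k\<in>K. \<alpha> k * L2_inner \<Omega> (F k) w) = \<alpha> None * L2_inner \<Omega> w w"
    using J(1) \<alpha>J by (simp add: K_def F_def sum.reindex)
  ultimately have "L2_inner \<Omega> w w = 0"
    using inner[of w] F_L2[of None] by (simp add: F_def)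
  then show ?thesis by (simp add: L2_inner_self)
qed

sublocale spec: compact_form "H10 \<Omega>" "L2_inner \<Omega>" "dirichlet_form \<Omega>" lam u
proof
  fix w \<mu>
  assume "w \<in> H10 \<Omega>" "\<And>v. v \<in> H10 \<Omega> \<Longrightarrow> dirichlet_form \<Omega> w v = of_real \<mu> * L2_inner \<Omega> w v" "\<And>j. L2_inner \<Omega> w (u j) = 0"
  then have "L2_norm \<Omega> w = 0"
    by (intro eigenvectors_exhausted[of w \<mu>]) (simp_all add: eigenspace_iff)
  then show "Re (L2_inner \<Omega> w w) = 0" by (simp add: L2_inner_self)
next
  fix j v assume "v \<in> H10 \<Omega>"
  then show "dirichlet_form \<Omega> (u j) v = of_real (lam j) * L2_inner \<Omega> (u j) v"
    using eigenfunctions[of j] by (simp add: eigenspace_iff)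
qed (rule H10_complete Rellich u_H10 orthonormal; assumption)+

text \<open>The Fourier energies of the first N eigenfunctions are summed.
  \<open>fourier_energy_ge\<close> bounds each from below by its eigenvalue, while at every fixed
  \<xi> Bessel's inequality bounds the sum of the squared transforms by the measure of \<Omega>,
  independently of N.\<close>

lemma counting_bound:
  assumes s: "s > 0"
  shows "(\<Sum>j<N. (4 * pi\<^sup>2) powr (real CARD('n) / 2) - 4 * s * (8 * pi\<^sup>2) powr (real CARD('n) / 2) * lam j)
    \<le> measure lebesgue \<Omega> * (pi / s) powr (real CARD('n) / 2)"
proof -
  let ?P = "(4 * pi\<^sup>2) powr (real CARD('n) / 2)" and ?Q = "(8 * pi\<^sup>2) powr (real CARD('n) / 2)"
  have "(\<Sum>j<N. ?P - 4 * s * ?Q * lam j) \<le> (\<Sum>j<N. fourier_energy s (u j))"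
  proof (rule sum_mono)
    fix j
    have g: "h10_grad \<Omega> (u j) (weak_grad \<Omega> (u j))" by (rule H10_imp_h10_grad[OF u_H10])
    have "(L2_norm \<Omega> (u j))\<^sup>2 = 1"
      using orthonormal[of j j] Re_L2_inner_self[of "u j"] by simp
    moreover have "(L2_norm \<Omega> (weak_grad \<Omega> (u j)))\<^sup>2 = lam j"
      using spec.eigen[OF u_H10, of j j] orthonormal[of j j] by (simp flip: Re_dirichlet_form_self[OF g])
    ultimately show "?P - 4 * s * ?Q * lam j \<le> fourier_energy s (u j)"
      using fourier_energy_ge[OF s g] by simp
  qed
  also have "\<dots> = (LINT \<xi>|lborel. (\<Sum>j<N. exp (- s * (norm \<xi>)\<^sup>2) * (norm (L2_inner \<Omega> (u j) (plane_wave \<xi>)))\<^sup>2))"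
    unfolding fourier_energy_def
    by (rule Bochner_Integration.integral_sum[symmetric]) (rule fourier_energy_integrable[OF u_L2 s])
  also have "\<dots> \<le> (LINT \<xi>|lborel. measure lebesgue \<Omega> * exp (- s * (norm (\<xi>::real^'n))\<^sup>2))"
  proof (rule integral_mono)
    show "integrable lborel (\<lambda>\<xi>. \<Sum>j<N. exp (- s * (norm \<xi>)\<^sup>2) * (norm (L2_inner \<Omega> (u j) (plane_wave \<xi>)))\<^sup>2)"
      by (intro Bochner_Integration.integrable_sum fourier_energy_integrable u_L2 s)
    show "integrable lborel (\<lambda>\<xi>::real^'n. measure lebesgue \<Omega> * exp (- s * (norm \<xi>)\<^sup>2))"
      by (intro integrable_mult_right gaussian_integral s)
    fix \<xi> :: "real^'n"
    \<comment> \<open>The roles are exchanged: the transforms of the \<open>u j\<close> at \<xi>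
      are, up to conjugation, the coefficients of one plane wave in the orthonormal system.\<close>
    have "norm (L2_inner \<Omega> (u j) (plane_wave \<xi>)) = norm (L2_inner \<Omega> (plane_wave \<xi>) (u j))" for j
      using L2_inner_commute[of \<Omega> "u j" "plane_wave \<xi>"] by simp
    then have "(\<Sum>j<N. (norm (L2_inner \<Omega> (u j) (plane_wave \<xi>)))\<^sup>2) \<le> (L2_norm \<Omega> (plane_wave \<xi>))\<^sup>2"
      using L2.Bessel[OF u_L2 orthonormal plane_wave_L2[of \<xi>], of N] by (simp add: Re_L2_inner_self)
    then have "exp (- s * (norm \<xi>)\<^sup>2) * (\<Sum>j<N. (norm (L2_inner \<Omega> (u j) (plane_wave \<xi>)))\<^sup>2)
        \<le> exp (- s * (norm \<xi>)\<^sup>2) * measure lebesgue \<Omega>"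
      by (intro mult_left_mono) (simp_all add: L2_norm_plane_wave)
    then show "(\<Sum>j<N. exp (- s * (norm \<xi>)\<^sup>2) * (norm (L2_inner \<Omega> (u j) (plane_wave \<xi>)))\<^sup>2)
        \<le> measure lebesgue \<Omega> * exp (- s * (norm \<xi>)\<^sup>2)"
      by (simp add: sum_distrib_left mult.commute)
  qed
  also have "\<dots> = measure lebesgue \<Omega> * (pi / s) powr (real CARD('n) / 2)"
    using gaussian_integral(2)[OF s, where 'a="real^'n"] by simp
  finally show ?thesis .
qed

text \<open>In \<open>counting_bound\<close> with N = j + 1 the parameter s is taken of order 1 /
  \<open>lam j\<close>; since \<open>lam\<close> is nondecreasing every summand is then at least
  half of the leading constant. This is Weyl's order of growth, and \<open>max 1\<close> keeps s
  well defined for small eigenvalues.\<close>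

lemma eigenvalue_growth: "\<exists>K. \<forall>j. real (Suc j) \<le> K * (max 1 (lam j)) powr (real CARD('n) / 2)"
proof -
  let ?d = "real CARD('n) / 2"
  let ?P = "(4 * pi\<^sup>2) powr ?d" and ?Q = "(8 * pi\<^sup>2) powr ?d"
  have PQ: "?P > 0" "?Q > 0" by simp_all
  have "real (Suc j) \<le> (2 * measure lebesgue \<Omega> / ?P * (8 * pi * ?Q / ?P) powr ?d) * (max 1 (lam j)) powr ?d" for j
  proof -
    define m where "m = max 1 (lam j)"
    have m: "m \<ge> 1" "lam j \<le> m" by (auto simp: m_def)
    \<comment> \<open>This value makes 4 s Q m equal to P / 2.\<close>
    define s where "s = ?P / (8 * ?Q * m)"
    have s: "s > 0" unfolding s_def using m PQ by (intro divide_pos_pos mult_pos_pos) auto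
    have sm: "4 * s * ?Q * m = ?P / 2" unfolding s_def using m PQ by (simp add: field_simps)
    have "real (Suc j) * (?P / 2) = (\<Sum>i<Suc j. ?P / 2)" by simp
    also have "\<dots> \<le> (\<Sum>i<Suc j. ?P - 4 * s * ?Q * lam i)"
    proof (rule sum_mono)
      fix i assume "i \<in> {..<Suc j}"
      then have "lam i \<le> m"
        using eigenvalues m(2) unfolding dirichlet_eigenvalues_def incseq_def
        by (meson lessThan_iff less_Suc_eq_le order.trans)
      then have "4 * s * ?Q * lam i \<le> 4 * s * ?Q * m"
        using s PQ by (intro mult_left_mono) auto
      with sm show "?P / 2 \<le> ?P - 4 * s * ?Q * lam i" by linarith
    qed
    also have "\<dots> \<le> measure lebesgue \<Omega> * (pi / s) powr ?d" by (rule counting_bound[OF s])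
    also have "pi / s = 8 * pi * ?Q / ?P * m" unfolding s_def using m PQ by (simp add: field_simps)
    also have "(8 * pi * ?Q / ?P * m) powr ?d = (8 * pi * ?Q / ?P) powr ?d * m powr ?d"
      by (rule powr_mult)
    finally have "real (Suc j) * (?P / 2) \<le> measure lebesgue \<Omega> * ((8 * pi * ?Q / ?P) powr ?d * m powr ?d)" .
    then have "real (Suc j) \<le> measure lebesgue \<Omega> * ((8 * pi * ?Q / ?P) powr ?d * m powr ?d) / (?P / 2)"
      using PQ(1) by (simp only: pos_le_divide_eq half_gt_zero)
    also have "\<dots> = (2 * measure lebesgue \<Omega> / ?P * (8 * pi * ?Q / ?P) powr ?d) * m powr ?d"
      by simp
    finally show ?thesis by (simp only: m_def)
  qed
  then show ?thesis by blast
qed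

text \<open>By \<open>eigenvalue_growth\<close> (j + 1)^2 is at most a constant times the d-th power
  of \<open>max 1 (lam j)\<close>, which the exponential absorbs; the terms are of order 1 / (j +
  1)^2.\<close>

lemma heat_trace_summable:
  assumes t: "t > 0"
  shows "summable (\<lambda>j. exp (- lam j * t))"
proof -
  let ?D = "CARD('n)"
  obtain K where K: "\<And>j. real (Suc j) \<le> K * (max 1 (lam j)) powr (real ?D / 2)"
    using eigenvalue_growth by blast
  let ?C = "exp t * (fact ?D / t ^ ?D) * K\<^sup>2"
  have le: "exp (- lam j * t) \<le> ?C * inverse (real (Suc j) ^ 2)" for j
  proof -
    define m where "m = max 1 (lam j)"
    have m: "m \<ge> 1" "m \<le> lam j + 1" using spec.lam_nonneg[of j] by (auto simp: m_def)
    \<comment> \<open>Squaring turns the real exponent d / 2 into the natural power d, which can be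
      compared with one term of the exponential series, and produces a summable majorant.\<close>
    have "(real (Suc j))\<^sup>2 \<le> (K * m powr (real ?D / 2))\<^sup>2"
      using K[of j] unfolding m_def by (intro power_mono) auto
    also have "\<dots> = K\<^sup>2 * m ^ ?D"
      using m by (simp add: power_mult_distrib powr_powr flip: powr_realpow powr_numeral)
    finally have 1: "(real (Suc j))\<^sup>2 \<le> K\<^sup>2 * m ^ ?D" .
    have 2: "(m * t) ^ ?D \<le> fact ?D * exp (m * t)"
      using power_over_fact_le_exp[of "m * t" ?D] m t by (simp add: field_simps)
    have "exp (- lam j * t) * (real (Suc j))\<^sup>2 \<le> (exp t * exp (- (m * t))) * (K\<^sup>2 * m ^ ?D)"
    proof (rule mult_mono)
      \<comment> \<open>Passing from \<open>lam j\<close> to \<open>m\<close>, which exceeds it by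
        at most 1, costs the factor exp t.\<close>
      have "(m - 1) * t \<le> lam j * t" using m t by (intro mult_right_mono) auto
      then show "exp (- lam j * t) \<le> exp t * exp (- (m * t))"
        unfolding exp_add[symmetric] by (simp add: algebra_simps)
    qed (use 1 in auto)
    also have "\<dots> = exp t * exp (- (m * t)) * K\<^sup>2 / t ^ ?D * (m * t) ^ ?D"
      using t by (simp add: power_mult_distrib)
    also have "\<dots> \<le> exp t * exp (- (m * t)) * K\<^sup>2 / t ^ ?D * (fact ?D * exp (m * t))"
      using t by (intro mult_left_mono 2) auto
    also have "\<dots> = ?C * (exp (- (m * t)) * exp (m * t))" by simp
    also have "\<dots> = ?C" by (simp flip: exp_add)
    finally have "exp (- lam j * t) * (real (Suc j))\<^sup>2 \<le> ?C" .
    moreover have "0 < (real (Suc j))\<^sup>2" by simp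
    ultimately show ?thesis by (simp only: divide_inverse[symmetric] pos_le_divide_eq)
  qed
  have "summable (\<lambda>j. ?C * inverse (real (Suc j) ^ 2))"
    using summable_Suc_iff[of "\<lambda>n. inverse (real n ^ 2)"] inverse_power_summable[of 2, where 'a=real]
    by (intro summable_mult) simp
  then show ?thesis
    by (rule summable_comparison_test'[where N = 0]) (simp only: real_norm_def abs_exp_cancel le)
qed

section \<open>Estimates for a fixed weight \<phi> and time t\<close>

context
  fixes \<phi> :: "real ^ 'n \<Rightarrow> real" and t :: real
  assumes \<phi>: "(\<lambda>x. complex_of_real (\<phi> x)) \<in> H10 \<Omega>" "\<phi> \<in> Linf \<Omega>"
    and nonzero: "\<not> (AE x in lebesgue_on \<Omega>. \<phi> x = 0)" and t: "t > 0"
begin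

lemma L2_norm_phi: "L2_norm \<Omega> (\<lambda>x. complex_of_real (\<phi> x)) = L2_norm \<Omega> \<phi>"
  by (simp add: L2_norm_def)

lemma L2_norm_phi_pos: "L2_norm \<Omega> \<phi> > 0"
proof -
  have "L2_norm \<Omega> (\<lambda>x. complex_of_real (\<phi> x)) \<noteq> 0"
    using L2_norm_eq_0_AE[OF H10_L2[OF \<phi>(1)]] nonzero by auto
  then show ?thesis using L2_norm_nonneg[of \<Omega> \<phi>] unfolding L2_norm_phi by linarith
qed

lemma phi_u_L2: "(\<lambda>x. complex_of_real (\<phi> x) * u j x) \<in> L2 \<Omega>"
  using Linf_norm_bound(1)[OF \<phi>(2) nonzero] L2_borel_measurable[OF H10_L2[OF \<phi>(1)]]
  by (intro L2_bounded_mult[where C = "Linf_norm \<Omega> \<phi>"] u_L2) auto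

lemma L2_norm_phi_u: "(L2_norm \<Omega> (\<lambda>x. complex_of_real (\<phi> x) * u j x))\<^sup>2 \<le> (Linf_norm \<Omega> \<phi>)\<^sup>2"
proof -
  have "(L2_norm \<Omega> (\<lambda>x. complex_of_real (\<phi> x) * u j x))\<^sup>2 \<le> (LINT x|lebesgue_on \<Omega>. (Linf_norm \<Omega> \<phi>)\<^sup>2 * (norm (u j x))\<^sup>2)"
    unfolding L2_norm_power2
  proof (rule integral_mono_AE)
    show "AE x in lebesgue_on \<Omega>. (norm (complex_of_real (\<phi> x) * u j x))\<^sup>2 \<le> (Linf_norm \<Omega> \<phi>)\<^sup>2 * (norm (u j x))\<^sup>2"
      using Linf_norm_bound(1)[OF \<phi>(2) nonzero]
    proof eventually_elim
      case (elim x)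
      then have "\<bar>\<phi> x\<bar>\<^sup>2 \<le> (Linf_norm \<Omega> \<phi>)\<^sup>2" by (intro power_mono) auto
      then show ?case by (simp add: norm_mult power_mult_distrib mult_right_mono)
    qed
  qed (intro L2_integrable integrable_mult_right phi_u_L2 u_L2)+
  also have "\<dots> = (Linf_norm \<Omega> \<phi>)\<^sup>2"
    using orthonormal[of j j] Re_L2_inner_self[of "u j"] by (simp add: L2_norm_power2)
  finally show ?thesis .
qed

lemma weighted_summable: "summable (\<lambda>j. exp (- lam j * t) * (L2_norm \<Omega> (\<lambda>x. complex_of_real (\<phi> x) * u j x))\<^sup>2)"
proof (rule summable_comparison_test'[OF summable_mult2[OF heat_trace_summable[OF t]], of 0])
  show "norm (exp (- lam j * t) * (L2_norm \<Omega> (\<lambda>x. complex_of_real (\<phi> x) * u j x))\<^sup>2)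
      \<le> exp (- lam j * t) * (Linf_norm \<Omega> \<phi>)\<^sup>2" for j
    using L2_norm_phi_u[of j] by (simp add: abs_mult)
qed

text \<open>\<open>exp_Jensen\<close> for the modulated function, whose squared norm does not depend
  on \<xi> and whose energy is G plus |\<xi>|^2 times that squared norm. After division by the
  squared norm the exponent splits, so the dependence on \<xi> is a pure Gaussian.\<close>

lemma modulated_Jensen:
  fixes \<xi> :: "real ^ 'n"
  defines "G \<equiv> (L2_norm \<Omega> (weak_grad \<Omega> (\<lambda>x. complex_of_real (\<phi> x))))\<^sup>2"
    and "c \<equiv> (\<lambda>j. L2_inner \<Omega> (\<lambda>x. complex_of_real (\<phi> x) * u j x) (plane_wave \<xi>))"
  shows "summable (\<lambda>j. exp (- lam j * t) * (norm (c j))\<^sup>2)"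
    and "(L2_norm \<Omega> \<phi>)\<^sup>2 * exp (- (G / (L2_norm \<Omega> \<phi>)\<^sup>2) * t) * exp (- t * (norm \<xi>)\<^sup>2)
      \<le> (\<Sum>j. exp (- lam j * t) * (norm (c j))\<^sup>2)"
proof -
  let ?f = "\<lambda>x. plane_wave \<xi> x * complex_of_real (\<phi> x)"
  let ?S = "(L2_norm \<Omega> \<phi>)\<^sup>2"
  have g: "h10_grad \<Omega> (\<lambda>x. complex_of_real (\<phi> x)) (weak_grad \<Omega> (\<lambda>x. complex_of_real (\<phi> x)))"
    by (rule H10_imp_h10_grad[OF \<phi>(1)])
  have fg: "h10_grad \<Omega> ?f (\<lambda>x. \<chi> i. plane_wave \<xi> x *
      (weak_grad \<Omega> (\<lambda>x. complex_of_real (\<phi> x)) x $ i + \<i> * of_real (\<xi> $ i) * complex_of_real (\<phi> x)))"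
    by (rule h10_grad_plane_wave[OF g])
  have f: "?f \<in> H10 \<Omega>" by (rule h10_grad_weak_grad(2)[OF fg])
  have nf: "Re (L2_inner \<Omega> ?f ?f) = ?S"
    by (simp add: Re_L2_inner_self L2_norm_mult_plane_wave L2_norm_phi)
  have ef: "Re (dirichlet_form \<Omega> ?f ?f) = G + (norm \<xi>)\<^sup>2 * ?S"
    unfolding Re_dirichlet_form_self[OF fg] energy_plane_wave[OF g] G_def ..
  \<comment> \<open>Since \<phi> is real, conjugation moves the plane wave into the second argument
    and leaves \<phi> with \<open>u j\<close>.\<close>
  have cf: "norm (L2_inner \<Omega> ?f (u j)) = norm (c j)" for j
  proof -
    have "cnj (L2_inner \<Omega> ?f (u j)) = c j"
      unfolding c_def L2_inner_def Bochner_Integration.integral_cnj[symmetric]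
      by (simp add: mult_ac)
    then show ?thesis using complex_mod_cnj by metis
  qed
  have S: "?S > 0" using L2_norm_phi_pos by simp
  note J = exp_Jensen[OF _ spec.Parseval[OF f, unfolded nf] S spec.lam_nonneg
      spec.coeff_summable(2)[OF f] spec.coeff_summable(3)[OF f, unfolded ef] t, unfolded cf]
  show "summable (\<lambda>j. exp (- lam j * t) * (norm (c j))\<^sup>2)"
    using J(1) by simp
  have "- ((G + (norm \<xi>)\<^sup>2 * ?S) / ?S) * t = - (G / ?S) * t + - t * (norm \<xi>)\<^sup>2"
    using S by (simp add: field_simps)
  then have "exp (- ((G + (norm \<xi>)\<^sup>2 * ?S) / ?S) * t) = exp (- (G / ?S) * t) * exp (- t * (norm \<xi>)\<^sup>2)"
    by (simp only: exp_add)
  then show "?S * exp (- (G / ?S) * t) * exp (- t * (norm \<xi>)\<^sup>2)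
      \<le> (\<Sum>j. exp (- lam j * t) * (norm (c j))\<^sup>2)"
    using J(2) by (simp add: mult.assoc)
qed

text \<open>The pointwise bound is multiplied by exp(- a |\<xi>|^2) and integrated. The left side
  becomes a Gaussian integral with parameter a + t; on the right each term is a
  \<open>fourier_energy\<close>, to which \<open>fourier_energy_le\<close> applies. Nonnegative
  integrals allow the sum and the integral to be exchanged freely.\<close>

lemma weighted_heat_trace_regularized:
  defines "G \<equiv> (L2_norm \<Omega> (weak_grad \<Omega> (\<lambda>x. complex_of_real (\<phi> x))))\<^sup>2"
  assumes a: "a > 0"
  shows "(L2_norm \<Omega> \<phi>)\<^sup>2 * exp (- (G / (L2_norm \<Omega> \<phi>)\<^sup>2) * t) * (pi / (a + t)) powr (real CARD('n) / 2)
    \<le> (4 * pi\<^sup>2) powr (real CARD('n) / 2) *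
      (\<Sum>j. exp (- lam j * t) * (L2_norm \<Omega> (\<lambda>x. complex_of_real (\<phi> x) * u j x))\<^sup>2)"
proof -
  let ?P = "(4 * pi\<^sup>2) powr (real CARD('n) / 2)"
  let ?A = "(L2_norm \<Omega> \<phi>)\<^sup>2 * exp (- (G / (L2_norm \<Omega> \<phi>)\<^sup>2) * t)"
  let ?pu = "\<lambda>j x. complex_of_real (\<phi> x) * u j x"
  let ?N = "\<lambda>j. (L2_norm \<Omega> (?pu j))\<^sup>2"
  let ?c = "\<lambda>j \<xi>. (norm (L2_inner \<Omega> (?pu j) (plane_wave \<xi>)))\<^sup>2"
  have at: "a + t > 0" using a t by simp
  have [measurable]: "(\<lambda>\<xi>. L2_inner \<Omega> (?pu j) (plane_wave \<xi>)) \<in> borel_measurable borel" for j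
    by (rule fourier_measurable[OF phi_u_L2])
  have "ennreal (?A * (pi / (a + t)) powr (real CARD('n) / 2)) = (\<integral>\<^sup>+\<xi>. ennreal (?A * exp (- (a + t) * (norm (\<xi>::real^'n))\<^sup>2)) \<partial>lborel)"
    using gaussian_integral[OF at, where 'a="real^'n"]
    by (subst nn_integral_eq_integral) simp_all
  also have "\<dots> \<le> (\<integral>\<^sup>+\<xi>. (\<Sum>j. ennreal (exp (- lam j * t)) * ennreal (exp (- a * (norm \<xi>)\<^sup>2) * ?c j \<xi>)) \<partial>lborel)"
  proof (rule nn_integral_mono)
    fix \<xi> :: "real^'n"
    note J = modulated_Jensen[of \<xi>, folded G_def]
    have "?A * exp (- (a + t) * (norm \<xi>)\<^sup>2) = exp (- a * (norm \<xi>)\<^sup>2) * (?A * exp (- t * (norm \<xi>)\<^sup>2))"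
      by (simp add: algebra_simps flip: exp_add)
    also have "\<dots> \<le> exp (- a * (norm \<xi>)\<^sup>2) * (\<Sum>j. exp (- lam j * t) * ?c j \<xi>)"
      by (intro mult_left_mono J(2)) simp
    also have "\<dots> = (\<Sum>j. exp (- a * (norm \<xi>)\<^sup>2) * (exp (- lam j * t) * ?c j \<xi>))"
      by (rule suminf_mult[OF J(1), symmetric])
    finally have "ennreal (?A * exp (- (a + t) * (norm \<xi>)\<^sup>2)) \<le> ennreal (\<Sum>j. exp (- a * (norm \<xi>)\<^sup>2) * (exp (- lam j * t) * ?c j \<xi>))"
      by (rule ennreal_leI)
    also have "\<dots> = (\<Sum>j. ennreal (exp (- a * (norm \<xi>)\<^sup>2) * (exp (- lam j * t) * ?c j \<xi>)))"
      by (rule suminf_ennreal2[symmetric]) (simp, rule summable_mult[OF J(1)])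
    also have "\<dots> = (\<Sum>j. ennreal (exp (- lam j * t)) * ennreal (exp (- a * (norm \<xi>)\<^sup>2) * ?c j \<xi>))"
      by (simp add: mult.left_commute flip: ennreal_mult)
    finally show "ennreal (?A * exp (- (a + t) * (norm \<xi>)\<^sup>2))
      \<le> (\<Sum>j. ennreal (exp (- lam j * t)) * ennreal (exp (- a * (norm \<xi>)\<^sup>2) * ?c j \<xi>))" .
  qed
  also have "\<dots> = (\<Sum>j. \<integral>\<^sup>+\<xi>. ennreal (exp (- lam j * t)) * ennreal (exp (- a * (norm \<xi>)\<^sup>2) * ?c j \<xi>) \<partial>lborel)"
    by (rule nn_integral_suminf) measurable
  also have "\<dots> = (\<Sum>j. ennreal (exp (- lam j * t) * fourier_energy a (?pu j)))"
  proof (rule suminf_cong)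
    fix j
    have "(\<integral>\<^sup>+\<xi>. ennreal (exp (- lam j * t)) * ennreal (exp (- a * (norm \<xi>)\<^sup>2) * ?c j \<xi>) \<partial>lborel)
        = ennreal (exp (- lam j * t)) * (\<integral>\<^sup>+\<xi>. ennreal (exp (- a * (norm \<xi>)\<^sup>2) * ?c j \<xi>) \<partial>lborel)"
      by (rule nn_integral_cmult) measurable
    also have "(\<integral>\<^sup>+\<xi>. ennreal (exp (- a * (norm \<xi>)\<^sup>2) * ?c j \<xi>) \<partial>lborel) = ennreal (fourier_energy a (?pu j))"
      unfolding fourier_energy_def
      by (rule nn_integral_eq_integral[OF fourier_energy_integrable[OF phi_u_L2 a]]) simp
    finally show "(\<integral>\<^sup>+\<xi>. ennreal (exp (- lam j * t)) * ennreal (exp (- a * (norm \<xi>)\<^sup>2) * ?c j \<xi>) \<partial>lborel)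
        = ennreal (exp (- lam j * t) * fourier_energy a (?pu j))"
      by (simp add: ennreal_mult fourier_energy_nonneg)
  qed
  also have "\<dots> \<le> (\<Sum>j. ennreal (?P * (exp (- lam j * t) * ?N j)))"
  proof (intro suminf_le ennreal_leI)
    fix j
    show "exp (- lam j * t) * fourier_energy a (?pu j) \<le> ?P * (exp (- lam j * t) * ?N j)"
      using mult_left_mono[OF fourier_energy_le[OF a phi_u_L2[of j]], of "exp (- lam j * t)"]
      by (simp add: mult_ac)
  qed auto
  also have "\<dots> = ennreal (\<Sum>j. ?P * (exp (- lam j * t) * ?N j))"
    by (rule suminf_ennreal2) (simp, rule summable_mult[OF weighted_summable])
  also have "(\<Sum>j. ?P * (exp (- lam j * t) * ?N j)) = ?P * (\<Sum>j. exp (- lam j * t) * ?N j)"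
    by (rule suminf_mult[OF weighted_summable])
  finally have "ennreal (?A * (pi / (a + t)) powr (real CARD('n) / 2)) \<le> ennreal (?P * (\<Sum>j. exp (- lam j * t) * ?N j))" .
  moreover have "0 \<le> ?P * (\<Sum>j. exp (- lam j * t) * ?N j)"
    by (intro mult_nonneg_nonneg suminf_nonneg weighted_summable) auto
  ultimately show ?thesis by (simp only: ennreal_le_iff)
qed

text \<open>The right side of the regularised bound does not involve a, so a may tend to 0 on the
  left alone; then (2 pi)^d cancels.\<close>

lemma weighted_heat_trace_ge:
  defines "G \<equiv> (L2_norm \<Omega> (weak_grad \<Omega> (\<lambda>x. complex_of_real (\<phi> x))))\<^sup>2"
  shows "(4 * pi * t) powr (- real CARD('n) / 2) * (L2_norm \<Omega> \<phi>)\<^sup>2 * exp (- (G / (L2_norm \<Omega> \<phi>)\<^sup>2) * t)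
    \<le> (\<Sum>j. exp (- lam j * t) * (L2_norm \<Omega> (\<lambda>x. complex_of_real (\<phi> x) * u j x))\<^sup>2)"
proof -
  let ?d = "real CARD('n) / 2"
  let ?P = "(4 * pi\<^sup>2) powr ?d"
  let ?A = "(L2_norm \<Omega> \<phi>)\<^sup>2 * exp (- (G / (L2_norm \<Omega> \<phi>)\<^sup>2) * t)"
  let ?S = "\<Sum>j. exp (- lam j * t) * (L2_norm \<Omega> (\<lambda>x. complex_of_real (\<phi> x) * u j x))\<^sup>2"
  have "(\<lambda>n. ?A * (pi / (inverse (real (Suc n)) + t)) powr ?d) \<longlonglongrightarrow> ?A * (pi / (0 + t)) powr ?d"
    using t by (intro tendsto_intros LIMSEQ_inverse_real_of_nat) auto
  then have "?A * (pi / (0 + t)) powr ?d \<le> ?P * ?S"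
  proof (rule LIMSEQ_le_const2)
    show "\<exists>N. \<forall>n\<ge>N. ?A * (pi / (inverse (real (Suc n)) + t)) powr ?d \<le> ?P * ?S"
      using weighted_heat_trace_regularized[folded G_def, of "inverse (real (Suc n))" for n] by auto
  qed
  \<comment> \<open>The source of the constant: pi / t is 4 pi^2 divided by 4 pi t, and the first
    factor is the mass of the Gauss kernel.\<close>
  moreover have "(pi / (0 + t)) powr ?d = ?P * (4 * pi * t) powr (- ?d)"
  proof -
    have "pi / (0 + t) = (4 * pi\<^sup>2) * inverse (4 * pi * t)"
      using t by (simp add: field_simps power2_eq_square)
    then have "(pi / (0 + t)) powr ?d = ?P * inverse (4 * pi * t) powr ?d"
      by (simp only: powr_mult)
    also have "inverse (4 * pi * t) powr ?d = (4 * pi * t) powr (- ?d)"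
      unfolding powr_minus by (rule inverse_powr)
    finally show ?thesis .
  qed
  ultimately have "?P * ((4 * pi * t) powr (- ?d) * ?A) \<le> ?P * ?S"
    by (simp add: mult_ac)
  then have "(4 * pi * t) powr (- ?d) * ?A \<le> ?S"
    by (rule mult_left_le_imp_le) simp
  then show ?thesis by (simp add: mult.assoc)
qed

text \<open>The weights in the previous estimate are at most the squared supremum norm of \<phi>,
  and exp(- s) \<ge> 1 - s makes the bound linear in G t. The measure of \<Omega> is absent because
  its two occurrences in the final inequality cancel.\<close>

lemma heat_trace_ge:
  defines "G \<equiv> (L2_norm \<Omega> (weak_grad \<Omega> (\<lambda>x. complex_of_real (\<phi> x))))\<^sup>2"
  shows "1 / (4 * pi * t) powr (real CARD('n) / 2) * (((L2_norm \<Omega> \<phi>)\<^sup>2 - G * t) / (Linf_norm \<Omega> \<phi>)\<^sup>2)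
    \<le> (\<Sum>j. exp (- lam j * t))"
proof -
  let ?L = "(Linf_norm \<Omega> \<phi>)\<^sup>2" and ?S = "(L2_norm \<Omega> \<phi>)\<^sup>2" and ?X = "(4 * pi * t) powr (real CARD('n) / 2)"
  have L: "?L > 0" using Linf_norm_bound(2)[OF \<phi>(2) nonzero] by simp
  have S: "?S > 0" using L2_norm_phi_pos by simp
  have "?S - G * t = ?S * (1 + - (G / ?S) * t)" using S by (simp add: field_simps)
  also have "\<dots> \<le> ?S * exp (- (G / ?S) * t)"
    by (intro mult_left_mono exp_ge_add_one_self) simp
  finally have "1 / ?X * (?S - G * t) \<le> 1 / ?X * (?S * exp (- (G / ?S) * t))"
    by (rule mult_left_mono) simp
  also have "\<dots> = (4 * pi * t) powr (- real CARD('n) / 2) * ?S * exp (- (G / ?S) * t)"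
    by (simp only: minus_divide_left[symmetric] powr_minus_divide mult.assoc)
  also have "\<dots> \<le> (\<Sum>j. exp (- lam j * t) * (L2_norm \<Omega> (\<lambda>x. complex_of_real (\<phi> x) * u j x))\<^sup>2)"
    unfolding G_def by (rule weighted_heat_trace_ge)
  also have "\<dots> \<le> (\<Sum>j. exp (- lam j * t) * ?L)"
    by (intro suminf_le weighted_summable summable_mult2 heat_trace_summable t mult_left_mono L2_norm_phi_u) simp
  also have "\<dots> = (\<Sum>j. exp (- lam j * t)) * ?L"
    by (rule suminf_mult2[OF heat_trace_summable[OF t], symmetric])
  finally have "1 / ?X * (?S - G * t) / ?L \<le> (\<Sum>j. exp (- lam j * t))"
    using L by (simp only: pos_divide_le_eq)
  then show ?thesis by simp
qed

end

end

theorem corollary2p5: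
  fixes \<Omega> :: "(real ^ 'n) set"
    and lam :: "nat \<Rightarrow> real"
    and u :: "nat \<Rightarrow> real ^ 'n \<Rightarrow> complex"
    and \<phi> :: "real ^ 'n \<Rightarrow> real"
    and t :: real
  assumes "CARD('n) \<ge> 2"
    and "open \<Omega>" and "connected \<Omega>" and "\<Omega> \<noteq> {}" and "bounded \<Omega>"
    and "dirichlet_eigenvalues \<Omega> lam"
    and "\<And>j. u j \<in> eigenspace \<Omega> (lam j)"
    and "\<And>i j. L2_inner \<Omega> (u i) (u j) = (if i = j then 1 else 0)"
    and "(\<lambda>x. complex_of_real (\<phi> x)) \<in> H10 \<Omega>" and "\<phi> \<in> Linf \<Omega>"
    and "\<not> (AE x in lebesgue_on \<Omega>. \<phi> x = 0)"
    and "t > 0"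
  shows "(summable (\<lambda>j. exp (- lam j * t) * (L2_norm \<Omega> (\<lambda>x. complex_of_real (\<phi> x) * u j x))\<^sup>2)
      \<and> (\<Sum>j. exp (- lam j * t) * (L2_norm \<Omega> (\<lambda>x. complex_of_real (\<phi> x) * u j x))\<^sup>2)
        \<ge> (4 * pi * t) powr (- real CARD('n) / 2) * (L2_norm \<Omega> \<phi>)\<^sup>2
            * exp (- ((L2_norm \<Omega> (weak_grad \<Omega> (\<lambda>x. complex_of_real (\<phi> x))))\<^sup>2
                      / (L2_norm \<Omega> \<phi>)\<^sup>2) * t))
    \<and> (summable (\<lambda>j. exp (- lam j * t))
      \<and> (\<Sum>j. exp (- lam j * t))
        \<ge> measure lebesgue \<Omega> / (4 * pi * t) powr (real CARD('n) / 2)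
          - 1 / (4 * pi * t) powr (real CARD('n) / 2)
            * (((L2_norm \<Omega> (weak_grad \<Omega> (\<lambda>x. complex_of_real (\<phi> x))))\<^sup>2 * t
                 + measure lebesgue \<Omega> * (Linf_norm \<Omega> \<phi>)\<^sup>2 - (L2_norm \<Omega> \<phi>)\<^sup>2)
               / (Linf_norm \<Omega> \<phi>)\<^sup>2))"
proof -
  interpret dirichlet_spectrum \<Omega> lam u
    by unfold_locales (use assms(2,5,6,7,8) in auto)
  note \<phi> = assms(9,10,11,12)
  have L: "(Linf_norm \<Omega> \<phi>)\<^sup>2 > 0"
    using Linf_norm_bound(2)[OF \<phi>(2,3)] by simp
  \<comment> \<open>The two terms containing the measure V of \<Omega> cancel, which reduces the
    claimed right-hand side to that of \<open>heat_trace_ge\<close>; the positive supremum norm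
    makes the division legitimate.\<close>
  have eq: "V / X - 1 / X * ((g + V * l - s) / l) = 1 / X * ((s - g) / l)" if "l > 0" for V X g l s :: real
  proof -
    have "(g + V * l - s) / l = V - (s - g) / l"
      using that by (simp add: field_simps)
    then show ?thesis by (simp add: right_diff_distrib)
  qed
  show ?thesis
    unfolding eq[OF L]
    using weighted_summable[OF \<phi>] weighted_heat_trace_ge[OF \<phi>] heat_trace_summable[OF assms(12)] heat_trace_ge[OF \<phi>]
    by blast
qed

end
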